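(* Let $AP$ be a finite set of atomic propositions. (i) Let $k\in K_1\setminus\{-\infty,\infty\}$. Given $\varphi\in k\text{-}t\text{-}RULTL(K_1,AP)$ and a weighted Büchi automaton $\mathcal{M}$ over $K_1$ and $\mathcal{P}(AP)$, it is decidable whether $\|\varphi\|=\|\mathcal{M}\|$. (ii) Let $k\in K_2\setminus\{-\infty,\infty\}$. Given $\varphi\in k\text{-}\vee\text{-}t\text{-}RULTL(K_2,AP)$ and a weighted Büchi automaton $\mathcal{M}$ over $K_2$ and $\mathcal{P}(AP)$, it is decidable whether $\|\varphi\|=\|\mathcal{M}\|$. (iii) Let $k\in K_3\setminus\{-\infty,\infty\}$. Given $\varphi\in k\text{-}\vee\text{-}t\text{-}RULTL(K_3,AP)$ and a weighted Büchi automaton $\mathcal{M}$ over $K_3$ and $\mathcal{P}(AP)$, it is decidable whether $\|\varphi\|=\|\mathcal{M}\|$.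
   Context: $\overline{\mathbb{Q}}=\mathbb{Q}\cup\{\infty,-\infty\}$ with its usual order. In each of $K_1,K_2,K_3$ the carrier is $\overline{\mathbb{Q}}$, addition $+$ (binary and infinitary) is $\sup$ with zero $\mathbf{0}=-\infty$, product $\cdot$ is $\inf$ with unit $\mathbf{1}=\infty$; the $\omega$-valuation $Val^{\omega}$ on sequences $(d_i)_{i\ge0}$ with finitely many values is: for $K_1$, $\mathrm{liminf}$: $-\infty$ if some $d_i=-\infty$; $\infty$ if all $d_i=\infty$; $\sup_{i\ge0}\inf\{d_k\mid k\ge i,d_k\ne\infty\}$ if no $-\infty$ and infinitely many $d_i\ne\infty$; $\inf\{d_i\mid d_i\ne\infty\}$ otherwise. For $K_2$, $\mathrm{limsup}$: same cases with $\inf_{i\ge0}\sup\{d_k\mid k\ge i,d_k\ne\infty\}$ in the third case and $\sup\{d_i\mid d_i\ne\infty\}$ in the last. For $K_3$, $\sup_{-\infty}$: $-\infty$ if some $d_i=-\infty$; $\infty$ if all $d_i=\infty$; $\sup\{d_k\mid d_k\ne\infty\}$ otherwise. Weighted LTL over $AP$ and $K$: $\varphi::=k\mid a\mid\neg a\mid\varphi\vee\varphi\mid\varphi\wedge\varphi\mid\bigcirc\varphi\mid\varphi U\varphi\mid\square\varphi$; semantics $\|\varphi\|:(\mathcal{P}(AP))^{\omega}\to K$: $(\|k\|,w)=k$; $(\|a\|,w)=\mathbf{1}$ if $a\in w(0)$ else $\mathbf{0}$; $\neg a$ dually; $\vee\mapsto+$, $\wedge\mapsto\cdot$; $(\|\bigcirc\varphi\|,w)=(\|\varphi\|,w_{\ge1})$;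 $(\|\varphi U\psi\|,w)=\sum_{i\ge0}Val^{\omega}((\|\varphi\|,w_{\ge0}),\dots,(\|\varphi\|,w_{\ge i-1}),(\|\psi\|,w_{\ge i}),\mathbf{1},\mathbf{1},\dots)$; $(\|\square\varphi\|,w)=Val^{\omega}(((\|\varphi\|,w_{\ge i}))_{i\ge0})$. $true:=\mathbf{1}$, $\varphi\tilde U\psi:=\square\varphi\vee(\varphi U\psi)$. $sbLTL(K,AP)$: $\varphi::=true\mid a\mid\neg a\mid\varphi\vee\varphi\mid\varphi\wedge\varphi\mid\bigcirc\varphi\mid\varphi\tilde U\varphi\mid\square\varphi$. $L_k=\{k'\ge k\}$. $k\text{-}stLTL(K,AP)$: formulas $\bigvee_{i=1}^n(k_i\wedge\varphi_i)$, $k_i\in L_k\setminus\{\mathbf{0},\mathbf{1}\}$, $\varphi_i\in sbLTL(K,AP)$. $k\text{-}t\text{-}RULTL(K,AP)$ is the least class containing $L_k$, $sbLTL(K,AP)$, $k\text{-}stLTL(K,AP)$, closed under $\bigcirc$ and $\vee$, containing $\varphi\wedge\psi,\psi\wedge\varphi$ whenever $\varphi\in sbLTL(K,AP)$ and $\psi\in k\text{-}stLTL(K,AP)$ or $\psi=\xi\tilde U\lambda$ or $\psi=\square\xi$ with $\xi,\lambda\in k\text{-}stLTL(K,AP)$, and containing $\varphi\tilde U\psi$ and $\square\varphi$ for $\varphi,\psi\in k\text{-}stLTL(K,AP)$. $k\text{-}\vee\text{-}t\text{-}RULTL(K,AP)$ is defined identically except closure under $\vee$ is replaced by: if $\varphi,\psi\in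 k\text{-}stLTL(K,AP)$ then $\varphi\vee\psi$ is in it. A weighted Büchi automaton over alphabet $B$ and $K$ is $(Q,wt,I,F)$, finite $Q$, $wt:Q\times B\times Q\to\overline{\mathbb{Q}}$, $I,F\subseteq Q$; path weight is $Val^{\omega}$ of the transition-weight sequence; successful paths start in $I$ and visit $F$ infinitely often; the behavior is the supremum of the weights of successful paths over each word. *)

theory Defs
  imports Complex_Main "HOL-Library.Extended_Real" "HOL-Library.Nat_Bijection"
begin

datatype qbar = QMInf | QFin rat | QPInf

fun qval :: "qbar \<Rightarrow> ereal" where
  "qval QMInf = -\<infinity>"
| "qval (QFin q) = ereal (of_rat q)"
| "qval QPInf = \<infinity>"

section \<open>omega-valuation functions (on sequences with finitely many values)\<close>

definition val_liminf :: "(nat \<Rightarrow> ereal) \<Rightarrow> ereal" where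
  "val_liminf d =
    (if \<exists>i. d i = -\<infinity> then -\<infinity>
     else if \<forall>i. d i = \<infinity> then \<infinity>
     else if infinite {i. d i \<noteq> \<infinity>}
       then (SUP i. INF k\<in>{k. i \<le> k \<and> d k \<noteq> \<infinity>}. d k)
     else (INF i\<in>{i. d i \<noteq> \<infinity>}. d i))"

definition val_limsup :: "(nat \<Rightarrow> ereal) \<Rightarrow> ereal" where
  "val_limsup d =
    (if \<exists>i. d i = -\<infinity> then -\<infinity>
     else if \<forall>i. d i = \<infinity> then \<infinity>
     else if infinite {i. d i \<noteq> \<infinity>}
       then (INF i. SUP k\<in>{k. i \<le> k \<and> d k \<noteq> \<infinity>}. d k)
     else (SUP i\<in>{i. d i \<noteq> \<infinity>}. d i))"

definition val_supm :: "(nat \<Rightarrow> ereal) \<Rightarrow> ereal" where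
  "val_supm d =
    (if \<exists>i. d i = -\<infinity> then -\<infinity>
     else if \<forall>i. d i = \<infinity> then \<infinity>
     else (SUP k\<in>{k. d k \<noteq> \<infinity>}. d k))"

datatype form =
    FConst qbar
  | FAtom nat
  | FNAtom nat
  | FOr form form
  | FAnd form form
  | FNext form
  | FUntil form form
  | FBox form

definition ftrue :: form where "ftrue = FConst QPInf"

definition FTU :: "form \<Rightarrow> form \<Rightarrow> form" where
  "FTU \<phi> \<psi> = FOr (FBox \<phi>) (FUntil \<phi> \<psi>)"

fun atoms :: "form \<Rightarrow> nat set" where
  "atoms (FConst k) = {}"
| "atoms (FAtom a) = {a}"
| "atoms (FNAtom a) = {a}"
| "atoms (FOr \<phi> \<psi>) = atoms \<phi> \<union> atoms \<psi>"
| "atoms (FAnd \<phi> \<psi>) = atoms \<phi> \<union> atoms \<psi>"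
| "atoms (FNext \<phi>) = atoms \<phi>"
| "atoms (FUntil \<phi> \<psi>) = atoms \<phi> \<union> atoms \<psi>"
| "atoms (FBox \<phi>) = atoms \<phi>"

definition suffix :: "nat \<Rightarrow> (nat \<Rightarrow> 'a) \<Rightarrow> (nat \<Rightarrow> 'a)" where
  "suffix i w = (\<lambda>j. w (i + j))"

text \<open>Semantics; the parameter V is the omega-valuation of the valuation monoid.
  Addition is sup, product is inf, zero is -\<infinity>, unit is \<infinity>.\<close>
fun sem :: "((nat \<Rightarrow> ereal) \<Rightarrow> ereal) \<Rightarrow> form \<Rightarrow> (nat \<Rightarrow> nat set) \<Rightarrow> ereal" where
  "sem V (FConst k) w = qval k"
| "sem V (FAtom a) w = (if a \<in> w 0 then \<infinity> else -\<infinity>)"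
| "sem V (FNAtom a) w = (if a \<in> w 0 then -\<infinity> else \<infinity>)"
| "sem V (FOr \<phi> \<psi>) w = sup (sem V \<phi> w) (sem V \<psi> w)"
| "sem V (FAnd \<phi> \<psi>) w = inf (sem V \<phi> w) (sem V \<psi> w)"
| "sem V (FNext \<phi>) w = sem V \<phi> (suffix 1 w)"
| "sem V (FUntil \<phi> \<psi>) w =
     (SUP i. V (\<lambda>j. if j < i then sem V \<phi> (suffix j w)
                     else if j = i then sem V \<psi> (suffix i w) else \<infinity>))"
| "sem V (FBox \<phi>) w = V (\<lambda>i. sem V \<phi> (suffix i w))"

inductive sbLTL :: "form \<Rightarrow> bool" where
  "sbLTL ftrue"
| "sbLTL (FAtom a)"
| "sbLTL (FNAtom a)"
| "sbLTL \<phi> \<Longrightarrow> sbLTL \<psi> \<Longrightarrow> sbLTL (FOr \<phi> \<psi>)"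
| "sbLTL \<phi> \<Longrightarrow> sbLTL \<psi> \<Longrightarrow> sbLTL (FAnd \<phi> \<psi>)"
| "sbLTL \<phi> \<Longrightarrow> sbLTL (FNext \<phi>)"
| "sbLTL \<phi> \<Longrightarrow> sbLTL \<psi> \<Longrightarrow> sbLTL (FTU \<phi> \<psi>)"
| "sbLTL \<phi> \<Longrightarrow> sbLTL (FBox \<phi>)"

inductive stLTL :: "qbar \<Rightarrow> form \<Rightarrow> bool" for k where
  "qval k \<le> qval ki \<Longrightarrow> ki \<noteq> QMInf \<Longrightarrow> ki \<noteq> QPInf \<Longrightarrow> sbLTL \<phi>
     \<Longrightarrow> stLTL k (FAnd (FConst ki) \<phi>)"
| "stLTL k \<phi> \<Longrightarrow> stLTL k \<psi> \<Longrightarrow> stLTL k (FOr \<phi> \<psi>)"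

definition stRight :: "qbar \<Rightarrow> form \<Rightarrow> bool" where
  "stRight k \<psi> \<longleftrightarrow> stLTL k \<psi>
     \<or> (\<exists>\<xi> \<zeta>. \<psi> = FTU \<xi> \<zeta> \<and> stLTL k \<xi> \<and> stLTL k \<zeta>)
     \<or> (\<exists>\<xi>. \<psi> = FBox \<xi> \<and> stLTL k \<xi>)"

inductive tRULTL :: "qbar \<Rightarrow> form \<Rightarrow> bool" for k where
  "qval k \<le> qval k' \<Longrightarrow> tRULTL k (FConst k')"
| "sbLTL \<phi> \<Longrightarrow> tRULTL k \<phi>"
| "stLTL k \<phi> \<Longrightarrow> tRULTL k \<phi>"
| "tRULTL k \<phi> \<Longrightarrow> tRULTL k (FNext \<phi>)"
| "tRULTL k \<phi> \<Longrightarrow> tRULTL k \<psi> \<Longrightarrow> tRULTL k (FOr \<phi> \<psi>)"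
| "sbLTL \<phi> \<Longrightarrow> stRight k \<psi> \<Longrightarrow> tRULTL k (FAnd \<phi> \<psi>)"
| "sbLTL \<phi> \<Longrightarrow> stRight k \<psi> \<Longrightarrow> tRULTL k (FAnd \<psi> \<phi>)"
| "stLTL k \<phi> \<Longrightarrow> stLTL k \<psi> \<Longrightarrow> tRULTL k (FTU \<phi> \<psi>)"
| "stLTL k \<phi> \<Longrightarrow> tRULTL k (FBox \<phi>)"

inductive vtRULTL :: "qbar \<Rightarrow> form \<Rightarrow> bool" for k where
  "qval k \<le> qval k' \<Longrightarrow> vtRULTL k (FConst k')"
| "sbLTL \<phi> \<Longrightarrow> vtRULTL k \<phi>"
| "stLTL k \<phi> \<Longrightarrow> vtRULTL k \<phi>"
| "vtRULTL k \<phi> \<Longrightarrow> vtRULTL k (FNext \<phi>)"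
| "stLTL k \<phi> \<Longrightarrow> stLTL k \<psi> \<Longrightarrow> vtRULTL k (FOr \<phi> \<psi>)"
| "sbLTL \<phi> \<Longrightarrow> stRight k \<psi> \<Longrightarrow> vtRULTL k (FAnd \<phi> \<psi>)"
| "sbLTL \<phi> \<Longrightarrow> stRight k \<psi> \<Longrightarrow> vtRULTL k (FAnd \<psi> \<phi>)"
| "stLTL k \<phi> \<Longrightarrow> stLTL k \<psi> \<Longrightarrow> vtRULTL k (FTU \<phi> \<psi>)"
| "stLTL k \<phi> \<Longrightarrow> vtRULTL k (FBox \<phi>)"

text \<open>WBA n T I F: states {0..<n}; T is a finite list of transitions (p, letter, q, weight),
  the letter (a subset of AP) being given as a list of its elements; transitions not listed have
  weight -\<infinity> (the zero).  The first matching entry determines the weight.\<close>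
datatype wba = WBA nat "(nat \<times> nat list \<times> nat \<times> qbar) list" "nat list" "nat list"

fun lookup_wt :: "(nat \<times> nat list \<times> nat \<times> qbar) list \<Rightarrow> nat \<Rightarrow> nat set \<Rightarrow> nat \<Rightarrow> qbar" where
  "lookup_wt [] p a q = QMInf"
| "lookup_wt ((p', l, q', x) # T) p a q =
     (if p' = p \<and> set l = a \<and> q' = q then x else lookup_wt T p a q)"

fun wba_wt :: "wba \<Rightarrow> nat \<Rightarrow> nat set \<Rightarrow> nat \<Rightarrow> ereal" where
  "wba_wt (WBA n T I F) p a q = qval (lookup_wt T p a q)"

fun wba_succ_path :: "wba \<Rightarrow> (nat \<Rightarrow> nat) \<Rightarrow> bool" where
  "wba_succ_path (WBA n T I F) \<rho> \<longleftrightarrow>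
     (\<forall>i. \<rho> i < n) \<and> \<rho> 0 \<in> set I \<and> infinite {i. \<rho> i \<in> set F}"

definition wba_beh :: "((nat \<Rightarrow> ereal) \<Rightarrow> ereal) \<Rightarrow> wba \<Rightarrow> (nat \<Rightarrow> nat set) \<Rightarrow> ereal" where
  "wba_beh V M w =
     (SUP \<rho>\<in>{\<rho>. wba_succ_path M \<rho>}. V (\<lambda>i. wba_wt M (\<rho> i) (w i) (\<rho> (Suc i))))"

fun wba_valid :: "nat set \<Rightarrow> wba \<Rightarrow> bool" where
  "wba_valid AP (WBA n T I F) \<longleftrightarrow>
     (\<forall>(p, l, q, x) \<in> set T. p < n \<and> q < n \<and> set l \<subseteq> AP)
     \<and> set I \<subseteq> {..<n} \<and> set F \<subseteq> {..<n}"

datatype recf = Zero | Succ | Proj nat | Comp recf "recf list" | Prec recf recf | Mini recf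

inductive reval :: "recf \<Rightarrow> nat list \<Rightarrow> nat \<Rightarrow> bool" where
  "reval Zero xs 0"
| "reval Succ (x # xs) (Suc x)"
| "i < length xs \<Longrightarrow> reval (Proj i) xs (xs ! i)"
| "length ys = length hs \<Longrightarrow> (\<forall>i<length hs. reval (hs ! i) xs (ys ! i))
     \<Longrightarrow> reval g ys y \<Longrightarrow> reval (Comp g hs) xs y"
| "reval f xs y \<Longrightarrow> reval (Prec f g) (0 # xs) y"
| "reval (Prec f g) (n # xs) r \<Longrightarrow> reval g (n # r # xs) y
     \<Longrightarrow> reval (Prec f g) (Suc n # xs) y"
| "reval f (n # xs) 0 \<Longrightarrow> (\<forall>m<n. \<exists>y. y > 0 \<and> reval f (m # xs) y)
     \<Longrightarrow> reval (Mini f) xs n"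

definition enc_rat :: "rat \<Rightarrow> nat" where
  "enc_rat q = (case quotient_of q of (a, b) \<Rightarrow> prod_encode (int_encode a, int_encode b))"

fun enc_qbar :: "qbar \<Rightarrow> nat" where
  "enc_qbar QMInf = 0"
| "enc_qbar QPInf = 1"
| "enc_qbar (QFin q) = Suc (Suc (enc_rat q))"

fun enc_form :: "form \<Rightarrow> nat" where
  "enc_form (FConst k) = prod_encode (0, enc_qbar k)"
| "enc_form (FAtom a) = prod_encode (1, a)"
| "enc_form (FNAtom a) = prod_encode (2, a)"
| "enc_form (FOr \<phi> \<psi>) = prod_encode (3, prod_encode (enc_form \<phi>, enc_form \<psi>))"
| "enc_form (FAnd \<phi> \<psi>) = prod_encode (4, prod_encode (enc_form \<phi>, enc_form \<psi>))"
| "enc_form (FNext \<phi>) = prod_encode (5, enc_form \<phi>)"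
| "enc_form (FUntil \<phi> \<psi>) = prod_encode (6, prod_encode (enc_form \<phi>, enc_form \<psi>))"
| "enc_form (FBox \<phi>) = prod_encode (7, enc_form \<phi>)"

fun enc_trans :: "nat \<times> nat list \<times> nat \<times> qbar \<Rightarrow> nat" where
  "enc_trans (p, l, q, x) =
     list_encode [p, list_encode l, q, enc_qbar x]"

fun enc_wba :: "wba \<Rightarrow> nat" where
  "enc_wba (WBA n T I F) =
     list_encode [n, list_encode (map enc_trans T), list_encode I, list_encode F]"

definition enc_input :: "form \<Rightarrow> wba \<Rightarrow> nat" where
  "enc_input \<phi> M = prod_encode (enc_form \<phi>, enc_wba M)"

definition equiv_decidable ::
  "nat set \<Rightarrow> ((nat \<Rightarrow> ereal) \<Rightarrow> ereal) \<Rightarrow> (form \<Rightarrow> bool) \<Rightarrow> bool" where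
  "equiv_decidable AP V Frag \<longleftrightarrow>
     (\<exists>f. \<forall>\<phi> M. Frag \<phi> \<and> atoms \<phi> \<subseteq> AP \<and> wba_valid AP M \<longrightarrow>
        reval f [enc_input \<phi> M]
          (if (\<forall>w. (\<forall>i. w i \<subseteq> AP) \<longrightarrow> sem V \<phi> w = wba_beh V M w) then 1 else 0))"

end

theory Submission
  imports Defs "HOL-Library.Ramsey"
begin

text \<open>Only finitely many values occur, and on such sequences each of the three \<open>\<omega>\<close>-valuations depends
  only on the range of the sequence and on the set of its values that recur infinitely often.
  Hence both the semantics of a formula and the behaviour of an automaton are recognised by a
  congruence of finite index on finite words: the first letter is, and products, the next
  operator, functions of the history of a sequence (until, always) and projections (the choice of
  a path) preserve this, with an index bounded by an explicit tower of exponentials. By Ramsey's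
  theorem every word then has the same values as some lasso \<open>u v v v \<dots>\<close> with \<open>u\<close> and \<open>v\<close> no longer than the
  index, so it suffices to compare the two sides on finitely many lassos, without complementing
  an automaton. On a lasso a formula is evaluated by recursion on its code, and the same bound,
  applied to the words over pairs of a position and a state, reduces the supremum over paths to a
  maximum over finitely many lasso-shaped paths. All bounds and searches are primitive recursive.\<close>

section \<open>Computable functions\<close>

text \<open>The obstacle is the until operator. Its value is a supremum over infinitely many split
  points, and each term depends on all values of the left operand seen so far. A class of a finite
  word therefore also records which classes its nonempty suffixes have and, for each position, which
  of these belong to suffixes that begin earlier. This costs the doubly exponential factor in the
  index, and nesting turns it into a tower.

  The height of the tower is essentially the code of the formula itself: the code of a compound
  formula exceeds the sum of the codes of its parts, so no measure of nesting has to be computed.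

  The supremum over paths behaves like a quantifier over infinite words, and states are projected
  away by a power set construction. A single lasso has to witness both values at once, so the
  congruences of the two sides are multiplied before Ramsey's theorem is applied.

  One program serves all formulas and automata over a fixed \<open>AP\<close>: the finite set of
  letter codes is a constant of the program, everything else is read from the input.\<close>

definition cmpn :: "nat \<Rightarrow> (nat list \<Rightarrow> nat) \<Rightarrow> bool" where
  "cmpn k f \<longleftrightarrow> (\<exists>r. \<forall>xs. length xs = k \<longrightarrow> reval r xs (f xs))"

lemma cmpn_zero: "cmpn k (\<lambda>xs. 0)"
  unfolding cmpn_def by (blast intro: reval.intros)

lemma cmpn_nth: "i < k \<Longrightarrow> cmpn k (\<lambda>xs. xs ! i)"
  unfolding cmpn_def by (blast intro: reval.intros)

lemma cmpn_comp:
  assumes g: "cmpn (length fs) g" and fs: "\<And>f. f \<in> set fs \<Longrightarrow> cmpn k f"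
  shows "cmpn k (\<lambda>xs. g (map (\<lambda>f. f xs) fs))"
proof -
  obtain r where r: "\<And>xs. length xs = length fs \<Longrightarrow> reval r xs (g xs)"
    using g unfolding cmpn_def by blast
  have "\<forall>f\<in>set fs. \<exists>q. \<forall>xs. length xs = k \<longrightarrow> reval q xs (f xs)"
    using fs unfolding cmpn_def by blast
  then obtain q where q: "\<And>f xs. f \<in> set fs \<Longrightarrow> length xs = k \<Longrightarrow> reval (q f) xs (f xs)"
    by metis
  have "reval (Comp r (map q fs)) xs (g (map (\<lambda>f. f xs) fs))" if "length xs = k" for xs
    by (rule reval.intros(4)[where ys="map (\<lambda>f. f xs) fs"]) (auto simp: r q that)
  then show ?thesis unfolding cmpn_def by blast
qed

lemma cmpn_Suc: assumes "cmpn k f" shows "cmpn k (\<lambda>xs. Suc (f xs))"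
proof -
  have "cmpn (length [f]) (\<lambda>xs. Suc (xs ! 0))"
    unfolding cmpn_def
    by (rule exI[of _ Succ]) (auto simp: length_Suc_conv intro: reval.intros)
  from cmpn_comp[OF this, of k] assms show ?thesis by simp
qed

lemma cmpn_const: "cmpn k (\<lambda>xs. c)"
  by (induction c) (auto intro: cmpn_zero cmpn_Suc)

text \<open>\<open>Prec\<close> passes the counter and the previous result in front of the
  parameters, so the step function has arity \<open>k + 2\<close> and finds its parameters after
  dropping two arguments.\<close>

lemma cmpn_prec:
  assumes g: "cmpn k g" and h: "cmpn (Suc (Suc k)) (\<lambda>ys. h (ys ! 0) (ys ! 1) (drop 2 ys))"
  shows "cmpn (Suc k) (\<lambda>xs. rec_nat (g (tl xs)) (\<lambda>n r. h n r (tl xs)) (hd xs))"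
proof -
  obtain a where a: "\<And>xs. length xs = k \<Longrightarrow> reval a xs (g xs)"
    using g unfolding cmpn_def by blast
  obtain b where b: "\<And>n r xs. length xs = k \<Longrightarrow> reval b (n # r # xs) (h n r xs)"
  proof -
    obtain b where "\<And>xs. length xs = Suc (Suc k) \<Longrightarrow> reval b xs (h (xs ! 0) (xs ! 1) (drop 2 xs))"
      using h unfolding cmpn_def by blast
    from this[of "_ # _ # _"] show thesis by (intro that[of b]) auto
  qed
  have "reval (Prec a b) (n # xs) (rec_nat (g xs) (\<lambda>n r. h n r xs) n)" if "length xs = k" for n xs
    by (induction n) (auto intro: reval.intros a b that)
  then have "\<forall>xs. length xs = Suc k \<longrightarrow> reval (Prec a b) xs (rec_nat (g (tl xs)) (\<lambda>n r. h n r (tl xs)) (hd xs))"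
    by (auto simp: length_Suc_conv)
  then show ?thesis unfolding cmpn_def by blast
qed

lemma cmpn_comp1:
  assumes "cmpn 1 (\<lambda>xs. g (xs ! 0))" "cmpn k a"
  shows "cmpn k (\<lambda>xs. g (a xs))"
  using cmpn_comp[of "[a]" "\<lambda>xs. g (xs ! 0)" k] assms by simp

lemma cmpn_comp2:
  assumes "cmpn 2 (\<lambda>xs. g (xs ! 0) (xs ! 1))" "cmpn k a" "cmpn k b"
  shows "cmpn k (\<lambda>xs. g (a xs) (b xs))"
proof -
  have "cmpn (length [a, b]) (\<lambda>xs. g (xs ! 0) (xs ! 1))" using assms by (simp add: eval_nat_numeral)
  from cmpn_comp[OF this, of k] have "cmpn k (\<lambda>xs. g (map (\<lambda>f. f xs) [a, b] ! 0) (map (\<lambda>f. f xs) [a, b] ! 1))"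
    using assms(2,3) by fastforce
  then show ?thesis by simp
qed

lemma cmpn_cong: "cmpn k f \<Longrightarrow> (\<And>xs. length xs = k \<Longrightarrow> f xs = g xs) \<Longrightarrow> cmpn k g"
  unfolding cmpn_def by metis

lemma length_2_conv: "length xs = 2 \<longleftrightarrow> (\<exists>x y. xs = [x, y])"
  by (auto simp: eval_nat_numeral length_Suc_conv)

text \<open>Stated through the recursion equations of \<open>f\<close>, so that its uses need not
  exhibit a \<open>rec_nat\<close> term.\<close>

lemma cmpn_rec2:
  assumes "cmpn 1 (\<lambda>xs. g (xs ! 0))" "cmpn 3 (\<lambda>xs. h (xs ! 0) (xs ! 1) (xs ! 2))"
    and eq: "\<And>x. f 0 x = g x" "\<And>n x. f (Suc n) x = h n (f n x) x"
  shows "cmpn 2 (\<lambda>xs. f (xs ! 0) (xs ! 1))"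
proof -
  have *: "cmpn (Suc (Suc 1)) (\<lambda>ys. h (ys ! 0) (ys ! 1) (drop 2 ys ! 0))"
    by (rule cmpn_cong[where f="\<lambda>xs. h (xs ! 0) (xs ! 1) (xs ! 2)"])
       (use assms in \<open>auto simp: eval_nat_numeral\<close>)
  have f: "rec_nat (g x) (\<lambda>n r. h n r x) n = f n x" for n x
    by (induction n) (auto simp: eq)
  show ?thesis
    by (rule cmpn_cong[OF cmpn_prec[OF assms(1) *, simplified Suc_1 One_nat_def[symmetric]]])
       (auto simp: f length_2_conv)
qed

lemma cmpn_rec1:
  assumes "cmpn 2 (\<lambda>xs. h (xs ! 0) (xs ! 1))" and eq: "\<And>n. f (Suc n) = h n (f n)"
  shows "cmpn 1 (\<lambda>xs. f (xs ! 0))"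
proof -
  have *: "cmpn (Suc (Suc 0)) (\<lambda>ys. h (ys ! 0) (ys ! 1))"
    using assms by (simp add: eval_nat_numeral)
  have f: "rec_nat (f 0) h n = f n" for n
    by (induction n) (auto simp: eq)
  show ?thesis unfolding One_nat_def
    by (rule cmpn_cong[OF cmpn_prec[where g="\<lambda>_. f 0", OF cmpn_const *]])
       (auto simp: f length_Suc_conv)
qed

lemma cmpn_add: assumes "cmpn k a" "cmpn k b" shows "cmpn k (\<lambda>xs. a xs + b xs)"
proof -
  have "cmpn 2 (\<lambda>xs. xs ! 0 + xs ! 1)"
    by (rule cmpn_rec2[where f="\<lambda>n x. n + x" and g="\<lambda>x. x" and h="\<lambda>n r x. Suc r"])
       (simp_all add: cmpn_nth cmpn_Suc)
  from cmpn_comp2[OF this assms] show ?thesis .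
qed

lemma cmpn_triangle: assumes "cmpn k a" shows "cmpn k (\<lambda>xs. triangle (a xs))"
proof -
  have "cmpn 1 (\<lambda>xs. triangle (xs ! 0))"
    by (rule cmpn_rec1[where f=triangle and h="\<lambda>n r. r + Suc n"])
       (intro cmpn_nth cmpn_Suc cmpn_add, simp_all)
  from cmpn_comp1[OF this assms] show ?thesis .
qed

lemma cmpn_pred: assumes "cmpn k a" shows "cmpn k (\<lambda>xs. a xs - 1)"
proof -
  have "cmpn 1 (\<lambda>xs. (\<lambda>n. n - 1) (xs ! 0))"
    by (rule cmpn_rec1[where f="\<lambda>n. n - 1" and h="\<lambda>n r. n"]) (simp_all add: cmpn_nth)
  from cmpn_comp1[OF this assms] show ?thesis .
qed

text \<open>The recursion is on the subtrahend, which therefore comes first; the final composition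
  swaps the arguments back.\<close>

lemma cmpn_diff: assumes "cmpn k a" "cmpn k b" shows "cmpn k (\<lambda>xs. a xs - b xs)"
proof -
  have "cmpn 2 (\<lambda>xs. (\<lambda>n x. x - n) (xs ! 0) (xs ! 1))"
    by (rule cmpn_rec2[where f="\<lambda>n x. x - n" and g="\<lambda>x. x" and h="\<lambda>n r x. r - 1"])
       (simp_all only: diff_Suc_eq_diff_pred, (intro cmpn_nth cmpn_pred; simp)+)
  from cmpn_comp2[OF this assms(2,1)] show ?thesis .
qed

text \<open>Each of the two summands is zero when the other branch is selected. Both branches are
  evaluated, which is harmless for total functions.\<close>

lemma cmpn_if0:
  assumes "cmpn k a" "cmpn k b" "cmpn k c"
  shows "cmpn k (\<lambda>xs. if a xs = 0 then b xs else c xs)"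
proof -
  have 1: "cmpn 2 (\<lambda>xs. (\<lambda>n x. if n = 0 then x else 0) (xs ! 0) (xs ! 1))"
    by (rule cmpn_rec2[where f="\<lambda>n x. if n = 0 then x else 0" and g="\<lambda>x. x" and h="\<lambda>n r x. 0"])
       (simp_all add: cmpn_nth cmpn_zero)
  have 2: "cmpn 2 (\<lambda>xs. (\<lambda>n x. if n = 0 then 0 else x) (xs ! 0) (xs ! 1))"
    by (rule cmpn_rec2[where f="\<lambda>n x. if n = 0 then 0 else x" and g="\<lambda>x. 0" and h="\<lambda>n r x. x"])
       (simp_all add: cmpn_nth cmpn_zero)
  show ?thesis
    by (rule cmpn_cong[OF cmpn_add[OF cmpn_comp2[OF 1 assms(1,2)] cmpn_comp2[OF 2 assms(1,3)]]]) auto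
qed

section \<open>The Cantor pairing and its projections\<close>

definition pfst :: "nat \<Rightarrow> nat" where "pfst z = fst (prod_decode z)"
definition psnd :: "nat \<Rightarrow> nat" where "psnd z = snd (prod_decode z)"
abbreviation pr :: "nat \<Rightarrow> nat \<Rightarrow> nat" where "pr a b \<equiv> prod_encode (a, b)"

lemma pfst_pr [simp]: "pfst (pr a b) = a" and psnd_pr [simp]: "psnd (pr a b) = b"
  by (simp_all add: pfst_def psnd_def)

lemma pr_pfst_psnd [simp]: "pr (pfst z) (psnd z) = z"
  by (simp add: pfst_def psnd_def)

text \<open>The Cantor enumeration moves along an antidiagonal and at its end, where the second
  component is 0, jumps to the start of the next one.\<close>

lemma prod_decode_Suc:
  "prod_decode (Suc z) = (if psnd z = 0 then (0, Suc (pfst z)) else (Suc (pfst z), psnd z - 1))"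
proof -
  have "Suc (pr a b) = pr 0 (Suc a)" if "b = 0" for a b
    using that by (simp add: prod_encode_def)
  moreover have "Suc (pr a b) = pr (Suc a) (b - 1)" if "b \<noteq> 0" for a b
    using that by (cases b) (simp_all add: prod_encode_def)
  ultimately show ?thesis
    by (metis pr_pfst_psnd prod_encode_inverse)
qed

definition diagonal :: "nat \<Rightarrow> nat" where "diagonal z = pfst z + psnd z"

lemma triangle_diagonal: "triangle (diagonal z) + pfst z = z"
  using pr_pfst_psnd[of z, unfolded prod_encode_def] by (simp add: diagonal_def)

text \<open>The projections are not yet known to be computable, so the end of a diagonal is detected
  without them: the truncated difference in the test equals \<open>psnd z\<close>. A recursion with
  a single accumulator thus yields \<open>diagonal\<close>, and from it both projections.\<close>

lemma diagonal_Suc: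
  "diagonal (Suc z) = (if triangle (Suc (diagonal z)) - Suc z = 0 then Suc (diagonal z) else diagonal z)"
proof -
  have "triangle (Suc (diagonal z)) - Suc z = psnd z"
    using triangle_diagonal[of z] by (simp add: diagonal_def)
  then show ?thesis
    using prod_decode_Suc[of z] by (auto simp: diagonal_def pfst_def psnd_def)
qed

lemma cmpn_diagonal: assumes "cmpn k a" shows "cmpn k (\<lambda>xs. diagonal (a xs))"
proof -
  have "cmpn 1 (\<lambda>xs. diagonal (xs ! 0))"
    by (rule cmpn_rec1[where h="\<lambda>n r. if triangle (Suc r) - Suc n = 0 then Suc r else r", OF _ diagonal_Suc])
       (intro cmpn_if0 cmpn_diff cmpn_triangle cmpn_nth cmpn_Suc; simp)
  from cmpn_comp1[OF this assms] show ?thesis .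
qed

lemma pfst_eq: "pfst z = z - triangle (diagonal z)"
  using triangle_diagonal[of z] by simp

lemma psnd_eq: "psnd z = diagonal z - pfst z"
  by (simp add: diagonal_def)

lemma cmpn_pfst: "cmpn k a \<Longrightarrow> cmpn k (\<lambda>xs. pfst (a xs))"
  unfolding pfst_eq by (intro cmpn_diff cmpn_triangle cmpn_diagonal)

lemma cmpn_psnd: "cmpn k a \<Longrightarrow> cmpn k (\<lambda>xs. psnd (a xs))"
  unfolding psnd_eq by (intro cmpn_diff cmpn_pfst cmpn_diagonal)

lemma cmpn_pr: "cmpn k a \<Longrightarrow> cmpn k b \<Longrightarrow> cmpn k (\<lambda>xs. pr (a xs) (b xs))"
  unfolding prod_encode_def by (simp add: cmpn_add cmpn_triangle)

text \<open>Closure properties are stated for unary functions only, with all further parameters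
  packed into the single argument by pairing. A rule for a construct with several arguments
  is stated under composition, which makes these rules syntax-directed.\<close>

definition cmp :: "(nat \<Rightarrow> nat) \<Rightarrow> bool" where
  "cmp f \<longleftrightarrow> (\<exists>r. \<forall>x. reval r [x] (f x))"

lemma cmp_iff: "cmp f \<longleftrightarrow> cmpn 1 (\<lambda>xs. f (xs ! 0))"
proof -
  have "(\<forall>x. reval r [x] (f x)) \<longleftrightarrow> (\<forall>xs. length xs = 1 \<longrightarrow> reval r xs (f (xs ! 0)))" for r
    by (auto simp: length_Suc_conv)
  then show ?thesis by (simp only: cmp_def cmpn_def)
qed

lemma cmpn_cmp: "cmp f \<Longrightarrow> cmpn k a \<Longrightarrow> cmpn k (\<lambda>xs. f (a xs))"
  unfolding cmp_iff by (rule cmpn_comp1)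

named_theorems cmp_intros

lemma cmp_id [cmp_intros]: "cmp (\<lambda>x. x)"
  unfolding cmp_iff by (simp add: cmpn_nth)

lemma cmp_const [cmp_intros]: "cmp (\<lambda>x. c)"
  unfolding cmp_iff by (rule cmpn_const)

lemma cmp_comp: "cmp f \<Longrightarrow> cmp a \<Longrightarrow> cmp (\<lambda>x. f (a x))"
  using cmpn_cmp[of f 1] unfolding cmp_iff by simp

lemma cmp_Suc [cmp_intros]: "cmp a \<Longrightarrow> cmp (\<lambda>x. Suc (a x))"
  unfolding cmp_iff by (rule cmpn_Suc)

lemma cmp_add [cmp_intros]: "cmp a \<Longrightarrow> cmp b \<Longrightarrow> cmp (\<lambda>x. a x + b x)"
  unfolding cmp_iff by (rule cmpn_add)

lemma cmp_diff [cmp_intros]: "cmp a \<Longrightarrow> cmp b \<Longrightarrow> cmp (\<lambda>x. a x - b x)"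
  unfolding cmp_iff by (rule cmpn_diff)

lemma cmp_pfst [cmp_intros]: "cmp a \<Longrightarrow> cmp (\<lambda>x. pfst (a x))"
  unfolding cmp_iff by (rule cmpn_pfst)

lemma cmp_psnd [cmp_intros]: "cmp a \<Longrightarrow> cmp (\<lambda>x. psnd (a x))"
  unfolding cmp_iff by (rule cmpn_psnd)

lemma cmp_pr [cmp_intros]: "cmp a \<Longrightarrow> cmp b \<Longrightarrow> cmp (\<lambda>x. pr (a x) (b x))"
  unfolding cmp_iff by (rule cmpn_pr)

text \<open>The step function becomes unary on the packed triple of parameter, counter and
  accumulator, in this order, so the parameter is reached by a single \<open>pfst\<close>.\<close>

lemma cmp_rec_nat [cmp_intros]:
  assumes b: "cmp b" and g: "cmp g" and h: "cmp (\<lambda>z. h (pfst z) (pfst (psnd z)) (psnd (psnd z)))"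
  shows "cmp (\<lambda>x. rec_nat (g x) (h x) (b x))"
proof -
  have "cmpn 2 (\<lambda>xs. (\<lambda>n x. rec_nat (g x) (h x) n) (xs ! 0) (xs ! 1))"
  proof (rule cmpn_rec2[where g=g and h="\<lambda>n r x. h x n r"])
    show "cmpn 1 (\<lambda>xs. g (xs ! 0))" using g by (simp add: cmp_iff)
    have "cmpn 3 (\<lambda>xs. pr (xs ! 2) (pr (xs ! 0) (xs ! 1)))"
      by (intro cmpn_pr cmpn_nth) auto
    from cmpn_cmp[OF h this] show "cmpn 3 (\<lambda>xs. h (xs ! 2) (xs ! 0) (xs ! 1))" by simp
  qed auto
  from cmpn_comp2[OF this, of 1 "\<lambda>xs. b (xs ! 0)" "\<lambda>xs. xs ! 0"] b show ?thesis
    by (simp add: cmp_iff cmpn_nth)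
qed

lemma cmp_mult [cmp_intros]: assumes "cmp a" "cmp b" shows "cmp (\<lambda>x. a x * b x)"
proof -
  have "rec_nat 0 (\<lambda>_ r. r + m) n = n * m" for m n :: nat
    by (induction n) auto
  then have eq: "(\<lambda>x. a x * b x) = (\<lambda>x. rec_nat 0 (\<lambda>_ r. r + b x) (a x))" by simp
  \<comment> \<open>Inside the recursion the parameter is \<open>pfst\<close> of the packed
    argument, so \<open>b\<close> occurs composed with it; \<open>cmp_comp\<close> applied to the
    assumption covers this. The same device recurs below.\<close>
  show ?thesis unfolding eq by (intro cmp_intros assms cmp_comp[OF assms(2)])
qed

lemma cmp_power [cmp_intros]: assumes "cmp a" "cmp b" shows "cmp (\<lambda>x. a x ^ b x)"
proof -
  have "rec_nat 1 (\<lambda>_ r. m * r) n = m ^ n" for m n :: nat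
    by (induction n) auto
  then have eq: "(\<lambda>x. a x ^ b x) = (\<lambda>x. rec_nat 1 (\<lambda>_ r. a x * r) (b x))" by simp
  show ?thesis unfolding eq by (intro cmp_intros assms cmp_comp[OF assms(1)])
qed

section \<open>Decidable predicates and bounded search\<close>

definition cmpP :: "(nat \<Rightarrow> bool) \<Rightarrow> bool" where
  "cmpP P \<longleftrightarrow> cmp (\<lambda>x. if P x then 1 else 0)"

lemma cmpP_comp: "cmpP P \<Longrightarrow> cmp a \<Longrightarrow> cmpP (\<lambda>x. P (a x))"
  unfolding cmpP_def by (rule cmp_comp)

lemma cmp_If [cmp_intros]:
  assumes "cmpP P" "cmp a" "cmp b" shows "cmp (\<lambda>x. if P x then a x else b x)"
proof -
  have eq: "(\<lambda>x. if P x then a x else b x) =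
    (\<lambda>x. (if P x then 1 else 0) * a x + (1 - (if P x then 1 else 0)) * b x)" by auto
  show ?thesis unfolding eq using assms(1) unfolding cmpP_def by (intro cmp_intros assms)
qed

lemma cmpP_const [cmp_intros]: "cmpP (\<lambda>x. c)"
  unfolding cmpP_def by (rule cmp_const)

lemma cmpP_le [cmp_intros]: assumes "cmp a" "cmp b" shows "cmpP (\<lambda>x. a x \<le> b x)"
proof -
  have eq: "(\<lambda>x. if a x \<le> b x then 1 else 0) = (\<lambda>x. 1 - (a x - b x))" by auto
  show ?thesis unfolding cmpP_def eq by (intro cmp_intros assms)
qed

lemma cmpP_not [cmp_intros]: assumes "cmpP P" shows "cmpP (\<lambda>x. \<not> P x)"
proof -
  have eq: "(\<lambda>x. if \<not> P x then 1 else 0) = (\<lambda>x. if P x then 0 else 1)" by auto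
  show ?thesis unfolding cmpP_def eq by (intro cmp_intros assms)
qed

lemma cmpP_conj [cmp_intros]: assumes "cmpP P" "cmpP Q" shows "cmpP (\<lambda>x. P x \<and> Q x)"
proof -
  have eq: "(\<lambda>x. if P x \<and> Q x then 1 else 0) = (\<lambda>x. if P x then if Q x then 1 else 0 else 0)" by auto
  show ?thesis unfolding cmpP_def eq by (intro cmp_intros assms)
qed

lemma cmpP_disj [cmp_intros]: assumes "cmpP P" "cmpP Q" shows "cmpP (\<lambda>x. P x \<or> Q x)"
  using cmpP_not[OF cmpP_conj[OF assms[THEN cmpP_not]]] by simp

lemma cmpP_imp [cmp_intros]: assumes "cmpP P" "cmpP Q" shows "cmpP (\<lambda>x. P x \<longrightarrow> Q x)"
  using cmpP_disj[OF assms(1)[THEN cmpP_not] assms(2)] by simp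

lemma cmpP_less [cmp_intros]: assumes "cmp a" "cmp b" shows "cmpP (\<lambda>x. a x < b x)"
  using cmpP_not[OF cmpP_le[OF assms(2,1)]] by (simp add: not_le)

lemma cmpP_eq [cmp_intros]: assumes "cmp a" "cmp b" shows "cmpP (\<lambda>x. a x = b x)"
proof -
  have "(\<lambda>x. a x = b x) = (\<lambda>x. a x \<le> b x \<and> b x \<le> a x)" by auto
  then show ?thesis by (simp add: cmp_intros assms)
qed

lemma cmpP_ball [cmp_intros]:
  assumes b: "cmp b" and P: "cmpP (\<lambda>z. P (pfst z) (psnd z))"
  shows "cmpP (\<lambda>x. \<forall>i<b x. P x i)"
proof -
  have "rec_nat 1 (\<lambda>i r. if Q i then r else 0) n = (if \<forall>i<n. Q i then 1 else 0 :: nat)" for Q n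
    by (induction n) (auto simp: less_Suc_eq)
  then have eq: "(\<lambda>x. if \<forall>i<b x. P x i then 1 else 0 :: nat) =
    (\<lambda>x. rec_nat 1 (\<lambda>i r. if P x i then r else 0) (b x))" by (simp only:)
  show ?thesis unfolding cmpP_def eq proof (intro cmp_intros b)
    have "cmp (\<lambda>z. pr (pfst z) (pfst (psnd z)))" by (intro cmp_intros)
    from cmpP_comp[OF P this] show "cmpP (\<lambda>x. P (pfst x) (pfst (psnd x)))" by simp
  qed
qed

lemma cmpP_bex [cmp_intros]:
  assumes b: "cmp b" and P: "cmpP (\<lambda>z. P (pfst z) (psnd z))"
  shows "cmpP (\<lambda>x. \<exists>i<b x. P x i)"
  using cmpP_not[OF cmpP_ball[OF b cmpP_not[OF P]]] by simp

text \<open>Minimisation bounded by \<open>n\<close>, with default \<open>n\<close>. After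
  \<open>i\<close> rounds the accumulator is \<open>i\<close> exactly if nothing has been found, so
  \<open>r < i\<close> recognises an earlier witness.\<close>

definition bleast :: "nat \<Rightarrow> (nat \<Rightarrow> bool) \<Rightarrow> nat" where
  "bleast n P = rec_nat 0 (\<lambda>i r. if r < i then r else if P i then i else Suc i) n"

lemma bleast_cases:
  "bleast n P < n \<and> P (bleast n P) \<and> (\<forall>i<bleast n P. \<not> P i) \<or> bleast n P = n \<and> (\<forall>i<n. \<not> P i)"
proof (induction n)
  case (Suc n)
  have "bleast (Suc n) P = (if bleast n P < n then bleast n P else if P n then n else Suc n)"
    by (simp add: bleast_def)
  with Suc show ?case by (auto simp: less_Suc_eq)
qed (simp add: bleast_def)

lemma bleast: assumes "\<exists>i<n. P i"
  shows "bleast n P < n" "P (bleast n P)" "i < bleast n P \<Longrightarrow> \<not> P i"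
  using bleast_cases[of n P] assms by auto

lemma bleast_eqI: "i < n \<Longrightarrow> P i \<Longrightarrow> (\<And>j. j < i \<Longrightarrow> \<not> P j) \<Longrightarrow> bleast n P = i"
  using bleast_cases[of n P] by (metis linorder_neqE_nat)

lemma cmp_bleast [cmp_intros]:
  assumes b: "cmp b" and P: "cmpP (\<lambda>z. P (pfst z) (psnd z))"
  shows "cmp (\<lambda>x. bleast (b x) (P x))"
  unfolding bleast_def
proof (intro cmp_intros b)
  have "cmp (\<lambda>z. pr (pfst z) (pfst (psnd z)))" by (intro cmp_intros)
  from cmpP_comp[OF P this] show "cmpP (\<lambda>x. P (pfst x) (pfst (psnd x)))" by simp
qed

lemma cmp_div2 [cmp_intros]: assumes "cmp a" shows "cmp (\<lambda>x. a x div 2)"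
proof -
  have "n div 2 = bleast (Suc n) (\<lambda>i. n < 2 * i + 2)" for n :: nat
    by (rule sym, rule bleast_eqI) auto
  then have eq: "(\<lambda>x. a x div 2) = (\<lambda>x. bleast (Suc (a x)) (\<lambda>i. a x < 2 * i + 2))" by simp
  show ?thesis unfolding eq by (intro cmp_intros assms cmp_comp[OF assms])
qed

lemma cmp_mod [cmp_intros]: assumes "cmp a" "cmp b" shows "cmp (\<lambda>x. a x mod b x)"
proof -
  have "rec_nat 0 (\<lambda>_ r. if Suc r = m then 0 else Suc r) n = n mod m" for m n :: nat
    by (induction n) (auto simp: mod_Suc)
  then have eq: "(\<lambda>x. a x mod b x) = (\<lambda>x. rec_nat 0 (\<lambda>_ r. if Suc r = b x then 0 else Suc r) (a x))"
    by simp
  show ?thesis unfolding eq by (intro cmp_intros assms cmp_comp[OF assms(2)])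
qed

lemma cmpP_even [cmp_intros]: assumes "cmp a" shows "cmpP (\<lambda>x. even (a x))"
  unfolding even_iff_mod_2_eq_zero by (intro cmp_intros assms)

lemma cmpP_finite [cmp_intros]:
  assumes "finite S" "cmp a" shows "cmpP (\<lambda>x. a x \<in> S)"
  using assms(1) by induction (simp_all add: cmp_intros assms(2))

section \<open>Codes of lists\<close>

definition ltl :: "nat \<Rightarrow> nat" where "ltl c = psnd (c - 1)"
definition lnth :: "nat \<Rightarrow> nat \<Rightarrow> nat" where "lnth c i = pfst (rec_nat c (\<lambda>_. ltl) i - 1)"
text \<open>The code 0 of the empty list is a fixed point of \<open>ltl\<close>, so the length is
  the first number of tails that reaches 0. The search bound is adequate because a list is no longer
  than its code.\<close>

definition llen :: "nat \<Rightarrow> nat" where "llen c = bleast (Suc c) (\<lambda>i. rec_nat c (\<lambda>_. ltl) i = 0)"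

lemma psnd_0 [simp]: "psnd 0 = 0" and pfst_0 [simp]: "pfst 0 = 0"
  using psnd_pr[of 0 0] pfst_pr[of 0 0] by (simp_all add: prod_encode_def)

lemma ltl_list_encode [simp]: "ltl (list_encode xs) = list_encode (tl xs)"
  by (cases xs) (auto simp: ltl_def)

lemma ltl_iterate [simp]: "rec_nat (list_encode xs) (\<lambda>_. ltl) i = list_encode (drop i xs)"
  by (induction i) (auto simp: drop_Suc tl_drop)

lemma lnth_list_encode [simp]: "i < length xs \<Longrightarrow> lnth (list_encode xs) i = xs ! i"
  by (auto simp: lnth_def Cons_nth_drop_Suc[symmetric])

lemma list_encode_eq_0 [simp]: "list_encode xs = 0 \<longleftrightarrow> xs = []"
  by (cases xs) auto

lemma length_le_list_encode: "length xs \<le> list_encode xs"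
proof (induction xs)
  case (Cons x xs)
  then show ?case using le_prod_encode_2[of "list_encode xs" x] by simp
qed simp

lemma llen_list_encode [simp]: "llen (list_encode xs) = length xs"
  unfolding llen_def
  by (rule bleast_eqI) (auto simp: length_le_list_encode less_Suc_eq_le)

lemma llen_eq: "llen c = length (list_decode c)"
  by (metis list_decode_inverse llen_list_encode)

lemma lnth_eq: "i < llen c \<Longrightarrow> lnth c i = list_decode c ! i"
  by (metis list_decode_inverse llen_eq lnth_list_encode)

lemma cmp_ltl [cmp_intros]: "cmp a \<Longrightarrow> cmp (\<lambda>x. ltl (a x))"
  unfolding ltl_def by (intro cmp_intros)

lemma cmp_lnth [cmp_intros]: "cmp a \<Longrightarrow> cmp b \<Longrightarrow> cmp (\<lambda>x. lnth (a x) (b x))"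
  unfolding lnth_def by (intro cmp_intros)

lemma cmp_llen [cmp_intros]: assumes "cmp a" shows "cmp (\<lambda>x. llen (a x))"
  unfolding llen_def by (intro cmp_intros assms cmp_comp[OF assms])

text \<open>Entries can only be added at the front, so they are produced from the last to the
  first.\<close>

definition ltab :: "nat \<Rightarrow> (nat \<Rightarrow> nat) \<Rightarrow> nat" where
  "ltab n f = rec_nat 0 (\<lambda>i r. Suc (pr (f (n - Suc i)) r)) n"

lemma ltab_eq: "ltab n f = list_encode (map f [0..<n])"
proof -
  have "k \<le> n \<Longrightarrow> rec_nat 0 (\<lambda>i r. Suc (pr (f (n - Suc i)) r)) k = list_encode (map f [n - k..<n])" for k
  proof (induction k)
    case (Suc k)
    then have "[n - Suc k..<n] = (n - Suc k) # [n - k..<n]"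
      by (simp add: upt_rec Suc_diff_Suc)
    with Suc show ?case by simp
  qed simp
  from this[of n] show ?thesis by (simp add: ltab_def)
qed

lemma lnth_ltab [simp]: "i < n \<Longrightarrow> lnth (ltab n f) i = f i"
  by (simp add: ltab_eq)

lemma cmp_ltab [cmp_intros]:
  assumes n: "cmp n" and f: "cmp (\<lambda>z. f (pfst z) (psnd z))"
  shows "cmp (\<lambda>x. ltab (n x) (f x))"
  unfolding ltab_def
proof (intro cmp_intros n cmp_comp[OF n])
  have "cmp (\<lambda>z. pr (pfst z) (n (pfst z) - Suc (pfst (psnd z))))" by (intro cmp_intros cmp_comp[OF n])
  from cmp_comp[OF f this] show "cmp (\<lambda>x. f (pfst x) (n (pfst x) - Suc (pfst (psnd x))))" by simp
qed

section \<open>Recognition by congruences of finite index\<close>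

definition seg :: "(nat \<Rightarrow> 'a) \<Rightarrow> nat \<Rightarrow> nat \<Rightarrow> 'a list" where
  "seg w i j = map w [i..<j]"

lemma length_seg [simp]: "length (seg w i j) = j - i"
  by (simp add: seg_def)

lemma seg_append: "i \<le> j \<Longrightarrow> j \<le> k \<Longrightarrow> seg w i j @ seg w j k = seg w i k"
  using upt_add_eq_append[of i j "k - j"] by (simp add: seg_def flip: map_append)

lemma drop_seg [simp]: "drop k (seg w i j) = seg w (i + k) j"
  by (simp add: seg_def drop_map)

lemma tl_seg: "tl (seg w i j) = seg w (Suc i) j"
  using drop_seg[of 1 w i j] by (simp add: drop_Suc del: drop_seg)

lemma seg_suffix: "seg (suffix k w) i j = seg w (k + i) (k + j)"
  by (rule nth_equalityI) (auto simp: seg_def suffix_def add.assoc)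

lemma seg_in_lists: "range w \<subseteq> A \<Longrightarrow> seg w i j \<in> lists A"
  by (auto simp: seg_def image_subset_iff)

lemma seg_eq_Nil_iff: "seg w i j = [] \<longleftrightarrow> j \<le> i"
  by (auto simp: seg_def)

definition cuts :: "(nat \<Rightarrow> nat) \<Rightarrow> bool" where
  "cuts f \<longleftrightarrow> strict_mono f \<and> f 0 = 0"

lemma cuts_le: "cuts f \<Longrightarrow> n \<le> f n"
  by (simp add: cuts_def strict_mono_imp_increasing)

lemma cuts_block:
  assumes "cuts f" obtains b where "f b \<le> i" "i < f (Suc b)"
proof -
  define b where "b = (GREATEST b. f b \<le> i)"
  have bd: "\<And>b. f b \<le> i \<Longrightarrow> b \<le> i" using cuts_le[OF assms] le_trans by blast
  have "f 0 \<le> i" using assms by (simp add: cuts_def)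
  then have "f b \<le> i" unfolding b_def by (rule GreatestI_nat) (rule bd)
  moreover have "\<not> f (Suc b) \<le> i"
    using Greatest_le_nat[of "\<lambda>b. f b \<le> i" "Suc b" i] bd unfolding b_def by fastforce
  ultimately show thesis using that by force
qed

text \<open>Recognition of \<open>F\<close> by a congruence on finite words, as by a finite semigroup. The first
  conjunct makes every representative of a block nonempty.\<close>

definition recog :: "'a set \<Rightarrow> ('a list \<Rightarrow> 'b) \<Rightarrow> ((nat \<Rightarrow> 'a) \<Rightarrow> 'v) \<Rightarrow> bool" where
  "recog A h F \<longleftrightarrow>
     (\<forall>u\<in>lists A. h u = h [] \<longrightarrow> u = []) \<and>
     (\<forall>x\<in>lists A. \<forall>x'\<in>lists A. \<forall>y\<in>lists A. \<forall>y'\<in>lists A.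
        h x = h x' \<longrightarrow> h y = h y' \<longrightarrow> h (x @ y) = h (x' @ y')) \<and>
     (\<forall>w w' f f'. range w \<subseteq> A \<longrightarrow> range w' \<subseteq> A \<longrightarrow> cuts f \<longrightarrow> cuts f' \<longrightarrow>
        (\<forall>i. h (seg w (f i) (f (Suc i))) = h (seg w' (f' i) (f' (Suc i)))) \<longrightarrow> F w = F w')"

lemma recogI:
  assumes "\<And>u. u \<in> lists A \<Longrightarrow> h u = h [] \<Longrightarrow> u = []"
    and "\<And>x x' y y'. x \<in> lists A \<Longrightarrow> x' \<in> lists A \<Longrightarrow> y \<in> lists A \<Longrightarrow> y' \<in> lists A \<Longrightarrow>
        h x = h x' \<Longrightarrow> h y = h y' \<Longrightarrow> h (x @ y) = h (x' @ y')"
    and "\<And>w w' f f'. range w \<subseteq> A \<Longrightarrow> range w' \<subseteq> A \<Longrightarrow> cuts f \<Longrightarrow> cuts f' \<Longrightarrow>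
        (\<And>i. h (seg w (f i) (f (Suc i))) = h (seg w' (f' i) (f' (Suc i)))) \<Longrightarrow> F w = F w'"
  shows "recog A h F"
  using assms unfolding recog_def by blast

lemma recog_Nil: "recog A h F \<Longrightarrow> u \<in> lists A \<Longrightarrow> h u = h [] \<Longrightarrow> u = []"
  unfolding recog_def by blast

lemma recog_append:
  "recog A h F \<Longrightarrow> h x = h x' \<Longrightarrow> h y = h y' \<Longrightarrow> x \<in> lists A \<Longrightarrow> x' \<in> lists A \<Longrightarrow> y \<in> lists A \<Longrightarrow>
    y' \<in> lists A \<Longrightarrow> h (x @ y) = h (x' @ y')"
  unfolding recog_def by blast

lemma recog_eq:
  "recog A h F \<Longrightarrow> range w \<subseteq> A \<Longrightarrow> range w' \<subseteq> A \<Longrightarrow> cuts f \<Longrightarrow> cuts f' \<Longrightarrow>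
     (\<And>i. h (seg w (f i) (f (Suc i))) = h (seg w' (f' i) (f' (Suc i)))) \<Longrightarrow> F w = F w'"
  unfolding recog_def by blast

definition sat :: "'a set \<Rightarrow> ((nat \<Rightarrow> 'a) \<Rightarrow> 'v) \<Rightarrow> nat \<Rightarrow> bool" where
  "sat A F N \<longleftrightarrow> (\<exists>h :: 'a list \<Rightarrow> nat. recog A h F \<and> h ` lists A \<subseteq> {..<N})"

text \<open>\<open>sat\<close> has to fix one type of classes, as types cannot be quantified inside
  a formula. Renumbering by a bijection lets the constructions below use pairs and sets as
  classes.\<close>

lemma satI:
  assumes h: "recog A h F" and S: "h ` lists A \<subseteq> S" "finite S" "card S \<le> N"
  shows "sat A F N"
proof -
  obtain g :: "'b \<Rightarrow> nat" where g: "bij_betw g S {..<card S}"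
    using ex_bij_betw_finite_nat[OF S(2)] by (auto simp: atLeast0LessThan)
  have inj: "g (h x) = g (h y) \<longleftrightarrow> h x = h y" if "x \<in> lists A" "y \<in> lists A" for x y
    using that S(1) by (intro inj_on_eq_iff[OF bij_betw_imp_inj_on[OF g]]) auto
  have "recog A (\<lambda>u. g (h u)) F"
  proof (rule recogI)
    show "u = []" if "u \<in> lists A" "g (h u) = g (h [])" for u
      using that inj[of u "[]"] recog_Nil[OF h] by simp
    show "g (h (x @ y)) = g (h (x' @ y'))"
      if "x \<in> lists A" "x' \<in> lists A" "y \<in> lists A" "y' \<in> lists A"
        "g (h x) = g (h x')" "g (h y) = g (h y')" for x x' y y'
      using that inj recog_append[OF h, of x x' y y'] by simp
    show "F w = F w'" if "range w \<subseteq> A" "range w' \<subseteq> A" "cuts f" "cuts f'"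
      "\<And>i. g (h (seg w (f i) (f (Suc i)))) = g (h (seg w' (f' i) (f' (Suc i))))" for w w' f f'
      using that inj seg_in_lists[OF that(1)] seg_in_lists[OF that(2)]
      by (intro recog_eq[OF h, of w w' f f']) auto
  qed
  moreover have "(\<lambda>u. g (h u)) ` lists A \<subseteq> {..<N}"
  proof clarsimp
    fix u assume "\<forall>x\<in>set u. x \<in> A"
    then have "h u \<in> S" using S(1) by auto
    then have "g (h u) \<in> {..<card S}" using g by (auto simp: bij_betw_def)
    then show "g (h u) < N" using S(3) by simp
  qed
  ultimately show ?thesis unfolding sat_def by blast
qed

section \<open>Elementary recognised functions and closure properties\<close>

lemma sat_mono: "sat A F N \<Longrightarrow> N \<le> M \<Longrightarrow> sat A F M"
  unfolding sat_def by fastforce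

lemma sat_cong: "sat A F N \<Longrightarrow> (\<And>w. range w \<subseteq> A \<Longrightarrow> F w = G w) \<Longrightarrow> sat A G N"
proof -
  assume "sat A F N" and FG: "\<And>w. range w \<subseteq> A \<Longrightarrow> F w = G w"
  then obtain h :: "'a list \<Rightarrow> nat" where h: "recog A h F" "h ` lists A \<subseteq> {..<N}"
    unfolding sat_def by blast
  have "recog A h G"
  proof (rule recogI)
    fix w w' f f' assume "range w \<subseteq> A" "range w' \<subseteq> A" "cuts f" "cuts f'"
      "\<And>i. h (seg w (f i) (f (Suc i))) = h (seg w' (f' i) (f' (Suc i)))"
    then show "G w = G w'" using recog_eq[OF h(1), of w w' f f'] FG[of w] FG[of w'] by simp
  qed (rule recog_Nil[OF h(1)] recog_append[OF h(1)]; assumption)+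
  then show ?thesis using h(2) unfolding sat_def by blast
qed

text \<open>The product of two congruences is a congruence, and it determines both values.\<close>

lemma sat_combine:
  assumes "sat A F N" "sat A G M"
  shows "sat A (\<lambda>w. H (F w) (G w)) (N * M)"
proof -
  obtain h k :: "'a list \<Rightarrow> nat"
    where h: "recog A h F" "h ` lists A \<subseteq> {..<N}" and k: "recog A k G" "k ` lists A \<subseteq> {..<M}"
    using assms unfolding sat_def by blast
  show ?thesis
  proof (rule satI)
    show "recog A (\<lambda>u. (h u, k u)) (\<lambda>w. H (F w) (G w))"
    proof (rule recogI)
      show "H (F w) (G w) = H (F w') (G w')" if "range w \<subseteq> A" "range w' \<subseteq> A" "cuts f" "cuts f'"
        "\<And>i. (h (seg w (f i) (f (Suc i))), k (seg w (f i) (f (Suc i)))) =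
             (h (seg w' (f' i) (f' (Suc i))), k (seg w' (f' i) (f' (Suc i))))" for w w' f f'
        using that recog_eq[OF h(1) that(1-4)] recog_eq[OF k(1) that(1-4)] by simp
    qed (auto intro: recog_Nil[OF h(1)] recog_append[OF h(1)] recog_append[OF k(1)])
    show "(\<lambda>u. (h u, k u)) ` lists A \<subseteq> {..<N} \<times> {..<M}" using h(2) k(2) by blast
  qed auto
qed

text \<open>The class of a word is its first letter. The additional class belongs to the empty
  word.\<close>

lemma sat_first:
  assumes "finite A"
  shows "sat A (\<lambda>w. g (w 0)) (card A + 1)"
proof (rule satI)
  let ?h = "\<lambda>u. if u = [] then None else Some (hd u)"
  show "recog A ?h (\<lambda>w. g (w 0))"
  proof (rule recogI)
    fix w w' :: "nat \<Rightarrow> 'a" and f f'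
    assume "cuts f" "cuts f'"
      and eq: "\<And>i. ?h (seg w (f i) (f (Suc i))) = ?h (seg w' (f' i) (f' (Suc i)))"
    then have "0 < f 1" "0 < f' 1" "f 0 = 0" "f' 0 = 0" using cuts_le[of f 1] cuts_le[of f' 1] by (simp_all add: cuts_def)
    then show "g (w 0) = g (w' 0)" using eq[of 0] by (simp add: seg_def upt_rec)
  qed (auto split: if_splits)
  show "?h ` lists A \<subseteq> insert None (Some ` A)" using hd_in_set by fastforce
  show "card (insert None (Some ` A)) \<le> card A + 1"
    using assms by (simp add: card_insert_if card_image)
qed (use assms in simp)

text \<open>Two classes rather than one, because the empty word must be alone in its class.\<close>

lemma sat_const: "sat A (\<lambda>w. c) 2"
proof (rule satI)
  show "recog A (\<lambda>u. u = []) (\<lambda>w. c)" by (rule recogI) auto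
  show "(\<lambda>u. u = []) ` lists A \<subseteq> UNIV" by simp
qed simp_all

text \<open>A class also remembers the class of the word without its first letter, since deleting
  that letter changes only the first block.\<close>

lemma sat_next:
  assumes "sat A F N"
  shows "sat A (\<lambda>w. F (suffix 1 w)) (N * N)"
proof -
  obtain h :: "'a list \<Rightarrow> nat" where h: "recog A h F" "h ` lists A \<subseteq> {..<N}"
    using assms unfolding sat_def by blast
  have tl_lists: "tl u \<in> lists A" if "u \<in> lists A" for u
    using that by (cases u) auto
  show ?thesis
  proof (rule satI)
    show "recog A (\<lambda>u. (h u, h (tl u))) (\<lambda>w. F (suffix 1 w))"
    proof (rule recogI)
      fix x x' y y' assume *: "x \<in> lists A" "x' \<in> lists A" "y \<in> lists A" "y' \<in> lists A"
        "(h x, h (tl x)) = (h x', h (tl x'))" "(h y, h (tl y)) = (h y', h (tl y'))"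
      have app: "h (x @ y) = h (x' @ y')" using * by (intro recog_append[OF h(1)]) auto
      have tl: "h (tl x @ y) = h (tl x' @ y')" using * by (intro recog_append[OF h(1)] tl_lists) auto
      \<comment> \<open>\<open>tl (x @ y)\<close> is computed from \<open>x\<close> or from
        \<open>y\<close> according to whether \<open>x\<close> is empty; equivalent words fall into
        the same case.\<close>
      have "x = [] \<longleftrightarrow> x' = []"
        using * recog_Nil[OF h(1), of x] recog_Nil[OF h(1), of x'] by auto
      then show "(h (x @ y), h (tl (x @ y))) = (h (x' @ y'), h (tl (x' @ y')))"
        using app tl * by (cases "x = []") simp_all
    next
      fix w w' f f' assume w: "range w \<subseteq> A" "range w' \<subseteq> A" and f: "cuts f" "cuts f'"
        and eq: "\<And>i. (h (seg w (f i) (f (Suc i))), h (tl (seg w (f i) (f (Suc i))))) =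
             (h (seg w' (f' i) (f' (Suc i))), h (tl (seg w' (f' i) (f' (Suc i)))))"
      \<comment> \<open>Without its first letter the first block may be empty, so it is merged with
        the second one to keep the cuts strictly increasing. The \<open>- 1\<close> accounts for the
        shift of all positions.\<close>
      define sh where "sh f i = (if i = 0 then 0 else f (Suc i) - 1)" for f :: "nat \<Rightarrow> nat" and i
      have f1: "1 \<le> f (Suc i)" if "cuts f" for f i using cuts_le[OF that, of "Suc i"] by simp
      have cuts_sh: "cuts (sh f)" if "cuts f" for f
        using that f1[OF that] cuts_le[OF that, of 2] unfolding cuts_def sh_def strict_mono_Suc_iff
        by (auto simp: diff_less_mono numeral_2_eq_2)
      have sh0: "seg (suffix 1 w) (sh f 0) (sh f (Suc 0)) = tl (seg w (f 0) (f 1)) @ seg w (f 1) (f 2)"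
        if "cuts f" for f and w :: "nat \<Rightarrow> 'a"
      proof -
        have "f 0 = 0" "f 1 \<ge> 1" "f 1 \<le> f 2"
          using that f1[OF that, of 0] by (simp_all add: cuts_def strict_mono_less_eq)
        then show ?thesis
          using seg_append[of 1 "f 1" "f 2" w] by (simp add: sh_def seg_suffix tl_seg numeral_2_eq_2)
      qed
      have shS: "seg (suffix 1 w) (sh f (Suc i)) (sh f (Suc (Suc i))) = seg w (f (Suc (Suc i))) (f (Suc (Suc (Suc i))))"
        if "cuts f" for f i and w :: "nat \<Rightarrow> 'a"
        using f1[OF that, of "Suc i"] f1[OF that, of "Suc (Suc i)"] by (simp add: sh_def seg_suffix)
      show "F (suffix 1 w) = F (suffix 1 w')"
      proof (rule recog_eq[OF h(1) _ _ cuts_sh[OF f(1)] cuts_sh[OF f(2)]])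
        show "range (suffix 1 w) \<subseteq> A" "range (suffix 1 w') \<subseteq> A" using w by (auto simp: suffix_def)
        fix i show "h (seg (suffix 1 w) (sh f i) (sh f (Suc i))) = h (seg (suffix 1 w') (sh f' i) (sh f' (Suc i)))"
        proof (cases i)
          case 0
          show ?thesis unfolding 0 sh0[OF f(1)] sh0[OF f(2)]
            using eq[of 0] eq[of 1] w by (intro recog_append[OF h(1)] tl_lists seg_in_lists) (simp_all add: numeral_2_eq_2)
        next
          case (Suc j)
          then show ?thesis using eq[of "Suc (Suc j)"] by (simp only: shS[OF f(1)] shS[OF f(2)] prod.inject)
        qed
      qed
    qed (auto intro: recog_Nil[OF h(1)])
    show "(\<lambda>u. (h u, h (tl u))) ` lists A \<subseteq> {..<N} \<times> {..<N}" using h(2) tl_lists by blast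
  qed auto
qed

section \<open>Histories and recurring values of a sequence\<close>

definition lims :: "(nat \<Rightarrow> 'v) \<Rightarrow> 'v set" where
  "lims d = {v. \<exists>\<^sub>\<infinity>i. d i = v}"

text \<open>Order and multiplicity of earlier values are dropped: the term of an until at split
  point \<open>i\<close> depends only on the set of left values before \<open>i\<close> and the
  right value at \<open>i\<close>.\<close>

definition hist :: "(nat \<Rightarrow> 'v) \<Rightarrow> ('v set \<times> 'v) set" where
  "hist d = range (\<lambda>i. (d ` {..<i}, d i))"

text \<open>Shift the cuts so that the remainder of block \<open>b\<close> becomes the first block;
  all later blocks stay as they are.\<close>

lemma recog_suffix:
  assumes h: "recog A h F" and w: "range w \<subseteq> A" "range w' \<subseteq> A" and f: "cuts f" "cuts f'"
    and eq: "\<And>i. h (seg w (f i) (f (Suc i))) = h (seg w' (f' i) (f' (Suc i)))"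
    and i: "f b \<le> i" "i < f (Suc b)" and i': "f' b \<le> i'" "i' < f' (Suc b)"
    and tail: "h (seg w i (f (Suc b))) = h (seg w' i' (f' (Suc b)))"
  shows "F (suffix i w) = F (suffix i' w')"
proof -
  define g where "g f i n = (if n = 0 then 0 else f (b + n) - i)" for f :: "nat \<Rightarrow> nat" and i n
  have lt: "i < f (Suc (b + n))" if "cuts f" "i < f (Suc b)" for f i n
  proof -
    have "f (Suc b) \<le> f (Suc (b + n))" using that(1) by (simp add: cuts_def strict_mono_less_eq)
    then show ?thesis using that(2) by simp
  qed
  have g: "cuts (g f i)" if "cuts f" "i < f (Suc b)" for f i
    unfolding cuts_def strict_mono_Suc_iff
  proof safe
    fix n
    have "f (b + n) < f (Suc (b + n))" using that(1) by (simp add: cuts_def strict_mono_Suc_iff)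
    then show "g f i n < g f i (Suc n)" using lt[OF that, of n] by (auto simp: g_def)
  qed (simp add: g_def)
  have g0: "seg (suffix i w) (g f i 0) (g f i (Suc 0)) = seg w i (f (Suc b))"
    if "cuts f" "i < f (Suc b)" for f i and w :: "nat \<Rightarrow> 'a"
    using that(2) by (simp add: seg_suffix g_def)
  have gS: "seg (suffix i w) (g f i (Suc n)) (g f i (Suc (Suc n))) =
      seg w (f (Suc (b + n))) (f (Suc (Suc (b + n))))"
    if "cuts f" "i < f (Suc b)" for f i n and w :: "nat \<Rightarrow> 'a"
    using lt[OF that, of n] lt[OF that, of "Suc n"] by (simp add: seg_suffix g_def)
  show ?thesis
  proof (rule recog_eq[OF h _ _ g[OF f(1) i(2)] g[OF f(2) i'(2)]])
    show "range (suffix i w) \<subseteq> A" "range (suffix i' w') \<subseteq> A" using w by (auto simp: suffix_def)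
    fix n show "h (seg (suffix i w) (g f i n) (g f i (Suc n))) =
        h (seg (suffix i' w') (g f' i' n) (g f' i' (Suc n)))"
      by (cases n) (simp_all only: g0[OF f(1) i(2)] g0[OF f(2) i'(2)] gS[OF f(1) i(2)] gS[OF f(2) i'(2)] tail eq)
  qed
qed

lemma lessThan_add_eq: "{..<a + b :: nat} = {..<a} \<union> (\<lambda>k. a + k) ` {..<b}"
proof -
  have "(\<lambda>k. a + k) ` {..<b} = {a..<a + b}"
    by (simp add: lessThan_atLeast0 add.commute del: atLeast0LessThan)
  then show ?thesis by (auto simp: ivl_disj_un)
qed

text \<open>By \<open>recog_suffix\<close>, these classes determine which values \<open>F\<close>
  takes on suffixes starting inside the block. Empty suffixes are excluded, as they start in the
  next block.\<close>

definition tails :: "('a list \<Rightarrow> 'b) \<Rightarrow> 'a list \<Rightarrow> 'b set" where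
  "tails h u = (\<lambda>j. h (drop j u)) ` {..<length u}"

definition tail_hist :: "('a list \<Rightarrow> 'b) \<Rightarrow> 'a list \<Rightarrow> ('b set \<times> 'b) set" where
  "tail_hist h u = (\<lambda>i. ((\<lambda>j. h (drop j u)) ` {..<i}, h (drop i u))) ` {..<length u}"

text \<open>The values before \<open>i\<close> come from complete blocks, which \<open>tails\<close>
  controls, and from the part of block \<open>b\<close> before \<open>i\<close>, which
  \<open>tail_hist\<close> controls. Choosing \<open>i'\<close> in the block with the same number
  makes it tend to infinity with \<open>i\<close>.\<close>

lemma history_half:
  assumes h: "recog A h F" and w: "range w \<subseteq> A" "range w' \<subseteq> A" and f: "cuts f" "cuts f'"
    and eq: "\<And>i. h (seg w (f i) (f (Suc i))) = h (seg w' (f' i) (f' (Suc i)))"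
    and eqJ: "\<And>i. tails h (seg w (f i) (f (Suc i))) = tails h (seg w' (f' i) (f' (Suc i)))"
    and eqD: "\<And>i. tail_hist h (seg w (f i) (f (Suc i))) = tail_hist h (seg w' (f' i) (f' (Suc i)))"
    and i: "f b \<le> i" "i < f (Suc b)"
  obtains i' where "f' b \<le> i'" "F (suffix i w) = F (suffix i' w')"
    "(\<lambda>j. F (suffix j w)) ` {..<i} = (\<lambda>j. F (suffix j w')) ` {..<i'}"
proof -
  note suff = recog_suffix[OF h w f eq]
  have img: "(\<lambda>j. F (suffix j w)) ` {f c..<f c + m} = (\<lambda>j. F (suffix j w')) ` {f' c..<f' c + m'}"
    if same: "(\<lambda>j. h (seg w (f c + j) (f (Suc c)))) ` {..<m} = (\<lambda>j. h (seg w' (f' c + j) (f' (Suc c)))) ` {..<m'}"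
      and m: "f c + m \<le> f (Suc c)" "f' c + m' \<le> f' (Suc c)" for c m m'
  proof (intro subset_antisym image_subsetI)
    fix j assume j: "j \<in> {f c..<f c + m}"
    then have "h (seg w (f c + (j - f c)) (f (Suc c))) \<in> (\<lambda>j. h (seg w' (f' c + j) (f' (Suc c)))) ` {..<m'}"
      unfolding same[symmetric] by (intro imageI) auto
    then obtain j' where j': "j' < m'" "h (seg w (f c + (j - f c)) (f (Suc c))) = h (seg w' (f' c + j') (f' (Suc c)))"
      by blast
    then have "F (suffix j w) = F (suffix (f' c + j') w')"
      using j m by (intro suff[of c]) auto
    then show "F (suffix j w) \<in> (\<lambda>j. F (suffix j w')) ` {f' c..<f' c + m'}" using j' by auto
  next
    fix j' assume j': "j' \<in> {f' c..<f' c + m'}"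
    then have "h (seg w' (f' c + (j' - f' c)) (f' (Suc c))) \<in> (\<lambda>j. h (seg w (f c + j) (f (Suc c)))) ` {..<m}"
      unfolding same by (intro imageI) auto
    then obtain j where j: "j < m" "h (seg w' (f' c + (j' - f' c)) (f' (Suc c))) = h (seg w (f c + j) (f (Suc c)))"
      by blast
    then have "F (suffix (f c + j) w) = F (suffix j' w')"
      using j' m by (intro suff[of c]) auto
    then show "F (suffix j' w') \<in> (\<lambda>j. F (suffix j w)) ` {f c..<f c + m}"
      using j(1) by (intro image_eqI[of _ _ "f c + j"]) auto
  qed
  have le: "f c \<le> f (Suc c)" "f' c \<le> f' (Suc c)" for c
    using f by (simp_all add: cuts_def strict_mono_less_eq)
  have before: "(\<lambda>j. F (suffix j w)) ` {..<f c} = (\<lambda>j. F (suffix j w')) ` {..<f' c}" for c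
  proof (induction c)
    case 0
    show ?case using f by (simp add: cuts_def)
  next
    case (Suc c)
    have "(\<lambda>j. F (suffix j w)) ` {f c..<f (Suc c)} = (\<lambda>j. F (suffix j w')) ` {f' c..<f' (Suc c)}"
      using img[of c "f (Suc c) - f c" "f' (Suc c) - f' c"] eqJ[of c] le[of c] by (simp add: tails_def)
    moreover have "{..<f (Suc c)} = {..<f c} \<union> {f c..<f (Suc c)}" "{..<f' (Suc c)} = {..<f' c} \<union> {f' c..<f' (Suc c)}"
      using le[of c] by auto
    ultimately show ?case using Suc by (simp add: image_Un)
  qed
  \<comment> \<open>Equality of \<open>tail_hist\<close> on the two blocks yields an offset
    \<open>o'\<close> with the same remainder class and the same classes before it.\<close>
  have "((\<lambda>j. h (seg w (f b + j) (f (Suc b)))) ` {..<i - f b}, h (seg w (f b + (i - f b)) (f (Suc b))))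
      \<in> tail_hist h (seg w (f b) (f (Suc b)))"
    unfolding tail_hist_def drop_seg length_seg using i by (intro image_eqI[where x="i - f b"]) auto
  then obtain o' where o': "o' < f' (Suc b) - f' b"
      "(\<lambda>j. h (seg w (f b + j) (f (Suc b)))) ` {..<i - f b} = (\<lambda>j. h (seg w' (f' b + j) (f' (Suc b)))) ` {..<o'}"
      "h (seg w i (f (Suc b))) = h (seg w' (f' b + o') (f' (Suc b)))"
    unfolding eqD unfolding tail_hist_def drop_seg length_seg using i by auto
  show thesis
  proof (rule that)
    show "F (suffix i w) = F (suffix (f' b + o') w')" using o' i by (intro suff[of b]) auto
    have "(\<lambda>j. F (suffix j w)) ` {f b..<i} = (\<lambda>j. F (suffix j w')) ` {f' b..<f' b + o'}"
      using img[OF o'(2)] o'(1) i by simp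
    moreover have "{..<i} = {..<f b} \<union> {f b..<i}" "{..<f' b + o'} = {..<f' b} \<union> {f' b..<f' b + o'}"
      using i by auto
    ultimately show "(\<lambda>j. F (suffix j w)) ` {..<i} = (\<lambda>j. F (suffix j w')) ` {..<f' b + o'}"
      using before[of b] by (simp add: image_Un)
  qed simp
qed

lemma history_subset:
  assumes h: "recog A h F" and w: "range w \<subseteq> A" "range w' \<subseteq> A" and f: "cuts f" "cuts f'"
    and eq: "\<And>i. h (seg w (f i) (f (Suc i))) = h (seg w' (f' i) (f' (Suc i)))"
    and eqJ: "\<And>i. tails h (seg w (f i) (f (Suc i))) = tails h (seg w' (f' i) (f' (Suc i)))"
    and eqD: "\<And>i. tail_hist h (seg w (f i) (f (Suc i))) = tail_hist h (seg w' (f' i) (f' (Suc i)))"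
  shows "hist (\<lambda>i. F (suffix i w)) \<subseteq> hist (\<lambda>i. F (suffix i w'))"
    "lims (\<lambda>i. F (suffix i w)) \<subseteq> lims (\<lambda>i. F (suffix i w'))"
proof -
  note half = history_half[OF h w f eq eqJ eqD]
  show "hist (\<lambda>i. F (suffix i w)) \<subseteq> hist (\<lambda>i. F (suffix i w'))"
  proof (clarsimp simp: hist_def)
    fix i
    obtain b where b: "f b \<le> i" "i < f (Suc b)" using cuts_block[OF f(1)] by blast
    obtain i' where "f' b \<le> i'" "F (suffix i w) = F (suffix i' w')"
      "(\<lambda>j. F (suffix j w)) ` {..<i} = (\<lambda>j. F (suffix j w')) ` {..<i'}"
      by (rule half[OF b])
    then show "((\<lambda>j. F (suffix j w)) ` {..<i}, F (suffix i w))
        \<in> range (\<lambda>i. ((\<lambda>j. F (suffix j w')) ` {..<i}, F (suffix i w')))" by auto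
  qed
  show "lims (\<lambda>i. F (suffix i w)) \<subseteq> lims (\<lambda>i. F (suffix i w'))"
  proof (clarsimp simp: lims_def INFM_nat_le)
    fix v m assume *: "\<forall>m. \<exists>n\<ge>m. F (suffix n w) = v"
    \<comment> \<open>Starting beyond \<open>f m\<close> forces the block number \<open>b\<close> to
      be at least \<open>m\<close>, and then \<open>i'\<close> is at least \<open>f' b\<close>,
      hence at least \<open>m\<close>.\<close>
    then obtain i where i: "i \<ge> f m" "F (suffix i w) = v" by blast
    obtain b where b: "f b \<le> i" "i < f (Suc b)" using cuts_block[OF f(1)] by blast
    have "m \<le> b"
    proof (rule ccontr)
      assume "\<not> m \<le> b"
      then have "f (Suc b) \<le> f m" using f(1) by (simp add: cuts_def strict_mono_less_eq)
      then show False using b i by simp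
    qed
    obtain i' where "f' b \<le> i'" "F (suffix i w) = F (suffix i' w')"
      "(\<lambda>j. F (suffix j w)) ` {..<i} = (\<lambda>j. F (suffix j w')) ` {..<i'}"
      by (rule half[OF b])
    then show "\<exists>n\<ge>m. F (suffix n w') = v"
      using i(2) \<open>m \<le> b\<close> cuts_le[OF f(2), of b] by (intro exI[of _ i']) auto
  qed
qed

text \<open>The three factors count the values of \<open>h\<close>, of \<open>tails\<close> and of
  \<open>tail_hist\<close>. The last two are multiplicative because appending a word acts on the
  classes of all suffixes by one and the same map.\<close>

lemma sat_history:
  fixes F :: "(nat \<Rightarrow> 'a) \<Rightarrow> 'v"
  assumes "sat A F N"
  shows "sat A (\<lambda>w. H (hist (\<lambda>i. F (suffix i w))) (lims (\<lambda>i. F (suffix i w)))) (N * 2 ^ N * 2 ^ (2 ^ N * N))"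
proof -
  obtain h :: "'a list \<Rightarrow> nat" where h: "recog A h F" "h ` lists A \<subseteq> {..<N}"
    using assms unfolding sat_def by blast
  have dl: "drop j u \<in> lists A" if "u \<in> lists A" for j u
    using that by (auto dest: in_set_dropD)
  show ?thesis
  proof (rule satI)
    show "recog A (\<lambda>u. (h u, tails h u, tail_hist h u))
      (\<lambda>w. H (hist (\<lambda>i. F (suffix i w))) (lims (\<lambda>i. F (suffix i w))))"
    proof (rule recogI)
      fix x x' y y' assume in_A: "x \<in> lists A" "x' \<in> lists A" "y \<in> lists A" "y' \<in> lists A"
        and eqs: "(h x, tails h x, tail_hist h x) = (h x', tails h x', tail_hist h x')"
          "(h y, tails h y, tail_hist h y) = (h y', tails h y', tail_hist h y')"
      \<comment> \<open>Right multiplication by the class of \<open>y\<close>, computed on an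
        arbitrary representative; the congruence makes the choice irrelevant.\<close>
      define m where "m a = h ((SOME z. z \<in> lists A \<and> h z = a) @ y)" for a
      have m: "h (z @ t) = m (h z)" if "z \<in> lists A" "t \<in> lists A" "h t = h y" for z t
      proof -
        have "(SOME z'. z' \<in> lists A \<and> h z' = h z) \<in> lists A \<and> h (SOME z'. z' \<in> lists A \<and> h z' = h z) = h z"
          using that(1) by (intro someI_ex[of "\<lambda>z'. z' \<in> lists A \<and> h z' = h z"]) blast
        then show ?thesis unfolding m_def using that in_A by (intro recog_append[OF h(1)]) auto
      qed
      have tls: "tails h (z @ t) = m ` tails h z \<union> tails h t"
        if "z \<in> lists A" "t \<in> lists A" "h t = h y" for z t
        using that m[of "drop _ z" t] dl[of z]
        unfolding tails_def length_append lessThan_add_eq image_Un image_image by (intro arg_cong2[of _ _ _ _ "(\<union>)"] image_cong) auto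
      \<comment> \<open>Positions in \<open>z\<close> keep their history up to \<open>m\<close>,
        whereas positions in \<open>t\<close> also see all suffixes starting in \<open>z\<close>.
        This is why \<open>tails\<close> has to be part of the class.\<close>
      have ths: "tail_hist h (z @ t) = (\<lambda>(P, c). (m ` P, m c)) ` tail_hist h z
          \<union> (\<lambda>(P, c). (m ` tails h z \<union> P, c)) ` tail_hist h t"
        if z: "z \<in> lists A" and t: "t \<in> lists A" "h t = h y" for z t
      proof -
        have 1: "(\<lambda>j. h (drop j (z @ t))) ` {..<i} = m ` (\<lambda>j. h (drop j z)) ` {..<i}"
          if "i \<le> length z" for i
          unfolding image_image using that m[OF dl[OF z] t] by (intro image_cong) auto
        have 2: "(\<lambda>j. h (drop j (z @ t))) ` {..<length z + i} = m ` tails h z \<union> (\<lambda>j. h (drop j t)) ` {..<i}" for i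
          using 1[of "length z"] by (simp add: lessThan_add_eq image_Un image_image tails_def)
        have p1: "((\<lambda>j. h (drop j (z @ t))) ` {..<i}, h (drop i (z @ t))) =
            ((\<lambda>j. m (h (drop j z))) ` {..<i}, m (h (drop i z)))" if "i < length z" for i
          using 1[of i] m[OF dl[OF z] t, of i] that by (simp only: image_image) simp
        have p2: "((\<lambda>j. h (drop j (z @ t))) ` {..<length z + i}, h (drop (length z + i) (z @ t))) =
            (m ` tails h z \<union> (\<lambda>j. h (drop j t)) ` {..<i}, h (drop i t))" for i
          by (simp only: 2) simp
        define E where "E i = ((\<lambda>j. h (drop j (z @ t))) ` {..<i}, h (drop i (z @ t)))" for i
        have "tail_hist h (z @ t) = E ` {..<length z + length t}"
          unfolding tail_hist_def length_append by (rule image_cong) (simp_all only: E_def)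
        also have "\<dots> = E ` {..<length z} \<union> (\<lambda>i. E (length z + i)) ` {..<length t}"
          by (simp only: lessThan_add_eq image_Un image_image)
        also have "E ` {..<length z} = (\<lambda>(P, c). (m ` P, m c)) ` tail_hist h z"
          unfolding tail_hist_def image_image prod.case by (rule image_cong) (simp_all only: E_def p1 lessThan_iff)
        also have "(\<lambda>i. E (length z + i)) ` {..<length t} = (\<lambda>(P, c). (m ` tails h z \<union> P, c)) ` tail_hist h t"
          unfolding tail_hist_def image_image prod.case by (simp only: E_def p2)
        finally show ?thesis .
      qed
      show "(h (x @ y), tails h (x @ y), tail_hist h (x @ y)) = (h (x' @ y'), tails h (x' @ y'), tail_hist h (x' @ y'))"
        using eqs in_A by (simp add: m tls ths)
    next
      fix w w' f f' assume w: "range w \<subseteq> A" "range w' \<subseteq> A" and f: "cuts f" "cuts f'"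
        and eq: "\<And>i. (h (seg w (f i) (f (Suc i))), tails h (seg w (f i) (f (Suc i))), tail_hist h (seg w (f i) (f (Suc i)))) =
             (h (seg w' (f' i) (f' (Suc i))), tails h (seg w' (f' i) (f' (Suc i))), tail_hist h (seg w' (f' i) (f' (Suc i))))"
      have "hist (\<lambda>i. F (suffix i w)) = hist (\<lambda>i. F (suffix i w'))"
        "lims (\<lambda>i. F (suffix i w)) = lims (\<lambda>i. F (suffix i w'))"
        using history_subset[OF h(1) w f] history_subset[OF h(1) w(2,1) f(2,1)] eq by (simp_all add: subset_antisym)
      then show "H (hist (\<lambda>i. F (suffix i w))) (lims (\<lambda>i. F (suffix i w))) =
        H (hist (\<lambda>i. F (suffix i w'))) (lims (\<lambda>i. F (suffix i w')))" by simp
    qed (auto intro: recog_Nil[OF h(1)])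
    have hd: "h (drop j u) < N" if "u \<in> lists A" for j u
      using h(2) dl[OF that] by blast
    show "(\<lambda>u. (h u, tails h u, tail_hist h u)) ` lists A \<subseteq> {..<N} \<times> Pow {..<N} \<times> Pow (Pow {..<N} \<times> {..<N})"
    proof (rule image_subsetI)
      fix u assume u: "u \<in> lists A"
      show "(h u, tails h u, tail_hist h u) \<in> {..<N} \<times> Pow {..<N} \<times> Pow (Pow {..<N} \<times> {..<N})"
        using hd[OF u] hd[OF u, of 0] by (auto simp: tails_def tail_hist_def)
    qed
  qed (simp_all add: card_cartesian_product card_Pow)
qed

text \<open>Power set construction: the class of \<open>u\<close> is the set of classes of its
  labellings by \<open>B\<close>. If two words have blockwise equal classes, each labelling of one
  is matched block by block on the other, so both attain the same set of values.\<close>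

lemma sat_project:
  fixes G :: "(nat \<Rightarrow> 'a \<times> 'b) \<Rightarrow> 'v"
  assumes "sat (A \<times> B) G N"
  shows "sat A (\<lambda>w. H {G (\<lambda>i. (w i, \<rho> i)) | \<rho>. range \<rho> \<subseteq> B}) (2 ^ N)"
proof -
  obtain h :: "('a \<times> 'b) list \<Rightarrow> nat" where h: "recog (A \<times> B) h G" "h ` lists (A \<times> B) \<subseteq> {..<N}"
    using assms unfolding sat_def by blast
  define k where "k u = {h (zip u r) | r. r \<in> lists B \<and> length r = length u}" for u
  have zl: "zip u r \<in> lists (A \<times> B)" if "u \<in> lists A" "r \<in> lists B" for u r
    using that by (auto dest: set_zip_leftD set_zip_rightD)
  have app: "k (x @ y) \<subseteq> k (x' @ y')"
    if "x \<in> lists A" "x' \<in> lists A" "y \<in> lists A" "y' \<in> lists A" "k x = k x'" "k y = k y'" for x x' y y'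
  proof
    fix v assume "v \<in> k (x @ y)"
    then obtain r where r: "r \<in> lists B" "length r = length x + length y" "v = h (zip (x @ y) r)"
      by (auto simp: k_def)
    define r1 r2 where "r1 = take (length x) r" and "r2 = drop (length x) r"
    have r12: "r = r1 @ r2" "length r1 = length x" "length r2 = length y" "r1 \<in> lists B" "r2 \<in> lists B"
      using r by (auto simp: r1_def r2_def dest: in_set_takeD in_set_dropD)
    have "h (zip x r1) \<in> k x'" "h (zip y r2) \<in> k y'" using r12 that by (auto simp: k_def[of x] k_def[of y] simp flip: that(5,6))
    then obtain s1 s2 where s: "s1 \<in> lists B" "length s1 = length x'" "h (zip x r1) = h (zip x' s1)"
        "s2 \<in> lists B" "length s2 = length y'" "h (zip y r2) = h (zip y' s2)"
      by (auto simp: k_def)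
    have "v = h (zip (x' @ y') (s1 @ s2))"
      using r12 r s that by (simp, intro recog_append[OF h(1)] zl) simp_all
    then show "v \<in> k (x' @ y')" using s by (auto simp: k_def intro!: exI[of _ "s1 @ s2"])
  qed
  have transfer: "\<exists>\<rho>'. range \<rho>' \<subseteq> B \<and> G (\<lambda>i. (w i, \<rho> i)) = G (\<lambda>i. (w' i, \<rho>' i))"
    if w: "range w \<subseteq> A" "range w' \<subseteq> A" and f: "cuts f" "cuts f'"
      and eq: "\<And>i. k (seg w (f i) (f (Suc i))) = k (seg w' (f' i) (f' (Suc i)))"
      and \<rho>: "range \<rho> \<subseteq> B" for w w' f f' \<rho>
  proof -
    have zip: "zip (seg w i j) (seg \<rho> i j) = seg (\<lambda>i. (w i, \<rho> i)) i j" for i j and w :: "nat \<Rightarrow> 'a" and \<rho> :: "nat \<Rightarrow> 'b"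
      by (simp add: seg_def zip_map_map zip_same_conv_map)
    have "h (seg (\<lambda>i. (w i, \<rho> i)) (f n) (f (Suc n))) \<in> k (seg w' (f' n) (f' (Suc n)))" for n
    proof -
      have "h (zip (seg w (f n) (f (Suc n))) (seg \<rho> (f n) (f (Suc n)))) \<in> k (seg w (f n) (f (Suc n)))"
        unfolding k_def using seg_in_lists[OF \<rho>] by (intro CollectI exI[of _ "seg \<rho> (f n) (f (Suc n))"]) auto
      then show ?thesis by (simp only: eq zip)
    qed
    then have "\<forall>n. \<exists>r. r \<in> lists B \<and> length r = f' (Suc n) - f' n \<and>
        h (seg (\<lambda>i. (w i, \<rho> i)) (f n) (f (Suc n))) = h (zip (seg w' (f' n) (f' (Suc n))) r)"
      by (auto simp: k_def)
    then obtain r where r: "\<And>n. r n \<in> lists B" "\<And>n. length (r n) = f' (Suc n) - f' n"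
        "\<And>n. h (seg (\<lambda>i. (w i, \<rho> i)) (f n) (f (Suc n))) = h (zip (seg w' (f' n) (f' (Suc n))) (r n))"
      by metis
    \<comment> \<open>The labels chosen separately for the blocks are glued into one sequence:
      \<open>blk i\<close> is the block containing \<open>i\<close>, and \<open>\<rho>'\<close>
      reads the label at the offset of \<open>i\<close> in it.\<close>
    define blk where "blk i = (SOME b. f' b \<le> i \<and> i < f' (Suc b))" for i
    have blk: "f' (blk i) \<le> i" "i < f' (Suc (blk i))" for i
      using someI_ex[of "\<lambda>b. f' b \<le> i \<and> i < f' (Suc b)"] cuts_block[OF f(2), of i] unfolding blk_def by metis+
    have blk_eq: "blk i = b" if "f' b \<le> i" "i < f' (Suc b)" for i b
    proof -
      have "f' b < f' (Suc (blk i))" "f' (blk i) < f' (Suc b)" using that blk[of i] by linarith+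
      then show ?thesis using f(2) by (simp add: cuts_def strict_mono_less)
    qed
    define \<rho>' where "\<rho>' i = r (blk i) ! (i - f' (blk i))" for i
    have seg\<rho>': "seg \<rho>' (f' n) (f' (Suc n)) = r n" for n
    proof (rule nth_equalityI)
      fix i assume i: "i < length (seg \<rho>' (f' n) (f' (Suc n)))"
      then have "blk (f' n + i) = n" by (intro blk_eq) simp_all
      then show "seg \<rho>' (f' n) (f' (Suc n)) ! i = r n ! i" using i by (simp add: seg_def \<rho>'_def)
    qed (simp add: r(2))
    have "\<rho>' i \<in> B" for i
    proof -
      have "i - f' (blk i) < length (r (blk i))" using blk[of i] r(2) by simp
      then show ?thesis using r(1)[of "blk i"] unfolding \<rho>'_def by auto
    qed
    then have \<rho>'B: "range \<rho>' \<subseteq> B" by auto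
    have "G (\<lambda>i. (w i, \<rho> i)) = G (\<lambda>i. (w' i, \<rho>' i))"
    proof (rule recog_eq[OF h(1) _ _ f])
      show "range (\<lambda>i. (w i, \<rho> i)) \<subseteq> A \<times> B" "range (\<lambda>i. (w' i, \<rho>' i)) \<subseteq> A \<times> B"
        using w \<rho> \<rho>'B by auto
      show "h (seg (\<lambda>i. (w i, \<rho> i)) (f n) (f (Suc n))) = h (seg (\<lambda>i. (w' i, \<rho>' i)) (f' n) (f' (Suc n)))" for n
        unfolding r(3) by (simp add: zip[symmetric] seg\<rho>')
    qed
    then show ?thesis using \<rho>'B by blast
  qed
  show ?thesis
  proof (rule satI)
    show "recog A k (\<lambda>w. H {G (\<lambda>i. (w i, \<rho> i)) | \<rho>. range \<rho> \<subseteq> B})"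
    proof (rule recogI)
      fix u assume u: "u \<in> lists A" "k u = k []"
      have "h [] \<in> k []" by (auto simp: k_def)
      then obtain r where r: "r \<in> lists B" "length r = length u" "h [] = h (zip u r)"
        unfolding u(2)[symmetric] by (auto simp: k_def)
      then have "zip u r = []" using u by (intro recog_Nil[OF h(1)] zl) simp_all
      then show "u = []" using r(2) by (cases u; cases r) auto
    next
      fix w w' f f' assume *: "range w \<subseteq> A" "range w' \<subseteq> A" "cuts f" "cuts f'"
        "\<And>i. k (seg w (f i) (f (Suc i))) = k (seg w' (f' i) (f' (Suc i)))"
      have "{G (\<lambda>i. (w i, \<rho> i)) | \<rho>. range \<rho> \<subseteq> B} = {G (\<lambda>i. (w' i, \<rho> i)) | \<rho>. range \<rho> \<subseteq> B}"
        using transfer[OF *] transfer[OF *(2,1,4,3) *(5)[symmetric]] by blast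
      then show "H {G (\<lambda>i. (w i, \<rho> i)) | \<rho>. range \<rho> \<subseteq> B} = H {G (\<lambda>i. (w' i, \<rho> i)) | \<rho>. range \<rho> \<subseteq> B}" by simp
    qed (intro subset_antisym app; simp)
    show "k ` lists A \<subseteq> Pow {..<N}" using h(2) zl by (fastforce simp: k_def)
  qed (simp_all add: card_Pow)
qed

section \<open>Ultimately periodic words\<close>

definition wrap :: "nat \<Rightarrow> nat \<Rightarrow> nat \<Rightarrow> nat" where
  "wrap p L i = (if i < L then i else p + (i - p) mod (L - p))"

text \<open>The word \<open>u v v v ...\<close> with \<open>t = u @ v\<close>, where
  \<open>p\<close> is the length of \<open>u\<close>, that is, the position at which the loop
  starts.\<close>

definition lasso :: "nat \<Rightarrow> 'a list \<Rightarrow> nat \<Rightarrow> 'a" where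
  "lasso p t i = t ! wrap p (length t) i"

lemma wrap_less: assumes "p < L" shows "wrap p L i < L"
proof -
  have "(i - p) mod (L - p) < L - p" using assms by simp
  then have "p + (i - p) mod (L - p) < L" by linarith
  then show ?thesis by (simp add: wrap_def)
qed

lemma wrap_id [simp]: "i < L \<Longrightarrow> wrap p L i = i"
  by (simp add: wrap_def)

lemma wrap_ge: "p \<le> i \<Longrightarrow> wrap p L i = p + (i - p) mod (L - p)"
  by (simp add: wrap_def)

lemma wrap_period: "p \<le> i \<Longrightarrow> wrap p L (i + (L - p)) = wrap p L i"
proof -
  assume "p \<le> i"
  then have "i + (L - p) - p = i - p + (L - p)" by simp
  then show ?thesis using \<open>p \<le> i\<close> by (simp only: wrap_ge trans_le_add1 mod_add_self2)
qed

text \<open>A suffix of a lasso thus depends only on the wrapped starting position, so finitely many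
  positions have to be evaluated.\<close>

lemma wrap_wrap_add: "p < L \<Longrightarrow> wrap p L (wrap p L i + j) = wrap p L (i + j)"
proof (cases "i < L")
  case False
  assume "p < L"
  then have "wrap p L (wrap p L i + j) = p + ((i - p) mod (L - p) + j) mod (L - p)"
    using False by (simp add: wrap_ge)
  also have "\<dots> = p + (i - p + j) mod (L - p)" by (simp add: mod_add_left_eq)
  finally show ?thesis using False \<open>p < L\<close> by (simp add: wrap_ge)
qed simp

lemma range_lasso: "p < length t \<Longrightarrow> range (lasso p t) \<subseteq> set t"
  by (auto simp: lasso_def wrap_less)

lemma suffix_lasso: "p < length t \<Longrightarrow> lasso p t (wrap p (length t) i + j) = lasso p t (i + j)"
  by (simp add: lasso_def wrap_wrap_add)

lemma seg_lasso_init: "seg (lasso (length u) (u @ v)) 0 (length u) = u"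
  by (rule nth_equalityI) (auto simp: seg_def lasso_def nth_append)

lemma seg_lasso_loop:
  "seg (lasso (length u) (u @ v)) (length u + n * length v) (length u + Suc n * length v) = v"
proof (rule nth_equalityI)
  fix i assume "i < length (seg (lasso (length u) (u @ v)) (length u + n * length v) (length u + Suc n * length v))"
  then have "i < length v" by simp
  then show "seg (lasso (length u) (u @ v)) (length u + n * length v) (length u + Suc n * length v) ! i = v ! i"
    by (simp add: seg_def lasso_def wrap_ge nth_append)
qed simp

text \<open>Pumping: a representative of minimal length cannot have two prefixes of the same class,
  since the factor between them could be cut out.\<close>

lemma short_representative:
  assumes h: "recog A h F" "h ` lists A \<subseteq> {..<N :: nat}" and u: "u \<in> lists A"
  obtains v where "v \<in> lists A" "h v = h u" "length v \<le> N"
proof -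
  obtain v where v: "v \<in> lists A \<and> h v = h u"
    and min: "\<And>v'. v' \<in> lists A \<and> h v' = h u \<Longrightarrow> length v \<le> length v'"
    using ex_has_least_nat[of "\<lambda>v. v \<in> lists A \<and> h v = h u" u length] u by blast
  have "length v \<le> N"
  proof (rule ccontr)
    assume "\<not> length v \<le> N"
    have td: "take i v \<in> lists A" "drop i v \<in> lists A" for i
      using v by (auto dest: in_set_takeD in_set_dropD)
    have "(\<lambda>i. h (take i v)) ` {..length v} \<subseteq> {..<N}" using td h(2) by blast
    then have "\<not> inj_on (\<lambda>i. h (take i v)) {..length v}"
      using \<open>\<not> length v \<le> N\<close> card_inj_on_le[of "\<lambda>i. h (take i v)" "{..length v}" "{..<N}"] by auto
    then obtain i j where ij: "i < j" "j \<le> length v" "h (take i v) = h (take j v)"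
      unfolding inj_on_def by (metis atMost_iff linorder_neqE_nat)
    have "h (take i v @ drop j v) = h (take j v @ drop j v)"
      using ij td by (intro recog_append[OF h(1)]) auto
    then have "take i v @ drop j v \<in> lists A \<and> h (take i v @ drop j v) = h u"
      using v td by simp
    from min[OF this] ij show False by simp
  qed
  with v that show thesis by blast
qed

text \<open>The infinite Ramsey theorem cuts any word into one block followed by blocks of a single class;
  replacing these blocks by short representatives makes the word a lasso.\<close>

theorem sat_lasso:
  assumes "sat A F N" and w: "range w \<subseteq> A"
  obtains p t where "set t \<subseteq> A" "p < length t" "length t \<le> 2 * N" "F (lasso p t) = F w"
proof -
  obtain h :: "'a list \<Rightarrow> nat" where h: "recog A h F" "h ` lists A \<subseteq> {..<N}"
    using assms unfolding sat_def by blast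
  have hN: "h (seg w i j) < N" for i j using h(2) seg_in_lists[OF w] by blast
  \<comment> \<open>Pairs of positions are coloured by the class of the segment between
    them.\<close>
  obtain Y c where Y: "infinite Y" "\<And>x y. x \<in> Y \<Longrightarrow> y \<in> Y \<Longrightarrow> x \<noteq> y \<Longrightarrow> h (seg w (Min {x, y}) (Max {x, y})) = c"
    using Ramsey2[of "UNIV :: nat set" "\<lambda>X. h (seg w (Min X) (Max X))" N] hN by auto
  \<comment> \<open>Position 0 is removed so that the initial block, which ends at the first chosen
    position, is nonempty.\<close>
  define e where "e = enumerate (Y - {0})"
  have inf: "infinite (Y - {0})" using Y(1) by simp
  have e_mono: "e i < e j" if "i < j" for i j unfolding e_def by (rule enumerate_mono[OF that inf])
  have e_in: "e n \<in> Y" "0 < e n" for n using enumerate_in_set[OF inf, of n] by (auto simp: e_def)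
  define f where "f n = (case n of 0 \<Rightarrow> 0 | Suc m \<Rightarrow> e m)" for n
  have f: "cuts f" unfolding cuts_def strict_mono_Suc_iff using e_in e_mono by (auto simp: f_def split: nat.splits)
  have c: "h (seg w (f (Suc n)) (f (Suc (Suc n)))) = c" for n
    using Y(2)[of "e n" "e (Suc n)"] e_in e_mono[of n "Suc n"] by (simp add: f_def)
  obtain u where u: "u \<in> lists A" "h u = h (seg w (f 0) (f 1))" "length u \<le> N"
    using short_representative[OF h seg_in_lists[OF w, of "f 0" "f 1"]] by blast
  obtain v where v: "v \<in> lists A" "h v = h (seg w (f 1) (f 2))" "length v \<le> N"
    using short_representative[OF h seg_in_lists[OF w, of "f 1" "f 2"]] by blast
  have flt: "f i < f j" if "i < j" for i j using f that by (simp add: cuts_def strict_mono_less)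
  \<comment> \<open>Only the empty word has the class of the empty word, so representatives of
    nonempty blocks are nonempty.\<close>
  have "u \<noteq> []" using u(2) recog_Nil[OF h(1) seg_in_lists[OF w, of "f 0" "f 1"]] flt[of 0 1]
    by (auto simp: seg_eq_Nil_iff)
  have "v \<noteq> []" using v(2) recog_Nil[OF h(1) seg_in_lists[OF w, of "f 1" "f 2"]] flt[of 1 2]
    by (auto simp: seg_eq_Nil_iff)
  define f' where "f' n = (case n of 0 \<Rightarrow> 0 | Suc m \<Rightarrow> length u + m * length v)" for n
  have f': "cuts f'" unfolding cuts_def strict_mono_Suc_iff
    using \<open>u \<noteq> []\<close> \<open>v \<noteq> []\<close> by (auto simp: f'_def split: nat.splits)
  show thesis
  proof (rule that)
    show *: "set (u @ v) \<subseteq> A" using u(1) v(1) by auto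
    show **: "length u < length (u @ v)" using \<open>v \<noteq> []\<close> by simp
    show "length (u @ v) \<le> 2 * N" using u v by simp
    show "F (lasso (length u) (u @ v)) = F w"
    proof (rule recog_eq[OF h(1) _ w f' f])
      show "range (lasso (length u) (u @ v)) \<subseteq> A" using range_lasso[OF **] * by blast
      fix i show "h (seg (lasso (length u) (u @ v)) (f' i) (f' (Suc i))) = h (seg w (f i) (f (Suc i)))"
      proof (cases i)
        case 0
        then show ?thesis using u(2) seg_lasso_init[of u v] by (simp add: f'_def)
      next
        case (Suc n)
        then show ?thesis using v(2) c[of n] c[of 0] seg_lasso_loop[of u v n]
          by (simp add: f'_def numeral_2_eq_2)
      qed
    qed
  qed
qed

section \<open>The valuations on sequences with finitely many values\<close>

lemma range_eq_snd_hist: "range d = snd ` hist d"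
  by (simp add: hist_def image_image)

lemma lims_subset: "lims d \<subseteq> range d"
  by (auto simp: lims_def dest: INFM_EX)

text \<open>If \<open>f (d i)\<close> takes a value infinitely often, the pigeonhole principle on
  the finite range gives a single value of \<open>d\<close> responsible for infinitely many of these
  indices.\<close>

lemma lims_comp:
  assumes "finite (range d)"
  shows "lims (\<lambda>i. f (d i)) = f ` lims d"
proof (intro subset_antisym subsetI)
  fix v assume "v \<in> lims (\<lambda>i. f (d i))"
  then have "infinite {i. f (d i) = v}" by (simp add: lims_def frequently_cofinite)
  moreover have "finite (d ` {i. f (d i) = v})" using assms by (rule finite_subset[rotated]) auto
  ultimately obtain i where i: "i \<in> {i. f (d i) = v}" "infinite {j \<in> {i. f (d i) = v}. d j = d i}"
    using pigeonhole_infinite by blast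
  have "infinite {j. d j = d i}" using i(2) by (rule infinite_super[rotated]) auto
  then have "d i \<in> lims d" by (simp add: lims_def frequently_cofinite)
  then show "v \<in> f ` lims d" using i(1) by auto
next
  fix v assume "v \<in> f ` lims d"
  then show "v \<in> lims (\<lambda>i. f (d i))" by (auto simp: lims_def elim: frequently_elim1)
qed

lemma infinite_iff_lims:
  assumes "finite (range d)"
  shows "infinite {i. P (d i)} \<longleftrightarrow> (\<exists>v\<in>lims d. P v)"
proof -
  have "infinite {i. P (d i)} \<longleftrightarrow> True \<in> lims (\<lambda>i. P (d i))" by (simp add: lims_def frequently_cofinite)
  then show ?thesis unfolding lims_comp[OF assms] by auto
qed

text \<open>A common form of the three valuations, with \<open>R\<close> the range and
  \<open>I\<close> the recurring values. \<open>ul\<close> says that recurring values take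
  precedence, \<open>up\<close> selects maximum or minimum.
  \<open>I \<subseteq> {\<infinity>}\<close> expresses that only finitely many entries differ from
  \<infinity>.\<close>

definition vset :: "bool \<Rightarrow> bool \<Rightarrow> ereal set \<Rightarrow> ereal set \<Rightarrow> ereal" where
  "vset ul up R I = (if -\<infinity> \<in> R then -\<infinity> else if R \<subseteq> {\<infinity>} then \<infinity>
     else let X = (if ul \<and> \<not> I \<subseteq> {\<infinity>} then I else R) - {\<infinity>} in if up then Max X else Min X)"

lemma eventually_in_lims:
  assumes "finite (range d)"
  obtains K where "\<And>k. K \<le> k \<Longrightarrow> d k \<in> lims d"
proof -
  have "finite {i. d i \<notin> lims d}"
    using infinite_iff_lims[OF assms, of "\<lambda>v. v \<notin> lims d"] by auto
  then obtain K where "\<And>i. i \<in> {i. d i \<notin> lims d} \<Longrightarrow> i < K"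
    using finite_nat_set_iff_bounded by auto
  then show thesis using that[of K] by (meson linorder_not_less mem_Collect_eq)
qed

lemma lims_frequent: "v \<in> lims d \<Longrightarrow> \<exists>k\<ge>i. d k = v"
  by (simp add: lims_def INFM_nat_le)

context
  fixes d :: "nat \<Rightarrow> ereal"
  assumes fin: "finite (range d)"
begin

lemma image_not_PInf: "d ` {i. d i \<noteq> \<infinity>} = range d - {\<infinity>}"
  by auto

lemma infinite_not_PInf: "infinite {i. d i \<noteq> \<infinity>} \<longleftrightarrow> \<not> lims d \<subseteq> {\<infinity>}"
  using infinite_iff_lims[OF fin, of "\<lambda>v. v \<noteq> \<infinity>"] by auto

lemma finite_lims: "finite (lims d)"
  using fin lims_subset by (rule rev_finite_subset)

text \<open>Every tail contains the least finite recurring value, and from some index on only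
  recurring values occur.\<close>

lemma SUP_INF_lims:
  assumes "\<not> lims d \<subseteq> {\<infinity>}"
  shows "(SUP i. INF k\<in>{k. i \<le> k \<and> d k \<noteq> \<infinity>}. d k) = Min (lims d - {\<infinity>})"
proof (rule antisym)
  have m: "Min (lims d - {\<infinity>}) \<in> lims d - {\<infinity>}" using assms finite_lims by (intro Min_in) auto
  show "(SUP i. INF k\<in>{k. i \<le> k \<and> d k \<noteq> \<infinity>}. d k) \<le> Min (lims d - {\<infinity>})"
  proof (rule SUP_least)
    fix i
    obtain k where "k \<ge> i" "d k = Min (lims d - {\<infinity>})"
      using lims_frequent[of "Min (lims d - {\<infinity>})" d i] m by auto
    then show "(INF k\<in>{k. i \<le> k \<and> d k \<noteq> \<infinity>}. d k) \<le> Min (lims d - {\<infinity>})"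
      using m by (intro INF_lower2[of k]) auto
  qed
  obtain K where "\<And>k. K \<le> k \<Longrightarrow> d k \<in> lims d" using eventually_in_lims[OF fin] by blast
  then show "Min (lims d - {\<infinity>}) \<le> (SUP i. INF k\<in>{k. i \<le> k \<and> d k \<noteq> \<infinity>}. d k)"
    using finite_lims by (intro SUP_upper2[of K] INF_greatest) auto
qed

lemma INF_SUP_lims:
  assumes "\<not> lims d \<subseteq> {\<infinity>}"
  shows "(INF i. SUP k\<in>{k. i \<le> k \<and> d k \<noteq> \<infinity>}. d k) = Max (lims d - {\<infinity>})"
proof (rule antisym)
  have m: "Max (lims d - {\<infinity>}) \<in> lims d - {\<infinity>}" using assms finite_lims by (intro Max_in) auto
  show "Max (lims d - {\<infinity>}) \<le> (INF i. SUP k\<in>{k. i \<le> k \<and> d k \<noteq> \<infinity>}. d k)"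
  proof (rule INF_greatest)
    fix i
    obtain k where "k \<ge> i" "d k = Max (lims d - {\<infinity>})"
      using lims_frequent[of "Max (lims d - {\<infinity>})" d i] m by auto
    then show "Max (lims d - {\<infinity>}) \<le> (SUP k\<in>{k. i \<le> k \<and> d k \<noteq> \<infinity>}. d k)"
      using m by (intro SUP_upper2[of k]) auto
  qed
  obtain K where "\<And>k. K \<le> k \<Longrightarrow> d k \<in> lims d" using eventually_in_lims[OF fin] by blast
  then show "(INF i. SUP k\<in>{k. i \<le> k \<and> d k \<noteq> \<infinity>}. d k) \<le> Max (lims d - {\<infinity>})"
    using finite_lims by (intro INF_lower2[of K] SUP_least) auto
qed

lemma val_liminf_eq: "val_liminf d = vset True False (range d) (lims d)"
  and val_limsup_eq: "val_limsup d = vset True True (range d) (lims d)"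
  and val_supm_eq: "val_supm d = vset False True (range d) (lims d)"
proof -
  have 1: "(\<exists>i. d i = -\<infinity>) \<longleftrightarrow> -\<infinity> \<in> range d" "(\<forall>i. d i = \<infinity>) \<longleftrightarrow> range d \<subseteq> {\<infinity>}"
    by (metis rangeE rangeI, auto)
  have 2: "Min (range d - {\<infinity>}) = (INF i\<in>{i. d i \<noteq> \<infinity>}. d i)" "Max (range d - {\<infinity>}) = (SUP i\<in>{i. d i \<noteq> \<infinity>}. d i)"
    if "\<not> range d \<subseteq> {\<infinity>}"
    using that fin unfolding image_not_PInf by (auto intro!: Min_Inf Max_Sup)
  show "val_liminf d = vset True False (range d) (lims d)"
    unfolding val_liminf_def vset_def 1 infinite_not_PInf by (auto simp: 2 SUP_INF_lims)
  show "val_limsup d = vset True True (range d) (lims d)"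
    unfolding val_limsup_def vset_def 1 infinite_not_PInf by (auto simp: 2 INF_SUP_lims)
  show "val_supm d = vset False True (range d) (lims d)"
    unfolding val_supm_def vset_def 1 by (auto simp: 2)
qed

text \<open>The valuations select one of the given values; this keeps the semantics of formulas
  finite-valued.\<close>

lemma vset_in_range: "vset ul up (range d) (lims d) \<in> range d"
proof -
  define X where "X = (if ul \<and> \<not> lims d \<subseteq> {\<infinity>} then lims d else range d) - {\<infinity>}"
  have X: "X \<subseteq> range d" unfolding X_def using lims_subset[of d] by auto
  show ?thesis
  proof (cases "range d \<subseteq> {\<infinity>}")
    case True
    then have "range d = {\<infinity>}" by (auto dest!: subset_singletonD)
    then show ?thesis by (simp add: vset_def)
  next
    case False
    then have "X \<noteq> {}" unfolding X_def by (auto simp del: image_subset_iff)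
    then have "Max X \<in> range d" "Min X \<in> range d"
      using X Max_in[of X] Min_in[of X] finite_subset[OF X fin] by blast+
    moreover have "vset ul up (range d) (lims d) = (if -\<infinity> \<in> range d then -\<infinity> else if up then Max X else Min X)"
      unfolding vset_def Let_def X_def using False by argo
    ultimately show ?thesis by (auto split: if_splits)
  qed
qed

end

section \<open>Recognition of semantics and behaviours\<close>

text \<open>One level dominates every construction: the square serves products and next, the single
  power serves projection, the last summand serves histories.\<close>

primrec tower :: "nat \<Rightarrow> nat \<Rightarrow> nat" where
  "tower b 0 = b"
| "tower b (Suc n) = tower b n * tower b n + 2 ^ tower b n
     + tower b n * 2 ^ tower b n * 2 ^ (2 ^ tower b n * tower b n)"

lemma tower_mono: "m \<le> n \<Longrightarrow> tower b m \<le> tower b n"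
proof (rule lift_Suc_mono_le[of "tower b"])
  show "tower b n \<le> tower b (Suc n)" for n
    using less_exp[of "tower b n"] by (simp add: trans_le_add1 trans_le_add2 less_imp_le)
qed

lemma tower_mult: "N \<le> tower b n \<Longrightarrow> M \<le> tower b n \<Longrightarrow> N * M \<le> tower b (Suc n)"
  by (simp add: mult_le_mono trans_le_add1)

lemma tower_pow: "N \<le> tower b n \<Longrightarrow> 2 ^ N \<le> tower b (Suc n)"
  by (simp add: trans_le_add1 trans_le_add2)

lemma sat_tower_history:
  "sat A F (tower b n) \<Longrightarrow>
    sat A (\<lambda>w. H (hist (\<lambda>i. F (suffix i w))) (lims (\<lambda>i. F (suffix i w)))) (tower b (Suc n))"
  by (rule sat_mono[OF sat_history]) auto

lemma sat_tower_mono: "sat A F (tower b m) \<Longrightarrow> m \<le> n \<Longrightarrow> sat A F (tower b n)"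
  by (rule sat_mono[OF _ tower_mono])

lemma sat_tower_combine:
  "sat A F (tower b m) \<Longrightarrow> sat A G (tower b k) \<Longrightarrow> m \<le> n \<Longrightarrow> k \<le> n \<Longrightarrow> sat A (\<lambda>w. H (F w) (G w)) (tower b (Suc n))"
  by (rule sat_mono[OF sat_combine tower_mult]) (auto intro: tower_mono)

lemma sat_tower_next:
  "sat A F (tower b n) \<Longrightarrow> sat A (\<lambda>w. F (suffix 1 w)) (tower b (Suc n))"
  by (rule sat_mono[OF sat_next tower_mult]) auto

lemma sat_tower_first:
  "finite A \<Longrightarrow> card A + 2 \<le> b \<Longrightarrow> sat A (\<lambda>w. g (w 0)) (tower b n)"
  by (rule sat_tower_mono[OF sat_mono[OF sat_first]]) auto

text \<open>What a path contributes is visible in pairs of consecutive letters. The four levels are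
  next, pairing, history, and pairing with the first letter.\<close>

lemma sat_windows:
  assumes "finite A" "card A + 2 \<le> b"
  shows "sat A (\<lambda>x. H (x 0) (range (\<lambda>i. (x i, x (Suc i)))) (lims (\<lambda>i. (x i, x (Suc i))))) (tower b 4)"
proof -
  note first = sat_tower_first[OF assms, of "\<lambda>a. a" 0]
  have "sat A (\<lambda>w. (w 0, w 1)) (tower b 2)"
    using sat_tower_combine[OF first sat_tower_next[OF first], of 1 Pair]
    by (simp add: suffix_def eval_nat_numeral)
  from sat_tower_history[OF this, of "\<lambda>X Y. (snd ` X, Y)"]
  have "sat A (\<lambda>x. (range (\<lambda>i. (x i, x (Suc i))), lims (\<lambda>i. (x i, x (Suc i))))) (tower b 3)"
    unfolding range_eq_snd_hist[symmetric] by (simp add: suffix_def eval_nat_numeral)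
  from sat_tower_combine[OF first this, of 3 "\<lambda>a (X, Y). H a X Y"] show ?thesis
    by (simp add: eval_nat_numeral)
qed

lemma add_le_prod_encode: "a + b \<le> pr a b"
proof -
  have "n \<le> triangle n" for n by (induction n) auto
  from this[of "a + b"] show ?thesis by (simp add: prod_encode_def)
qed

text \<open>Letters are represented by codes of lists of their elements.\<close>

definition letter :: "nat \<Rightarrow> nat set" where "letter c = set (list_decode c)"

lemma lims_eventually_const:
  assumes "\<And>j. K \<le> j \<Longrightarrow> d j = c" shows "lims d = {c}"
  unfolding lims_def INFM_nat_le using assms by (auto intro: le_add1 le_add2)

text \<open>The three valuations differ only in the two switches, so the argument is carried out
  once.\<close>

locale valuation =
  fixes V :: "(nat \<Rightarrow> ereal) \<Rightarrow> ereal" and ul up :: bool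
  assumes V: "finite (range d) \<Longrightarrow> V d = vset ul up (range d) (lims d)"
begin

lemma V_in_range: "finite (range d) \<Longrightarrow> V d \<in> range d"
  using vset_in_range[of d ul up] by (simp add: V)

lemma finite_sem: "finite (range (sem V \<phi>))"
proof (induction \<phi>)
  case (FOr \<phi> \<psi>)
  show ?case
    by (rule finite_subset[of _ "(\<lambda>(a, b). sup a b) ` (range (sem V \<phi>) \<times> range (sem V \<psi>))"]) (use FOr in auto)
next
  case (FAnd \<phi> \<psi>)
  show ?case
    by (rule finite_subset[of _ "(\<lambda>(a, b). inf a b) ` (range (sem V \<phi>) \<times> range (sem V \<psi>))"]) (use FAnd in auto)
next
  case (FNext \<phi>)
  show ?case by (rule finite_subset[OF _ FNext]) auto
next
  case (FUntil \<phi> \<psi>)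
  let ?S = "range (sem V \<phi>) \<union> range (sem V \<psi>) \<union> {\<infinity>}"
  have S: "finite ?S" using FUntil by simp
  have "V (\<lambda>j. if j < i then sem V \<phi> (suffix j w) else if j = i then sem V \<psi> (suffix i w) else \<infinity>) \<in> ?S" for i w
  proof -
    let ?d = "\<lambda>j. if j < i then sem V \<phi> (suffix j w) else if j = i then sem V \<psi> (suffix i w) else \<infinity>"
    have "range ?d \<subseteq> ?S" by auto
    then show ?thesis using V_in_range[of ?d] finite_subset[OF _ S] by blast
  qed
  then have "range (\<lambda>i. V (\<lambda>j. if j < i then sem V \<phi> (suffix j w) else if j = i then sem V \<psi> (suffix i w) else \<infinity>)) \<subseteq> ?S" for w
    by blast
  \<comment> \<open>The supremum ranges over infinitely many terms, but it is the supremum of some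
    subset of the finite set of possible terms.\<close>
  then have "sem V (FUntil \<phi> \<psi>) w \<in> Sup ` Pow ?S" for w
    unfolding sem.simps by (intro image_eqI[OF refl] PowI)
  then have "range (sem V (FUntil \<phi> \<psi>)) \<subseteq> Sup ` Pow ?S" by (intro image_subsetI)
  moreover have "finite (Sup ` Pow ?S)" by (intro finite_imageI finite_Pow_iff[THEN iffD2] S)
  ultimately show ?case by (rule finite_subset)
next
  case (FBox \<phi>)
  have "sem V (FBox \<phi>) w \<in> range (sem V \<phi>)" for w
  proof -
    have sub: "range (\<lambda>i. sem V \<phi> (suffix i w)) \<subseteq> range (sem V \<phi>)" by auto
    then show ?thesis using V_in_range[OF finite_subset[OF sub FBox]] by auto
  qed
  then show ?case by (intro finite_subset[OF _ FBox]) auto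
qed (rule finite_subset[of _ "{-\<infinity>, \<infinity>, qval _}"]; auto)+

lemma finite_sem_suffixes: "finite (range (\<lambda>i. sem V \<phi> (f i)))"
  by (rule finite_subset[OF _ finite_sem[of \<phi>]]) auto

text \<open>The padding makes \<infinity> the only recurring value, so the value depends on the set
  of entries alone.\<close>

lemma V_until:
  "V (\<lambda>j. if j < i then a j else if j = i then b else \<infinity>) = vset ul up (a ` {..<i} \<union> {b, \<infinity>}) {\<infinity>}"
proof -
  let ?d = "\<lambda>j. if j < i then a j else if j = i then b else \<infinity>"
  have "?d ` UNIV = ?d ` ({..<i} \<union> {i} \<union> {i<..})" by (rule arg_cong[of _ _ "image ?d"]) auto
  also have "\<dots> = a ` {..<i} \<union> {b, \<infinity>}" by (auto simp: image_Un image_iff)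
  finally have "range ?d = a ` {..<i} \<union> {b, \<infinity>}" .
  moreover have "lims ?d = {\<infinity>}" by (rule lims_eventually_const[of "Suc i"]) auto
  ultimately show ?thesis by (simp add: V)
qed

text \<open>The tag in the code of a compound formula leaves room for the levels that its operator
  adds to those of its parts.\<close>

lemma sat_sem:
  assumes A: "finite A" "card A + 2 \<le> b"
  shows "sat A (\<lambda>w. sem V \<phi> (\<lambda>i. letter (w i))) (tower b (enc_form \<phi>))"
proof (induction \<phi>)
  case (FConst k)
  have "sat A (\<lambda>w. qval k) (tower b 0)" by (rule sat_mono[OF sat_const]) (use A in simp)
  from sat_tower_mono[OF this le0] show ?case by simp
next
  case (FAtom a)
  show ?case unfolding sem.simps by (rule sat_tower_first[OF A])
next
  case (FNAtom a)
  show ?case unfolding sem.simps by (rule sat_tower_first[OF A])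
next
  case (FOr \<phi> \<psi>)
  have "Suc (enc_form \<phi> + enc_form \<psi>) \<le> enc_form (FOr \<phi> \<psi>)"
    using add_le_prod_encode[of 3 "pr (enc_form \<phi>) (enc_form \<psi>)"] add_le_prod_encode[of "enc_form \<phi>" "enc_form \<psi>"] by simp
  then show ?case unfolding sem.simps
    by (rule sat_tower_mono[OF sat_tower_combine[OF FOr le_add1 le_add2]])
next
  case (FAnd \<phi> \<psi>)
  have "Suc (enc_form \<phi> + enc_form \<psi>) \<le> enc_form (FAnd \<phi> \<psi>)"
    using add_le_prod_encode[of 4 "pr (enc_form \<phi>) (enc_form \<psi>)"] add_le_prod_encode[of "enc_form \<phi>" "enc_form \<psi>"] by simp
  then show ?case unfolding sem.simps
    by (rule sat_tower_mono[OF sat_tower_combine[OF FAnd le_add1 le_add2]])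
next
  case (FNext \<phi>)
  have "Suc (enc_form \<phi>) \<le> enc_form (FNext \<phi>)" using add_le_prod_encode[of 5 "enc_form \<phi>"] by simp
  with sat_tower_mono[OF sat_tower_next[OF FNext]] show ?case by (simp add: suffix_def del: enc_form.simps)
next
  case (FUntil \<phi> \<psi>)
  let ?f = "\<lambda>w. sem V \<phi> (\<lambda>i. letter (w i))" and ?g = "\<lambda>w. sem V \<psi> (\<lambda>i. letter (w i))"
  let ?e = "enc_form \<phi> + enc_form \<psi>"
  \<comment> \<open>Two levels: one to pair the operands, one for the history of the pair.\<close>
  have e: "Suc (Suc ?e) \<le> enc_form (FUntil \<phi> \<psi>)"
    using add_le_prod_encode[of 6 "pr (enc_form \<phi>) (enc_form \<psi>)"] add_le_prod_encode[of "enc_form \<phi>" "enc_form \<psi>"] by simp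
  have "sat A (\<lambda>w. (?f w, ?g w)) (tower b (Suc ?e))" using sat_tower_combine[OF FUntil, of ?e Pair] by simp
  from sat_tower_history[OF this, of "\<lambda>X Y. SUP (P, v)\<in>X. vset ul up (fst ` P \<union> {snd v, \<infinity>}) {\<infinity>}"]
  show ?case
    by (intro sat_tower_mono[OF _ e])
       (simp add: hist_def image_image V_until suffix_def)
next
  case (FBox \<phi>)
  have "Suc (enc_form \<phi>) \<le> enc_form (FBox \<phi>)" using add_le_prod_encode[of 7 "enc_form \<phi>"] by simp
  moreover have "sat A (\<lambda>w. sem V (FBox \<phi>) (\<lambda>i. letter (w i))) (tower b (Suc (enc_form \<phi>)))"
    using sat_tower_history[OF FBox, of "\<lambda>X Y. vset ul up (snd ` X) Y"]
    unfolding range_eq_snd_hist[symmetric] by (simp add: suffix_def V finite_sem_suffixes)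
  ultimately show ?case using sat_tower_mono by blast
qed

text \<open>Generic in the letters, as it is used twice: for pairs of letter and state, and for
  pairs of lasso position and state. \<open>None\<close> marks sequences that are not successful
  paths.\<close>

definition path_value :: "('a \<Rightarrow> bool) \<Rightarrow> ('a \<Rightarrow> 'a \<Rightarrow> bool) \<Rightarrow> ('a \<Rightarrow> bool) \<Rightarrow> ('a \<Rightarrow> 'a \<Rightarrow> ereal) \<Rightarrow> (nat \<Rightarrow> 'a) \<Rightarrow> ereal option" where
  "path_value ini step acc wt x =
     (if ini (x 0) \<and> (\<forall>i. step (x i) (x (Suc i))) \<and> infinite {i. acc (x i)}
      then Some (V (\<lambda>i. wt (x i) (x (Suc i)))) else None)"

text \<open>Steps are a condition on all windows, acceptance one on recurring windows, and the
  weights and recurring weights are images of the two sets of windows.\<close>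

lemma sat_path_value:
  assumes A: "finite A" "card A + 2 \<le> b"
  shows "sat A (path_value ini step acc wt) (tower b 4)"
proof -
  let ?H = "\<lambda>a R I. if ini a \<and> (\<forall>(a, b)\<in>R. step a b) \<and> (\<exists>(a, b)\<in>I. acc a)
      then Some (vset ul up (case_prod wt ` R) (case_prod wt ` I)) else None"
  show ?thesis
  proof (rule sat_cong[OF sat_windows[OF A, of ?H]])
    fix x :: "nat \<Rightarrow> 'a" assume "range x \<subseteq> A"
    then have "range (\<lambda>i. (x i, x (Suc i))) \<subseteq> A \<times> A" by auto
    then have fin: "finite (range (\<lambda>i. (x i, x (Suc i))))" using A(1) finite_subset by blast
    have 1: "finite (range (\<lambda>i. case_prod wt (x i, x (Suc i))))"
      using finite_imageI[OF fin, of "case_prod wt"] by (simp add: image_image)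
    have 2: "infinite {i. acc (x i)} \<longleftrightarrow> (\<exists>(a, b)\<in>lims (\<lambda>i. (x i, x (Suc i))). acc a)"
      using infinite_iff_lims[OF fin, of "\<lambda>(a, b). acc a"] by simp
    have 3: "V (\<lambda>i. case_prod wt (x i, x (Suc i))) =
      vset ul up (case_prod wt ` range (\<lambda>i. (x i, x (Suc i)))) (case_prod wt ` lims (\<lambda>i. (x i, x (Suc i))))"
      unfolding V[OF 1] lims_comp[OF fin] image_image ..
    show "?H (x 0) (range (\<lambda>i. (x i, x (Suc i)))) (lims (\<lambda>i. (x i, x (Suc i)))) = path_value ini step acc wt x"
      unfolding path_value_def 2 using 3 by simp
  qed
qed

text \<open>The behaviour as a function of the set of path values, the shape to which
  \<open>sat_project\<close> applies.\<close>

lemma wba_beh_eq: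
  "wba_beh V (WBA n T I F) (\<lambda>i. letter (w i)) =
    Sup {v. Some v \<in> {path_value (\<lambda>(a, p). p \<in> set I) (\<lambda>_ _. True) (\<lambda>(a, p). p \<in> set F)
      (\<lambda>(a, p) (a', q). qval (lookup_wt T p (letter a) q)) (\<lambda>i. (w i, \<rho> i)) | \<rho>. range \<rho> \<subseteq> {..<n}}}"
  unfolding wba_beh_def path_value_def by (rule arg_cong[of _ _ Sup]) (auto simp: image_subset_iff split: if_splits)

lemma sat_beh:
  assumes A: "finite A" "card A * n + 2 \<le> b"
  shows "sat A (\<lambda>w. wba_beh V (WBA n T I F) (\<lambda>i. letter (w i))) (tower b 5)"
proof -
  have "sat A (\<lambda>w. wba_beh V (WBA n T I F) (\<lambda>i. letter (w i))) (2 ^ tower b 4)"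
    unfolding wba_beh_eq
    by (rule sat_project[where H="\<lambda>S. Sup {v. Some v \<in> S}"], rule sat_path_value) (use A in simp_all)
  then show ?thesis by (rule sat_mono) (use tower_pow[of "tower b 4" b 4] in \<open>simp add: eval_nat_numeral\<close>)
qed

text \<open>The input word is absorbed into the path: the conditions on the first component force it
  to run through the positions of the lasso.\<close>

definition product_value ::
    "(nat \<times> nat list \<times> nat \<times> qbar) list \<Rightarrow> nat list \<Rightarrow> nat list \<Rightarrow> nat \<Rightarrow> nat list \<Rightarrow> (nat \<Rightarrow> nat \<times> nat) \<Rightarrow> ereal option"
  where "product_value T I F p t =
     path_value (\<lambda>(i, s). i = 0 \<and> s \<in> set I) (\<lambda>(i, s) (j, r). j = wrap p (length t) (Suc i))
      (\<lambda>(i, s). s \<in> set F) (\<lambda>(i, s) (j, r). qval (lookup_wt T s (letter (t ! i)) r))"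

text \<open>\<open>sat_lasso\<close>, applied to words over pairs of position and state, replaces
  any path by a lasso-shaped one of equal value. Conversely such a lasso is a path over the input
  word, as its positions are forced.\<close>

lemma wba_beh_lasso:
  fixes t :: "nat list"
  assumes p: "p < length t" and b: "length t * n + 2 \<le> b"
  shows "wba_beh V (WBA n T I F) (\<lambda>i. letter (lasso p t i)) =
    Sup {v. \<exists>q u. set u \<subseteq> {..<length t} \<times> {..<n} \<and> q < length u \<and> length u \<le> 2 * tower b 4 \<and> product_value T I F p t (lasso q u) = Some v}"
  unfolding wba_beh_eq
proof (intro arg_cong[of _ _ Sup] Collect_cong iffI)
  define G where "G = product_value T I F p t"
  note G_def = G_def product_value_def
  let ?A = "{..<length t} \<times> {..<n}"
  let ?G = "path_value (\<lambda>(a, p). p \<in> set I) (\<lambda>_ _. True) (\<lambda>(a, p). p \<in> set F)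
      (\<lambda>(a, p) (a', q). qval (lookup_wt T p (letter a) q))"
  have pos: "wrap p (length t) 0 = 0" by (rule wrap_id) (use p in linarith)
  have eq: "?G (\<lambda>i. (lasso p t i, \<rho> i)) = G (\<lambda>i. (wrap p (length t) i, \<rho> i))" for \<rho>
    using wrap_wrap_add[OF p, of _ 1] pos by (simp add: G_def path_value_def lasso_def)
  fix v
  {
    assume "Some v \<in> {?G (\<lambda>i. (lasso p t i, \<rho> i)) | \<rho>. range \<rho> \<subseteq> {..<n}}"
    then obtain \<rho> where \<rho>: "range \<rho> \<subseteq> {..<n}" "G (\<lambda>i. (wrap p (length t) i, \<rho> i)) = Some v"
      unfolding eq by auto
    have rng: "range (\<lambda>i. (wrap p (length t) i, \<rho> i)) \<subseteq> ?A" using \<rho>(1) wrap_less[OF p] by auto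
    have "sat ?A G (tower b 4)" unfolding G_def using b by (intro sat_path_value) simp_all
    from this rng obtain q u where "set u \<subseteq> ?A" "q < length u" "length u \<le> 2 * tower b 4"
      "G (lasso q u) = G (\<lambda>i. (wrap p (length t) i, \<rho> i))" by (rule sat_lasso)
    then show "\<exists>q u. set u \<subseteq> ?A \<and> q < length u \<and> length u \<le> 2 * tower b 4 \<and> product_value T I F p t (lasso q u) = Some v"
      using \<rho>(2) unfolding G_def(1) by auto
  }
  assume "\<exists>q u. set u \<subseteq> ?A \<and> q < length u \<and> length u \<le> 2 * tower b 4 \<and> product_value T I F p t (lasso q u) = Some v"
  then obtain q u where qu: "set u \<subseteq> ?A" "q < length u" "G (lasso q u) = Some v" unfolding G_def(1) by blast
  define x where "x = lasso q u"
  have x: "fst (x 0) = 0" "fst (x (Suc i)) = wrap p (length t) (Suc (fst (x i)))" for i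
    using qu(3) by (auto simp: G_def path_value_def x_def case_prod_beta split: if_splits)
  have "fst (x i) = wrap p (length t) i" for i
    by (induction i) (use x pos wrap_wrap_add[OF p, of _ 1] in simp_all)
  then have "x = (\<lambda>i. (wrap p (length t) i, snd (x i)))" by (metis prod.collapse)
  then have "Some v = ?G (\<lambda>i. (lasso p t i, snd (x i)))" unfolding eq using qu(3) x_def by simp
  moreover have "x i \<in> ?A" for i
    using subset_trans[OF range_lasso[OF qu(2)] qu(1)] unfolding x_def by (rule subsetD) (rule rangeI)
  then have "range (\<lambda>i. snd (x i)) \<subseteq> {..<n}" by (intro image_subsetI) (metis mem_Times_iff)
  ultimately show "Some v \<in> {?G (\<lambda>i. (lasso p t i, \<rho> i)) | \<rho>. range \<rho> \<subseteq> {..<n}}"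
    by (intro CollectI exI[of _ "\<lambda>i. snd (x i)"] conjI)
qed

lemma equiv_iff_lassos:
  assumes A: "finite A" "letter ` A = Pow AP" and b: "card A + 2 \<le> b" "card A * n + 2 \<le> b"
  shows "(\<forall>w. (\<forall>i. w i \<subseteq> AP) \<longrightarrow> sem V \<phi> w = wba_beh V (WBA n T I F) w) \<longleftrightarrow>
    (\<forall>p t. set t \<subseteq> A \<and> p < length t \<and> length t \<le> 2 * tower b (enc_form \<phi> + 6) \<longrightarrow>
      sem V \<phi> (\<lambda>i. letter (lasso p t i)) = wba_beh V (WBA n T I F) (\<lambda>i. letter (lasso p t i)))"
    (is "?L \<longleftrightarrow> ?R")
proof
  assume L: ?L
  show ?R
  proof (intro allI impI)
    fix p t assume "set t \<subseteq> A \<and> p < length t \<and> length t \<le> 2 * tower b (enc_form \<phi> + 6)"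
    then have "lasso p t i \<in> A" for i using range_lasso[of p t] by auto
    then have "letter (lasso p t i) \<subseteq> AP" for i using A(2) by blast
    then show "sem V \<phi> (\<lambda>i. letter (lasso p t i)) = wba_beh V (WBA n T I F) (\<lambda>i. letter (lasso p t i))"
      by (intro L[rule_format])
  qed
next
  assume R: ?R
  show ?L
  proof (intro allI impI)
    fix w :: "nat \<Rightarrow> nat set" assume "\<forall>i. w i \<subseteq> AP"
    then have "\<forall>i. \<exists>c\<in>A. w i = letter c" using A(2) by blast
    then obtain c where c: "\<And>i. c i \<in> A" "w = (\<lambda>i. letter (c i))" by metis
    \<comment> \<open>The two sides are paired so that one lasso realises both values of
      \<open>w\<close>. Their heights \<open>enc_form \<phi>\<close> and 5 are at most the sum, and
      pairing adds one level.\<close>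
    let ?F = "\<lambda>w. (sem V \<phi> (\<lambda>i. letter (w i)), wba_beh V (WBA n T I F) (\<lambda>i. letter (w i)))"
    have 6: "enc_form \<phi> + 6 = Suc (enc_form \<phi> + 5)" by simp
    have "sat A ?F (tower b (enc_form \<phi> + 6))"
      unfolding 6 by (rule sat_tower_combine[OF sat_sem[OF A(1) b(1)] sat_beh[OF A(1) b(2)], where H=Pair]) simp_all
    moreover have "range c \<subseteq> A" using c(1) by blast
    ultimately obtain p t where pt: "set t \<subseteq> A" "p < length t" "length t \<le> 2 * tower b (enc_form \<phi> + 6)"
      "?F (lasso p t) = ?F c" by (rule sat_lasso)
    have "sem V \<phi> (\<lambda>i. letter (lasso p t i)) = wba_beh V (WBA n T I F) (\<lambda>i. letter (lasso p t i))"
      using pt(1-3) by (intro R[rule_format] conjI)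
    with pt(4) show "sem V \<phi> w = wba_beh V (WBA n T I F) w"
      unfolding c(2) prod.inject by argo
  qed
qed

end

section \<open>Computing with codes of values\<close>

lemma cmp_comp2:
  assumes f: "cmp (\<lambda>z. f (pfst z) (psnd z))" and "cmp a" "cmp b"
  shows "cmp (\<lambda>x. f (a x) (b x))"
  using cmp_comp[OF f cmp_pr[OF assms(2,3)]] by simp

text \<open>A positive integer \<open>b\<close> has the code \<open>2 * b\<close>, so halving
  decodes it.\<close>

definition den :: "nat \<Rightarrow> nat" where
  "den m = (if psnd m div 2 = 0 then 1 else psnd m div 2)"

text \<open>Left inverse of \<open>enc_qbar\<close>, up to \<open>qval\<close>; the denominator of a code is forced to be positive.\<close>

definition valc :: "nat \<Rightarrow> ereal" where
  "valc c = (if c = 0 then -\<infinity> else if c = 1 then \<infinity>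
     else ereal (of_int (int_decode (pfst (c - 2))) / of_nat (den (c - 2))))"

lemma den_pos [simp]: "0 < den m"
  by (simp add: den_def)

lemma valc_enc_qbar [simp]: "valc (enc_qbar k) = qval k"
proof (cases k)
  case (QFin q)
  obtain a b where ab: "quotient_of q = (a, b)" by force
  have b: "b > 0" using quotient_of_denom_pos[OF ab] .
  have q: "q = of_int a / of_int b" using quotient_of_div[OF ab] .
  have "int_encode b = 2 * nat b" using b by (simp add: int_encode_def sum_encode_def)
  then have "of_nat (den (enc_rat q)) = (of_int b :: real)"
    using b by (simp add: enc_rat_def ab den_def)
  then have "valc (enc_qbar (QFin q)) = ereal (of_int a / of_int b)"
    by (simp add: valc_def enc_rat_def ab)
  also have "\<dots> = ereal (of_rat q)" unfolding q by (simp add: of_rat_divide)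
  finally show ?thesis using QFin by simp
qed (simp_all add: valc_def)

lemma valc_eq_MInf [simp]: "valc c = -\<infinity> \<longleftrightarrow> c = 0" and valc_eq_PInf [simp]: "valc c = \<infinity> \<longleftrightarrow> c = 1"
  by (simp_all add: valc_def)

lemma valc_0 [simp]: "valc 0 = -\<infinity>" and valc_1 [simp]: "valc (Suc 0) = \<infinity>"
  by (simp_all add: valc_def)

text \<open>Fractions are compared by cross-multiplication within the natural numbers. An even
  integer code \<open>c\<close> stands for \<open>c div 2\<close>, an odd one for the negative of
  \<open>Suc (c div 2)\<close>, so parity gives the sign.\<close>

definition cle_fin :: "nat \<Rightarrow> nat \<Rightarrow> bool" where
  "cle_fin m n \<longleftrightarrow> (if even (pfst m) then even (pfst n) \<and> pfst m div 2 * den n \<le> pfst n div 2 * den m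
     else even (pfst n) \<or> Suc (pfst n div 2) * den m \<le> Suc (pfst m div 2) * den n)"

definition cle :: "nat \<Rightarrow> nat \<Rightarrow> bool" where
  "cle c d \<longleftrightarrow> c = 0 \<or> d = 1 \<or> 2 \<le> c \<and> 2 \<le> d \<and> cle_fin (c - 2) (d - 2)"

lemma cle_fin_iff:
  "cle_fin m n \<longleftrightarrow> (of_int (int_decode (pfst m)) / of_nat (den m) :: real) \<le> of_int (int_decode (pfst n)) / of_nat (den n)"
proof -
  let ?a = "int_decode (pfst m)" and ?b = "int_decode (pfst n)" and ?D = "den m" and ?C = "den n"
  have "(of_int ?a / of_nat ?D :: real) \<le> of_int ?b / of_nat ?C \<longleftrightarrow> (of_int ?a * of_nat ?C :: real) \<le> of_int ?b * of_nat ?D"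
    by (simp add: field_simps)
  also have "\<dots> \<longleftrightarrow> ?a * int ?C \<le> ?b * int ?D"
    by (metis of_int_le_iff of_int_mult of_int_of_nat_eq)
  also have "\<dots> \<longleftrightarrow> cle_fin m n"
  proof -
    have ev: "int_decode c = int (c div 2)" if "even c" for c
      using that by (simp add: int_decode_def sum_decode_def)
    have od: "int_decode c = - int (Suc (c div 2))" if "odd c" for c
      using that by (simp add: int_decode_def sum_decode_def)
    have pos: "0 < int (Suc a) * int (den x)" for a x by simp
    have nn: "0 \<le> int a * int (den x)" for a x by simp
    consider "even (pfst m)" "even (pfst n)" | "even (pfst m)" "odd (pfst n)"
      | "odd (pfst m)" "even (pfst n)" | "odd (pfst m)" "odd (pfst n)" by blast
    then show ?thesis
    proof cases
      case 1
      then show ?thesis by (simp add: cle_fin_def ev flip: of_nat_mult del: zdiv_int of_nat_div)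
    next
      case 2
      have "\<not> cle_fin m n" using 2 by (simp add: cle_fin_def)
      moreover have "\<not> ?a * int ?C \<le> ?b * int ?D"
        unfolding ev[OF 2(1)] od[OF 2(2)] mult_minus_left
        using pos[of "pfst n div 2" m] nn[of "pfst m div 2" n] by linarith
      ultimately show ?thesis by simp
    next
      case 3
      have "cle_fin m n" using 3 by (simp add: cle_fin_def)
      moreover have "?a * int ?C \<le> ?b * int ?D"
        unfolding od[OF 3(1)] ev[OF 3(2)] mult_minus_left
        using pos[of "pfst m div 2" n] nn[of "pfst n div 2" m] by linarith
      ultimately show ?thesis by simp
    next
      case 4
      have "cle_fin m n \<longleftrightarrow> Suc (pfst n div 2) * ?D \<le> Suc (pfst m div 2) * ?C"
        using 4 by (simp add: cle_fin_def)
      then show ?thesis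
        unfolding od[OF 4(1)] od[OF 4(2)] mult_minus_left neg_le_iff_le
        by (simp only: of_nat_mult[symmetric] of_nat_le_iff)
    qed
  qed
  finally show ?thesis by simp
qed

lemma cle_iff: "cle c d \<longleftrightarrow> valc c \<le> valc d"
proof -
  consider "c = 0" | "c = 1" | "2 \<le> c" by linarith
  moreover consider "d = 0" | "d = 1" | "2 \<le> d" by linarith
  ultimately show ?thesis by cases (auto simp: cle_def valc_def cle_fin_iff)
qed

lemma cmp_den [cmp_intros]: "cmp a \<Longrightarrow> cmp (\<lambda>x. den (a x))"
  unfolding den_def by (intro cmp_intros)

lemma cmpP_cle [cmp_intros]: "cmp a \<Longrightarrow> cmp b \<Longrightarrow> cmpP (\<lambda>x. cle (a x) (b x))"
  unfolding cle_def cle_fin_def if_bool_eq_conj by (intro cmp_intros)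

text \<open>Evaluates \<open>vset\<close> on a finite window: entries below \<open>m\<close> show
  the range, entries from \<open>s\<close> on the recurring values. As the valuations select an
  entry, comparisons suffice and the result is one of the given codes.\<close>

definition cvalue :: "bool \<Rightarrow> bool \<Rightarrow> (nat \<Rightarrow> nat) \<Rightarrow> nat \<Rightarrow> nat \<Rightarrow> nat" where
  "cvalue ul up d m s =
    (if \<exists>j<m. d j = 0 then 0 else if \<forall>j<m. d j = 1 then 1
     else d (bleast m (\<lambda>j. (ul \<and> (\<exists>i<m. s \<le> i \<and> d i \<noteq> 1) \<longrightarrow> s \<le> j) \<and> d j \<noteq> 1 \<and>
       (\<forall>k<m. (ul \<and> (\<exists>i<m. s \<le> i \<and> d i \<noteq> 1) \<longrightarrow> s \<le> k) \<and> d k \<noteq> 1 \<longrightarrow>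
          (up \<longrightarrow> cle (d k) (d j)) \<and> (\<not> up \<longrightarrow> cle (d j) (d k))))))"

lemma valc_cvalue:
  "valc (cvalue ul up d m s) = vset ul up ((\<lambda>j. valc (d j)) ` {..<m}) ((\<lambda>j. valc (d j)) ` {s..<m})"
proof -
  let ?R = "(\<lambda>j. valc (d j)) ` {..<m}" and ?I = "(\<lambda>j. valc (d j)) ` {s..<m}"
  define S where "S = {j. j < m \<and> (ul \<and> (\<exists>i<m. s \<le> i \<and> d i \<noteq> 1) \<longrightarrow> s \<le> j) \<and> d j \<noteq> 1}"
  define X where "X = (if ul \<and> \<not> ?I \<subseteq> {\<infinity>} then ?I else ?R) - {\<infinity>}"
  have I: "\<not> ?I \<subseteq> {\<infinity>} \<longleftrightarrow> (\<exists>i<m. s \<le> i \<and> d i \<noteq> 1)"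
    unfolding image_subset_iff by auto
  have X: "X = (\<lambda>j. valc (d j)) ` S" unfolding X_def S_def I by auto
  have M: "-\<infinity> \<in> ?R \<longleftrightarrow> (\<exists>j<m. d j = 0)" 
  proof
    assume "-\<infinity> \<in> ?R"
    then obtain j where "j < m" "valc (d j) = -\<infinity>" by fastforce
    then show "\<exists>j<m. d j = 0" by auto
  qed (auto intro!: image_eqI)
  have P: "?R \<subseteq> {\<infinity>} \<longleftrightarrow> (\<forall>j<m. d j = 1)" unfolding image_subset_iff by auto
  show ?thesis
  proof (cases "(\<exists>j<m. d j = 0) \<or> (\<forall>j<m. d j = 1)")
    case True
    then show ?thesis unfolding cvalue_def vset_def M P by auto
  next
    case False
    let ?opt = "if up then Max X else Min X"
    define Q where "Q = (\<lambda>j. (ul \<and> (\<exists>i<m. s \<le> i \<and> d i \<noteq> 1) \<longrightarrow> s \<le> j) \<and> d j \<noteq> 1 \<and>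
       (\<forall>k<m. (ul \<and> (\<exists>i<m. s \<le> i \<and> d i \<noteq> 1) \<longrightarrow> s \<le> k) \<and> d k \<noteq> 1 \<longrightarrow>
          (up \<longrightarrow> cle (d k) (d j)) \<and> (\<not> up \<longrightarrow> cle (d j) (d k))))"
    have Q: "j < m \<and> Q j \<longleftrightarrow> j \<in> S \<and> (\<forall>k\<in>S. (up \<longrightarrow> valc (d k) \<le> valc (d j)) \<and> (\<not> up \<longrightarrow> valc (d j) \<le> valc (d k)))" for j
      unfolding Q_def S_def cle_iff by blast
    have fin: "finite X" unfolding X S_def by auto
    have "S \<noteq> {}" using False unfolding S_def by blast
    then have "X \<noteq> {}" unfolding X by simp
    then have "?opt \<in> X" using Max_in[OF fin] Min_in[OF fin] by simp
    then obtain j where j: "j \<in> S" "?opt = valc (d j)" unfolding X by auto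
    have "j < m \<and> Q j"
      unfolding Q
    proof (intro conjI ballI impI)
      fix k assume k: "k \<in> S"
      then have kX: "valc (d k) \<in> X" unfolding X by blast
      show "valc (d k) \<le> valc (d j)" if up using j(2) that Max_ge[OF fin kX] by simp
      show "valc (d j) \<le> valc (d k)" if "\<not> up" using j(2) that Min_le[OF fin kX] by simp
    qed (rule j(1))
    then have "bleast m Q < m \<and> Q (bleast m Q)" using bleast[of m Q] by blast
    then have l: "bleast m Q \<in> S" "\<And>k. k \<in> S \<Longrightarrow> (up \<longrightarrow> valc (d k) \<le> valc (d (bleast m Q))) \<and> (\<not> up \<longrightarrow> valc (d (bleast m Q)) \<le> valc (d k))"
      unfolding Q by blast+
    \<comment> \<open>The optimum may occur at several positions and under different codes, so only
      the decoded values are identified.\<close>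
    have "valc (d (bleast m Q)) = valc (d j)"
      using l(2)[OF j(1)] \<open>j < m \<and> Q j\<close>[unfolded Q] l(1) by (cases up) (auto intro: antisym)
    then have "valc (d (bleast m Q)) = ?opt" using j(2) by simp
    moreover have "cvalue ul up d m s = d (bleast m Q)" using False unfolding cvalue_def Q_def by auto
    moreover have "vset ul up ?R ?I = ?opt" using False unfolding vset_def M P X_def Let_def by auto
    ultimately show ?thesis by simp
  qed
qed

lemma cmp_cvalue [cmp_intros]:
  assumes d: "cmp (\<lambda>z. d (pfst z) (psnd z))" and m: "cmp m" and s: "cmp s"
  shows "cmp (\<lambda>x. cvalue ul up (d x) (m x) (s x))"
  unfolding cvalue_def
  by (intro cmp_intros m s cmp_comp[OF m] cmp_comp[OF s] cmp_comp2[of d, OF d])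

section \<open>Letters and transition tables as codes\<close>

definition cmem :: "nat \<Rightarrow> nat \<Rightarrow> bool" where
  "cmem x c \<longleftrightarrow> (\<exists>i<llen c. lnth c i = x)"

lemma cmem_iff: "cmem x c \<longleftrightarrow> x \<in> letter c"
  by (auto simp: cmem_def letter_def in_set_conv_nth llen_eq lnth_eq)

lemma cmpP_cmem [cmp_intros]: assumes "cmp a" "cmp b" shows "cmpP (\<lambda>x. cmem (a x) (b x))"
  unfolding cmem_def by (intro cmp_intros assms assms[THEN cmp_comp])

definition cseteq :: "nat \<Rightarrow> nat \<Rightarrow> bool" where
  "cseteq c d \<longleftrightarrow> (\<forall>i<llen c. cmem (lnth c i) d) \<and> (\<forall>i<llen d. cmem (lnth d i) c)"

lemma cseteq_iff: "cseteq c d \<longleftrightarrow> letter c = letter d"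
proof -
  have "(\<forall>i<llen c. cmem (lnth c i) d) \<longleftrightarrow> letter c \<subseteq> letter d" for c d
    by (auto simp: cmem_iff letter_def[of c] in_set_conv_nth llen_eq lnth_eq subset_iff)
  then show ?thesis by (auto simp: cseteq_def)
qed

lemma cmpP_cseteq [cmp_intros]: assumes "cmp a" "cmp b" shows "cmpP (\<lambda>x. cseteq (a x) (b x))"
  unfolding cseteq_def by (intro cmp_intros assms assms[THEN cmp_comp])

text \<open>The least matching index mirrors the rule that the first entry counts. Letters are
  compared as sets, and the default 0 is the code of -\<infinity>.\<close>

definition clookup :: "nat \<Rightarrow> nat \<Rightarrow> nat \<Rightarrow> nat \<Rightarrow> nat" where
  "clookup T p a q =
    (if \<exists>i<llen T. lnth (lnth T i) 0 = p \<and> cseteq (lnth (lnth T i) 1) a \<and> lnth (lnth T i) 2 = q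
     then lnth (lnth T (bleast (llen T) (\<lambda>i. lnth (lnth T i) 0 = p \<and> cseteq (lnth (lnth T i) 1) a \<and> lnth (lnth T i) 2 = q))) 3
     else 0)"

lemma lookup_wt_first:
  "(\<forall>i<length T. \<forall>p' l q' x. T ! i = (p', l, q', x) \<longrightarrow> \<not> (p' = p \<and> set l = a \<and> q' = q)) \<Longrightarrow> lookup_wt T p a q = QMInf"
  "i < length T \<Longrightarrow> T ! i = (p, l, q, x) \<Longrightarrow> set l = a \<Longrightarrow>
   (\<forall>j<i. \<forall>p' l q' x. T ! j = (p', l, q', x) \<longrightarrow> \<not> (p' = p \<and> set l = a \<and> q' = q)) \<Longrightarrow> lookup_wt T p a q = x"
proof (induction T arbitrary: i)
  case (Cons e T)
  obtain p' l' q' x' where e: "e = (p', l', q', x')" by (cases e)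
  {
    case 1
    have "\<forall>i<length T. \<forall>p' l q' x. T ! i = (p', l, q', x) \<longrightarrow> \<not> (p' = p \<and> set l = a \<and> q' = q)"
      using 1 by (metis Suc_less_eq length_Cons nth_Cons_Suc)
    moreover have "\<not> (p' = p \<and> set l' = a \<and> q' = q)" using 1 e by fastforce
    ultimately show ?case using Cons.IH(1) by (auto simp: e)
  next
    case 2
    show ?case
    proof (cases i)
      case 0
      then show ?thesis using 2 e by auto
    next
      case (Suc k)
      have "\<not> (p' = p \<and> set l' = a \<and> q' = q)" using 2(4) e Suc by fastforce
      moreover have "\<forall>j<k. \<forall>p' l q' x. T ! j = (p', l, q', x) \<longrightarrow> \<not> (p' = p \<and> set l = a \<and> q' = q)"
        using 2(4) Suc by (metis Suc_less_eq nth_Cons_Suc)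
      ultimately show ?thesis using Cons.IH(2)[of k] 2 Suc by (auto simp: e)
    qed
  }
qed auto

lemma clookup_enc:
  "clookup (list_encode (map enc_trans T)) p a q = enc_qbar (lookup_wt T p (letter a) q)"
proof -
  let ?T = "list_encode (map enc_trans T)"
  let ?P = "\<lambda>i. lnth (lnth ?T i) 0 = p \<and> cseteq (lnth (lnth ?T i) 1) a \<and> lnth (lnth ?T i) 2 = q"
  have lett: "letter (list_encode l) = set l" for l by (simp add: letter_def)
  have row: "lnth ?T i = list_encode [p', list_encode l, q', enc_qbar x]" if "i < length T" "T ! i = (p', l, q', x)" for i p' l q' x
    using that by simp
  have P: "?P i \<longleftrightarrow> p' = p \<and> set l = letter a \<and> q' = q" if "i < length T" "T ! i = (p', l, q', x)" for i p' l q' x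
    unfolding row[OF that] cseteq_iff by (simp add: lett del: list_encode.simps)
  show ?thesis
  proof (cases "\<exists>i<llen ?T. ?P i")
    case True
    define i where "i = bleast (llen ?T) ?P"
    have i: "i < length T" "?P i" and min: "\<And>j. j < i \<Longrightarrow> \<not> ?P j"
      using bleast[OF True] unfolding i_def[symmetric] by auto
    obtain p' l q' x where e: "T ! i = (p', l, q', x)" by (cases "T ! i")
    have "lookup_wt T p (letter a) q = x"
    proof (rule lookup_wt_first(2)[OF i(1)])
      show "T ! i = (p, l, q, x)" "set l = letter a" using P[OF i(1) e] i(2) e by auto
      show "\<forall>j<i. \<forall>p' l q' x. T ! j = (p', l, q', x) \<longrightarrow> \<not> (p' = p \<and> set l = letter a \<and> q' = q)"
      proof (intro allI impI)
        fix j p' l q' x assume "j < i" and e': "T ! j = (p', l, q', x)"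
        then have "j < length T" using i(1) by simp
        from P[OF this e'] min[OF \<open>j < i\<close>] show "\<not> (p' = p \<and> set l = letter a \<and> q' = q)" by simp
      qed
    qed
    moreover have "lnth (lnth ?T i) 3 = enc_qbar x" unfolding row[OF i(1) e] by (simp del: list_encode.simps)
    ultimately show ?thesis using True unfolding clookup_def i_def by simp
  next
    case False
    then have "\<forall>i<length T. \<forall>p' l q' x. T ! i = (p', l, q', x) \<longrightarrow> \<not> (p' = p \<and> set l = letter a \<and> q' = q)"
      using P by (metis llen_list_encode length_map)
    then have "lookup_wt T p (letter a) q = QMInf" by (rule lookup_wt_first(1))
    moreover have "clookup ?T p a q = 0" unfolding clookup_def by (rule if_not_P[OF False])
    ultimately show ?thesis by simp
  qed
qed

lemma cmp_clookup [cmp_intros]: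
  assumes "cmp T" "cmp p" "cmp a" "cmp q"
  shows "cmp (\<lambda>x. clookup (T x) (p x) (a x) (q x))"
  unfolding clookup_def by (intro cmp_intros assms assms[THEN cmp_comp])

section \<open>Evaluation of formulas on lassos\<close>

text \<open>A window containing one full period after \<open>s\<close> shows exactly the recurring
  values. Below, the window from \<open>L\<close> to \<open>2 * L\<close> serves, as the loop is no
  longer than \<open>L\<close>.\<close>

lemma periodic_window:
  fixes d :: "nat \<Rightarrow> 'v"
  assumes per: "\<And>j. s \<le> j \<Longrightarrow> d (j + l) = d j" and l: "0 < l" "s + l \<le> m"
  shows "range d = d ` {..<m}" "lims d = d ` {s..<m}"
proof -
  have mult: "d (j + n * l) = d j" if "s \<le> j" for j n
  proof (induction n)
    case (Suc n)
    then show ?case using per[of "j + n * l"] that by (simp add: algebra_simps)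
  qed simp
  have red: "d j \<in> d ` {s..<m}" if "s \<le> j" for j
  proof (rule image_eqI)
    show "d j = d (s + (j - s) mod l)"
      using mult[of "s + (j - s) mod l" "(j - s) div l"] that by (simp add: algebra_simps)
    have "(j - s) mod l < l" using l by simp
    then show "s + (j - s) mod l \<in> {s..<m}" using l(2) by simp
  qed
  show "range d = d ` {..<m}"
  proof (intro subset_antisym image_subsetI)
    fix j show "d j \<in> d ` {..<m}"
    proof (cases "j < m")
      case False
      then have "d j \<in> d ` {s..<m}" using l by (intro red) simp
      then show ?thesis by auto
    qed simp
  qed simp
  show "lims d = d ` {s..<m}"
  proof (intro subset_antisym subsetI)
    fix v assume "v \<in> lims d"
    from lims_frequent[OF this, of s] obtain j where "s \<le> j" "d j = v" by blast
    then show "v \<in> d ` {s..<m}" using red[of j] by simp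
  next
    fix v assume "v \<in> d ` {s..<m}"
    then obtain j where j: "s \<le> j" "v = d j" by auto
    have "\<exists>k\<ge>i. d k = v" for i
    proof (intro exI conjI)
      have "i \<le> i * l" using l(1) by simp
      then show "i \<le> j + i * l" by (rule trans_le_add2)
      show "d (j + i * l) = v" using mult[OF j(1)] j(2) by simp
    qed
    then show "v \<in> lims d" by (simp add: lims_def INFM_nat_le)
  qed
qed

lemma cmp_wrap [cmp_intros]: "cmp p \<Longrightarrow> cmp L \<Longrightarrow> cmp i \<Longrightarrow> cmp (\<lambda>x. wrap (p x) (L x) (i x))"
  unfolding wrap_def by (intro cmp_intros)

lemma cmp_tower [cmp_intros]:
  assumes "cmp b" "cmp n" shows "cmp (\<lambda>x. tower (b x) (n x))"
proof -
  have "tower b n = rec_nat b (\<lambda>_ m. m * m + 2 ^ m + m * 2 ^ m * 2 ^ (2 ^ m * m)) n" for b n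
    by (induction n) simp_all
  then show ?thesis by (simp only:) (intro cmp_intros assms)
qed

definition cmax :: "nat \<Rightarrow> (nat \<Rightarrow> nat) \<Rightarrow> nat" where
  "cmax n g = g (bleast n (\<lambda>j. \<forall>k<n. cle (g k) (g j)))"

lemma valc_cmax: assumes "0 < n" shows "valc (cmax n g) = (SUP j\<in>{..<n}. valc (g j))"
proof -
  let ?X = "(\<lambda>j. valc (g j)) ` {..<n}"
  have fin: "finite ?X" by simp
  have "Max ?X \<in> ?X" using assms by (intro Max_in) auto
  then obtain j where j: "j < n" "Max ?X = valc (g j)" by auto
  have "\<exists>j<n. \<forall>k<n. cle (g k) (g j)"
  proof (intro exI conjI allI impI)
    fix k assume "k < n"
    then show "cle (g k) (g j)" unfolding cle_iff j(2)[symmetric] by (intro Max_ge) auto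
  qed (rule j(1))
  from bleast[OF this] have "valc (cmax n g) \<in> ?X" "\<And>k. k < n \<Longrightarrow> valc (g k) \<le> valc (cmax n g)"
    by (auto simp: cmax_def cle_iff)
  then show ?thesis by (intro antisym SUP_least) (auto intro: SUP_upper)
qed

lemma cmp_cmax [cmp_intros]:
  assumes "cmp n" and g: "cmp (\<lambda>z. g (pfst z) (psnd z))" shows "cmp (\<lambda>x. cmax (n x) (g x))"
proof -
  have "cmp (\<lambda>x. bleast (n x) (\<lambda>j. \<forall>k<n x. cle (g x k) (g x j)))"
    by (intro cmp_intros assms(1) cmp_comp[OF assms(1)] cmp_comp2[of g, OF g])
  from cmp_comp2[of g, OF g cmp_id this] show ?thesis by (simp add: cmax_def)
qed

text \<open>The term for \<open>j\<close> uses \<open>j + 2\<close> entries: the last is a single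
  \<infinity> standing for the infinite padding, and it alone forms the recurring part.\<close>

definition cuntil :: "bool \<Rightarrow> bool \<Rightarrow> nat \<Rightarrow> (nat \<Rightarrow> nat) \<Rightarrow> (nat \<Rightarrow> nat) \<Rightarrow> nat" where
  "cuntil ul up n f g = cmax n (\<lambda>j. cvalue ul up (\<lambda>m. if m < j then f m else if m = j then g m else 1) (Suc (Suc j)) (Suc j))"

lemma cmp_cuntil [cmp_intros]:
  assumes "cmp n" and f: "cmp (\<lambda>z. f (pfst z) (psnd z))" and g: "cmp (\<lambda>z. g (pfst z) (psnd z))"
  shows "cmp (\<lambda>x. cuntil ul up (n x) (f x) (g x))"
  unfolding cuntil_def by (intro cmp_intros assms(1) cmp_comp2[of f, OF f] cmp_comp2[of g, OF g])

text \<open>From \<open>j = L\<close> on, the left values seen are already all of them, so the terms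
  inherit the period of \<open>g\<close> and \<open>2 * L\<close> of them exhaust the
  supremum.\<close>

lemma valc_cuntil:
  assumes per: "\<And>j. p \<le> j \<Longrightarrow> f (j + l) = f j" "\<And>j. p \<le> j \<Longrightarrow> g (j + l) = g j"
    and l: "0 < l" "p + l \<le> L"
  shows "valc (cuntil ul up (2 * L) f g) =
    (SUP j. vset ul up ((\<lambda>m. valc (f m)) ` {..<j} \<union> {valc (g j), \<infinity>}) {\<infinity>})"
proof -
  define G where "G j = vset ul up ((\<lambda>m. valc (f m)) ` {..<j} \<union> {valc (g j), \<infinity>}) {\<infinity>}" for j
  have "valc (cvalue ul up (\<lambda>m. if m < j then f m else if m = j then g m else 1) (Suc (Suc j)) (Suc j)) = G j" for j
  proof -
    let ?h = "\<lambda>m. if m < j then f m else if m = j then g m else 1"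
    have "{..<Suc (Suc j)} = insert j (insert (Suc j) {..<j})" by auto
    then have "(\<lambda>m. valc (?h m)) ` {..<Suc (Suc j)} = (\<lambda>m. valc (f m)) ` {..<j} \<union> {valc (g j), \<infinity>}" by auto
    moreover have "(\<lambda>m. valc (?h m)) ` {Suc j..<Suc (Suc j)} = {\<infinity>}" by simp
    ultimately show ?thesis unfolding valc_cvalue G_def by (simp only:)
  qed
  then have 1: "valc (cuntil ul up (2 * L) f g) = (SUP j\<in>{..<2 * L}. G j)"
    unfolding cuntil_def using l by (subst valc_cmax) simp_all
  have all: "(\<lambda>m. valc (f m)) ` {..<j} = range (\<lambda>m. valc (f m))" if "L \<le> j" for j
    by (rule periodic_window(1)[where s=p and l=l, symmetric]) (use per l that in auto)
  have "G (j + l) = G j" if "L \<le> j" for j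
    using that per(2)[of j] l unfolding G_def by (simp add: all)
  then have "range G = G ` {..<2 * L}"
    using l by (intro periodic_window(1)[where s=L and l=l]) auto
  then show ?thesis unfolding 1 G_def by simp
qed

text \<open>The list of rows grows at the front, so among \<open>k\<close> rows that of code
  \<open>y\<close> has index \<open>k - Suc y\<close>.\<close>

definition look :: "nat \<Rightarrow> nat \<Rightarrow> nat \<Rightarrow> nat \<Rightarrow> nat" where
  "look r k y i = lnth (lnth r (k - Suc y)) i"

lemma cmp_look [cmp_intros]:
  "cmp r \<Longrightarrow> cmp k \<Longrightarrow> cmp y \<Longrightarrow> cmp i \<Longrightarrow> cmp (\<lambda>x. look (r x) (k x) (y x) (i x))"
  unfolding look_def by (intro cmp_intros)

text \<open>\<open>cell\<close> evaluates the formula with code \<open>k\<close> at position \<open>i\<close> of the lasso \<open>(p, t)\<close>, where the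
  list \<open>r\<close> holds the value rows of all smaller codes, in descending order; \<open>table\<close> iterates it.\<close>

definition cell :: "bool \<Rightarrow> bool \<Rightarrow> nat \<Rightarrow> nat \<Rightarrow> nat \<Rightarrow> nat \<Rightarrow> nat \<Rightarrow> nat" where
  "cell ul up p t r k i =
    (if pfst k = 0 then psnd k
     else if pfst k = 1 then if cmem (psnd k) (lnth t i) then 1 else 0
     else if pfst k = 2 then if cmem (psnd k) (lnth t i) then 0 else 1
     else if pfst k = 3 then
       if cle (look r k (pfst (psnd k)) i) (look r k (psnd (psnd k)) i)
       then look r k (psnd (psnd k)) i else look r k (pfst (psnd k)) i
     else if pfst k = 4 then
       if cle (look r k (pfst (psnd k)) i) (look r k (psnd (psnd k)) i)
       then look r k (pfst (psnd k)) i else look r k (psnd (psnd k)) i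
     else if pfst k = 5 then look r k (psnd k) (wrap p (llen t) (Suc i))
     else if pfst k = 6 then
       cuntil ul up (2 * llen t) (\<lambda>j. look r k (pfst (psnd k)) (wrap p (llen t) (i + j)))
         (\<lambda>j. look r k (psnd (psnd k)) (wrap p (llen t) (i + j)))
     else cvalue ul up (\<lambda>j. look r k (psnd k) (wrap p (llen t) (i + j))) (2 * llen t) (llen t))"

definition table :: "bool \<Rightarrow> bool \<Rightarrow> nat \<Rightarrow> nat \<Rightarrow> nat \<Rightarrow> nat" where
  "table ul up p t n = rec_nat 0 (\<lambda>k r. Suc (pr (ltab (llen t) (\<lambda>i. cell ul up p t r k i)) r)) n"

definition ev :: "bool \<Rightarrow> bool \<Rightarrow> nat \<Rightarrow> nat \<Rightarrow> nat \<Rightarrow> nat \<Rightarrow> nat" where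
  "ev ul up p t k i = cell ul up p t (table ul up p t k) k i"

lemma cmp_cell [cmp_intros]:
  assumes "cmp p" "cmp t" "cmp r" "cmp k" "cmp i"
  shows "cmp (\<lambda>x. cell ul up (p x) (t x) (r x) (k x) (i x))"
  unfolding cell_def by (intro cmp_intros assms assms[THEN cmp_comp])

lemma cmp_ev [cmp_intros]:
  assumes "cmp p" "cmp t" "cmp k" "cmp i"
  shows "cmp (\<lambda>x. ev ul up (p x) (t x) (k x) (i x))"
  unfolding ev_def table_def by (intro cmp_intros assms assms[THEN cmp_comp])

lemma table_eq:
  "table ul up p t n = list_encode (map (\<lambda>k. ltab (llen t) (ev ul up p t k)) (rev [0..<n]))"
  by (induction n) (simp_all add: table_def ev_def)

lemma look_table: "y < k \<Longrightarrow> i < llen t \<Longrightarrow> look (table ul up p t k) k y i = ev ul up p t y i"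
  by (simp add: look_def table_eq rev_nth)

lemma less_prod_encode: "0 < a \<Longrightarrow> b < pr a b"
  using add_le_prod_encode[of a b] by simp

context valuation
begin

text \<open>The position is general because the temporal operators move it; later positions are read
  at their wrapped index.\<close>

lemma valc_ev:
  fixes t :: "nat list"
  assumes p: "p < length t"
  shows "i < length t \<Longrightarrow> valc (ev ul up p (list_encode t) (enc_form \<phi>) i) = sem V \<phi> (\<lambda>j. letter (lasso p t (i + j)))"
proof (induction \<phi> arbitrary: i)
  case (FConst k)
  then show ?case by (simp add: ev_def cell_def)
next
  case (FAtom a)
  then show ?case by (simp add: ev_def cell_def cmem_iff lasso_def)
next
  case (FNAtom a)
  then show ?case by (simp add: ev_def cell_def cmem_iff lasso_def)
next
  case (FOr \<phi> \<psi>)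
  let ?k = "enc_form (FOr \<phi> \<psi>)"
  have "enc_form \<phi> < ?k" "enc_form \<psi> < ?k"
    using less_prod_encode[of 3 "pr (enc_form \<phi>) (enc_form \<psi>)"] add_le_prod_encode[of "enc_form \<phi>" "enc_form \<psi>"] by simp_all
  then have l: "look (table ul up p (list_encode t) ?k) ?k (enc_form \<phi>) i = ev ul up p (list_encode t) (enc_form \<phi>) i"
    "look (table ul up p (list_encode t) ?k) ?k (enc_form \<psi>) i = ev ul up p (list_encode t) (enc_form \<psi>) i"
    using FOr.prems by (simp_all only: look_table llen_list_encode)
  have k: "pfst ?k = 3" "pfst (psnd ?k) = enc_form \<phi>" "psnd (psnd ?k) = enc_form \<psi>" by simp_all
  have "ev ul up p (list_encode t) ?k i =
    (if cle (ev ul up p (list_encode t) (enc_form \<phi>) i) (ev ul up p (list_encode t) (enc_form \<psi>) i)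
     then ev ul up p (list_encode t) (enc_form \<psi>) i else ev ul up p (list_encode t) (enc_form \<phi>) i)"
    unfolding ev_def[of _ _ _ _ ?k] cell_def k l by simp
  then show ?case using FOr by (auto simp: cle_iff sup_absorb1 sup_absorb2 simp del: enc_form.simps)
next
  case (FAnd \<phi> \<psi>)
  let ?k = "enc_form (FAnd \<phi> \<psi>)"
  have "enc_form \<phi> < ?k" "enc_form \<psi> < ?k"
    using less_prod_encode[of 4 "pr (enc_form \<phi>) (enc_form \<psi>)"] add_le_prod_encode[of "enc_form \<phi>" "enc_form \<psi>"] by simp_all
  then have l: "look (table ul up p (list_encode t) ?k) ?k (enc_form \<phi>) i = ev ul up p (list_encode t) (enc_form \<phi>) i"
    "look (table ul up p (list_encode t) ?k) ?k (enc_form \<psi>) i = ev ul up p (list_encode t) (enc_form \<psi>) i"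
    using FAnd.prems by (simp_all only: look_table llen_list_encode)
  have k: "pfst ?k = 4" "pfst (psnd ?k) = enc_form \<phi>" "psnd (psnd ?k) = enc_form \<psi>" by simp_all
  have "ev ul up p (list_encode t) ?k i =
    (if cle (ev ul up p (list_encode t) (enc_form \<phi>) i) (ev ul up p (list_encode t) (enc_form \<psi>) i)
     then ev ul up p (list_encode t) (enc_form \<phi>) i else ev ul up p (list_encode t) (enc_form \<psi>) i)"
    unfolding ev_def[of _ _ _ _ ?k] cell_def k l by simp
  then show ?case using FAnd by (auto simp: cle_iff inf_absorb1 inf_absorb2 simp del: enc_form.simps)
next
  case (FNext \<phi>)
  let ?k = "enc_form (FNext \<phi>)"
  have lt: "enc_form \<phi> < ?k" using less_prod_encode[of 5 "enc_form \<phi>"] by simp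
  have k: "pfst ?k = 5" "psnd ?k = enc_form \<phi>" by simp_all
  have "ev ul up p (list_encode t) ?k i = ev ul up p (list_encode t) (enc_form \<phi>) (wrap p (length t) (Suc i))"
    unfolding ev_def[of _ _ _ _ ?k] cell_def k llen_list_encode using lt wrap_less[OF p, of "Suc i"]
    by (simp add: look_table del: enc_form.simps)
  then show ?case using FNext.IH[OF wrap_less[OF p, of "Suc i"]]
    by (simp add: suffix_lasso[OF p] suffix_def del: enc_form.simps)
next
  case (FUntil \<phi> \<psi>)
  let ?k = "enc_form (FUntil \<phi> \<psi>)" and ?L = "length t"
  let ?f = "\<lambda>j. ev ul up p (list_encode t) (enc_form \<phi>) (wrap p ?L (i + j))"
  let ?g = "\<lambda>j. ev ul up p (list_encode t) (enc_form \<psi>) (wrap p ?L (i + j))"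
  have lt: "enc_form \<phi> < ?k" "enc_form \<psi> < ?k"
    using less_prod_encode[of 6 "pr (enc_form \<phi>) (enc_form \<psi>)"] add_le_prod_encode[of "enc_form \<phi>" "enc_form \<psi>"] by simp_all
  have k: "pfst ?k = 6" "pfst (psnd ?k) = enc_form \<phi>" "psnd (psnd ?k) = enc_form \<psi>" by simp_all
  have e: "ev ul up p (list_encode t) ?k i = cuntil ul up (2 * ?L) ?f ?g"
    unfolding ev_def[of _ _ _ _ ?k] cell_def k llen_list_encode using lt wrap_less[OF p]
    by (simp add: look_table del: enc_form.simps)
  have "valc (ev ul up p (list_encode t) ?k i) = (SUP j. vset ul up ((\<lambda>m. valc (?f m)) ` {..<j} \<union> {valc (?g j), \<infinity>}) {\<infinity>})"
    unfolding e
  proof (rule valc_cuntil[where l="?L - p"])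
    fix j assume "p \<le> j"
    then show "?f (j + (?L - p)) = ?f j" "?g (j + (?L - p)) = ?g j"
      using wrap_period[of p "i + j" ?L] by (simp_all add: add.assoc)
  qed (use p in simp_all)
  also have "\<dots> = sem V (FUntil \<phi> \<psi>) (\<lambda>j. letter (lasso p t (i + j)))"
  proof -
    have "valc (?f j) = sem V \<phi> (suffix j (\<lambda>j. letter (lasso p t (i + j))))"
      "valc (?g j) = sem V \<psi> (suffix j (\<lambda>j. letter (lasso p t (i + j))))" for j
      unfolding FUntil.IH(1)[OF wrap_less[OF p]] FUntil.IH(2)[OF wrap_less[OF p]]
      by (simp_all only: suffix_lasso[OF p] suffix_def add.assoc)
    then show ?thesis by (simp only: sem.simps V_until)
  qed
  finally show ?case .
next
  case (FBox \<phi>)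
  let ?k = "enc_form (FBox \<phi>)" and ?L = "length t"
  let ?f = "\<lambda>j. ev ul up p (list_encode t) (enc_form \<phi>) (wrap p ?L (i + j))"
  have lt: "enc_form \<phi> < ?k" using less_prod_encode[of 7 "enc_form \<phi>"] by simp
  have k: "pfst ?k = 7" "psnd ?k = enc_form \<phi>" by simp_all
  have e: "ev ul up p (list_encode t) ?k i = cvalue ul up ?f (2 * ?L) ?L"
    unfolding ev_def[of _ _ _ _ ?k] cell_def k llen_list_encode using lt wrap_less[OF p]
    by (simp add: look_table del: enc_form.simps)
  have "valc (ev ul up p (list_encode t) ?k i) = V (\<lambda>j. valc (?f j))"
  proof -
    \<comment> \<open>Beyond offset \<open>?L\<close> the position lies in the loop for every start
      \<open>i\<close>, so one window fits all starts.\<close>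
    have "valc (?f (j + (?L - p))) = valc (?f j)" if "?L \<le> j" for j
      using wrap_period[of p "i + j" ?L] that p by (simp add: add.assoc)
    from periodic_window[of ?L "\<lambda>j. valc (?f j)", OF this, of "2 * ?L"] p
    have "range (\<lambda>j. valc (?f j)) = (\<lambda>j. valc (?f j)) ` {..<2 * ?L}" "lims (\<lambda>j. valc (?f j)) = (\<lambda>j. valc (?f j)) ` {?L..<2 * ?L}"
      by simp_all
    moreover from this have "V (\<lambda>j. valc (?f j)) = vset ul up (range (\<lambda>j. valc (?f j))) (lims (\<lambda>j. valc (?f j)))"
      by (intro V) (simp only: finite_imageI finite_lessThan)
    ultimately show ?thesis unfolding e valc_cvalue by (simp only:)
  qed
  also have "\<dots> = sem V (FBox \<phi>) (\<lambda>j. letter (lasso p t (i + j)))"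
    unfolding FBox.IH[OF wrap_less[OF p]] by (simp only: sem.simps suffix_lasso[OF p] suffix_def add.assoc)
  finally show ?case .
qed

end

section \<open>Paths on lassos and the decision procedure\<close>

definition lstate :: "nat \<Rightarrow> nat \<Rightarrow> nat \<Rightarrow> nat" where
  "lstate q u j = lnth u (wrap q (llen u) j)"

definition decode_pairs :: "nat \<Rightarrow> (nat \<times> nat) list" where
  "decode_pairs u = map prod_decode (list_decode u)"

lemma surj_decode_pairs: "decode_pairs (list_encode (map prod_encode us)) = us"
  by (simp add: decode_pairs_def o_def)

lemma length_decode_pairs [simp]: "length (decode_pairs u) = llen u"
  by (simp add: decode_pairs_def llen_eq)

lemma lasso_decode_pairs:
  assumes "q < llen u"
  shows "lasso q (decode_pairs u) j = (pfst (lstate q u j), psnd (lstate q u j))"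
  using wrap_less[OF assms, of j]
  by (simp add: lasso_def lstate_def lnth_eq pfst_def psnd_def decode_pairs_def llen_eq)

lemma set_decode_pairs:
  "set (decode_pairs u) \<subseteq> {..<L} \<times> {..<n} \<longleftrightarrow> (\<forall>j<llen u. pfst (lnth u j) < L \<and> psnd (lnth u j) < n)"
proof -
  have "set (list_decode u) = lnth u ` {..<llen u}" by (force simp: set_conv_nth llen_eq lnth_eq)
  then have "set (decode_pairs u) = (\<lambda>j. prod_decode (lnth u j)) ` {..<llen u}"
    by (simp add: decode_pairs_def image_image)
  then show ?thesis by (simp add: image_subset_iff mem_Times_iff pfst_def psnd_def Ball_def)
qed

lemma lstate_period: "q < llen u \<Longrightarrow> llen u \<le> j \<Longrightarrow> lstate q u (j + (llen u - q)) = lstate q u j"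
  unfolding lstate_def by (subst wrap_period) auto

text \<open>Success of the infinite path, tested on two lengths of \<open>u\<close>: the second
  length shows exactly what recurs.\<close>

definition path_cond :: "nat \<Rightarrow> nat \<Rightarrow> nat \<Rightarrow> nat \<Rightarrow> nat \<Rightarrow> nat \<Rightarrow> bool" where
  "path_cond p L I F q u \<longleftrightarrow> pfst (lstate q u 0) = 0 \<and> cmem (psnd (lstate q u 0)) I \<and>
     (\<forall>j<2 * llen u. pfst (lstate q u (Suc j)) = wrap p L (Suc (pfst (lstate q u j)))) \<and>
     (\<exists>j<2 * llen u. llen u \<le> j \<and> cmem (psnd (lstate q u j)) F)"

definition path_code :: "bool \<Rightarrow> bool \<Rightarrow> nat \<Rightarrow> nat \<Rightarrow> nat \<Rightarrow> nat \<Rightarrow> nat" where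
  "path_code ul up T t q u = cvalue ul up
     (\<lambda>j. clookup T (psnd (lstate q u j)) (lnth t (pfst (lstate q u j))) (psnd (lstate q u (Suc j))))
     (2 * llen u) (llen u)"

lemma cmp_lstate [cmp_intros]: "cmp q \<Longrightarrow> cmp u \<Longrightarrow> cmp j \<Longrightarrow> cmp (\<lambda>x. lstate (q x) (u x) (j x))"
  unfolding lstate_def by (intro cmp_intros)

lemma cmpP_path_cond [cmp_intros]:
  assumes "cmp p" "cmp L" "cmp I" "cmp F" "cmp q" "cmp u"
  shows "cmpP (\<lambda>x. path_cond (p x) (L x) (I x) (F x) (q x) (u x))"
  unfolding path_cond_def by (intro cmp_intros assms assms[THEN cmp_comp])

lemma cmp_path_code [cmp_intros]:
  assumes "cmp T" "cmp t" "cmp q" "cmp u"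
  shows "cmp (\<lambda>x. path_code ul up (T x) (t x) (q x) (u x))"
  unfolding path_code_def by (intro cmp_intros assms assms[THEN cmp_comp])

context valuation
begin

lemma product_value_code:
  fixes t :: "nat list"
  assumes q: "q < llen u" and dom: "\<forall>j<llen u. pfst (lnth u j) < length t"
  shows "product_value T I F p t (lasso q (decode_pairs u)) =
    (if path_cond p (length t) (list_encode I) (list_encode F) q u
     then Some (valc (path_code ul up (list_encode (map enc_trans T)) (list_encode t) q u)) else None)"
proof -
  let ?L = "llen u" and ?s = "lstate q u"
  let ?c = "\<lambda>j. clookup (list_encode (map enc_trans T)) (psnd (?s j)) (lnth (list_encode t) (pfst (?s j))) (psnd (?s (Suc j)))"
  have per: "?s (j + (?L - q)) = ?s j" "?s (Suc (j + (?L - q))) = ?s (Suc j)" if "?L \<le> j" for j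
    using lstate_period[OF q, of j] lstate_period[OF q, of "Suc j"] that by simp_all
  have window: "range d = d ` {..<2 * ?L}" "lims d = d ` {?L..<2 * ?L}"
    if "\<And>j. ?L \<le> j \<Longrightarrow> d (j + (?L - q)) = d j" for d :: "nat \<Rightarrow> 'x"
    using periodic_window[of ?L d "?L - q" "2 * ?L"] that q by simp_all
  \<comment> \<open>The truth values along the steps form a periodic sequence themselves, so their
    range is visible in the window.\<close>
  have step: "(\<forall>j. P (?s j) (?s (Suc j))) \<longleftrightarrow> (\<forall>j<2 * ?L. P (?s j) (?s (Suc j)))" for P
  proof -
    have "range (\<lambda>j. P (?s j) (?s (Suc j))) = (\<lambda>j. P (?s j) (?s (Suc j))) ` {..<2 * ?L}"
      by (rule window(1)) (simp add: per)
    then show ?thesis by (metis (mono_tags, lifting) imageE image_eqI lessThan_iff rangeI)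
  qed
  have acc: "infinite {j. P (?s j)} \<longleftrightarrow> (\<exists>j<2 * ?L. ?L \<le> j \<and> P (?s j))" for P
  proof -
    have w: "range ?s = ?s ` {..<2 * ?L}" "lims ?s = ?s ` {?L..<2 * ?L}" by (rule window; simp add: per)+
    have "finite (range ?s)" unfolding w by simp
    then show ?thesis unfolding infinite_iff_lims[OF \<open>finite (range ?s)\<close>] w by auto
  qed
  \<comment> \<open>Positions must be in range, as beyond the end of a list \<open>lnth\<close> and
    \<open>!\<close> need not agree.\<close>
  have dom': "pfst (?s j) < length t" for j
    using dom wrap_less[OF q, of j] by (simp add: lstate_def)
  have "valc (?c j) = qval (lookup_wt T (psnd (?s j)) (letter (t ! pfst (?s j))) (psnd (?s (Suc j))))" for j
    by (simp add: clookup_enc dom')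
  moreover have "V (\<lambda>j. valc (?c j)) = valc (path_code ul up (list_encode (map enc_trans T)) (list_encode t) q u)"
  proof -
    have w: "range (\<lambda>j. valc (?c j)) = (\<lambda>j. valc (?c j)) ` {..<2 * ?L}"
      "lims (\<lambda>j. valc (?c j)) = (\<lambda>j. valc (?c j)) ` {?L..<2 * ?L}" by (rule window; simp only: per)+
    have "finite (range (\<lambda>j. valc (?c j)))" unfolding w by simp
    from V[OF this] show ?thesis unfolding w path_code_def valc_cvalue .
  qed
  ultimately have val: "V (\<lambda>j. qval (lookup_wt T (psnd (?s j)) (letter (t ! pfst (?s j))) (psnd (?s (Suc j))))) =
      valc (path_code ul up (list_encode (map enc_trans T)) (list_encode t) q u)"
    by (simp only:)
  have mem: "x \<in> set J \<longleftrightarrow> cmem x (list_encode J)" for x J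
    by (simp add: cmem_iff letter_def)
  show ?thesis
    unfolding product_value_def path_value_def lasso_decode_pairs[OF q] prod.case val mem
      step[of "\<lambda>x y. pfst y = wrap p (length t) (Suc (pfst x))"] acc[of "\<lambda>x. cmem (psnd x) (list_encode F)"]
    by (simp only: path_cond_def conj_assoc)
qed

end

section \<open>Search bounds and the comparison of both sides\<close>

definition list_bound :: "nat \<Rightarrow> nat \<Rightarrow> nat" where
  "list_bound C K = rec_nat 0 (\<lambda>_ r. Suc (pr C r)) K"

lemma prod_encode_mono: "a \<le> a' \<Longrightarrow> b \<le> b' \<Longrightarrow> pr a b \<le> pr a' b'"
proof -
  have "triangle m \<le> triangle n" if "m \<le> n" for m n
    using that by (rule lift_Suc_mono_le[of triangle, rotated]) simp
  then show "a \<le> a' \<Longrightarrow> b \<le> b' \<Longrightarrow> pr a b \<le> pr a' b'"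
    unfolding prod_encode_def by (simp add: add_mono)
qed

text \<open>Pairing is monotone, so the code of \<open>K\<close> copies of \<open>C\<close> is the
  largest.\<close>

lemma list_encode_le_bound:
  "length xs \<le> K \<Longrightarrow> \<forall>x\<in>set xs. x \<le> C \<Longrightarrow> list_encode xs \<le> list_bound C K"
proof (induction xs arbitrary: K)
  case (Cons x xs)
  then obtain K' where K: "K = Suc K'" by (cases K) auto
  then have "list_encode xs \<le> list_bound C K'" using Cons by simp
  then show ?case using Cons.prems K by (simp add: list_bound_def prod_encode_mono)
qed (simp add: list_bound_def)

lemma cmp_list_bound [cmp_intros]:
  assumes "cmp C" "cmp K" shows "cmp (\<lambda>x. list_bound (C x) (K x))"
  unfolding list_bound_def by (intro cmp_intros assms assms[THEN cmp_comp])

definition path_bound :: "nat \<Rightarrow> nat \<Rightarrow> nat" where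
  "path_bound L n = 2 * tower (L * n + 2) 4"

definition good_path :: "nat \<Rightarrow> nat \<Rightarrow> nat \<Rightarrow> nat \<Rightarrow> nat \<Rightarrow> nat \<Rightarrow> bool" where
  "good_path p L n I F y \<longleftrightarrow> llen (psnd y) \<le> path_bound L n \<and> pfst y < llen (psnd y) \<and>
     (\<forall>j<llen (psnd y). pfst (lnth (psnd y) j) < L \<and> psnd (lnth (psnd y) j) < n) \<and>
     path_cond p L I F (pfst y) (psnd y)"

text \<open>The supremum is not computed but tested: \<open>c\<close> is an upper bound and lies
  below some path weight. The alternative \<open>c = 0\<close> covers the empty supremum. The number
  \<open>y\<close> codes the loop start and the states of a lasso-shaped path.\<close>

definition beh_eq :: "bool \<Rightarrow> bool \<Rightarrow> nat \<Rightarrow> nat \<Rightarrow> nat \<Rightarrow> nat \<Rightarrow> nat \<Rightarrow> nat \<Rightarrow> nat \<Rightarrow> bool" where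
  "beh_eq ul up n T I F p t c \<longleftrightarrow>
     (c = 0 \<or> (\<exists>y<Suc (pr (path_bound (llen t) n) (list_bound (pr (llen t) n) (path_bound (llen t) n))).
        good_path p (llen t) n I F y \<and> cle c (path_code ul up T t (pfst y) (psnd y)))) \<and>
     (\<forall>y<Suc (pr (path_bound (llen t) n) (list_bound (pr (llen t) n) (path_bound (llen t) n))).
        good_path p (llen t) n I F y \<longrightarrow> cle (path_code ul up T t (pfst y) (psnd y)) c)"

lemma cmp_path_bound [cmp_intros]: "cmp L \<Longrightarrow> cmp n \<Longrightarrow> cmp (\<lambda>x. path_bound (L x) (n x))"
  unfolding path_bound_def by (intro cmp_intros)

lemma cmpP_good_path [cmp_intros]:
  assumes "cmp p" "cmp L" "cmp n" "cmp I" "cmp F" "cmp y"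
  shows "cmpP (\<lambda>x. good_path (p x) (L x) (n x) (I x) (F x) (y x))"
  unfolding good_path_def by (intro cmp_intros assms assms[THEN cmp_comp])

lemma cmpP_beh_eq [cmp_intros]:
  assumes "cmp n" "cmp T" "cmp I" "cmp F" "cmp p" "cmp t" "cmp c"
  shows "cmpP (\<lambda>x. beh_eq ul up (n x) (T x) (I x) (F x) (p x) (t x) (c x))"
  unfolding beh_eq_def by (intro cmp_intros assms assms[THEN cmp_comp])

lemma Sup_eq_iff_finite:
  fixes S :: "ereal set"
  assumes "finite S"
  shows "s = Sup S \<longleftrightarrow> (s = -\<infinity> \<or> (\<exists>v\<in>S. s \<le> v)) \<and> (\<forall>v\<in>S. v \<le> s)"
proof
  assume s: "s = Sup S"
  have "s = -\<infinity> \<or> s \<in> S"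
  proof (cases "S = {}")
    case True
    then show ?thesis using s by (simp add: bot_ereal_def)
  next
    case False
    then show ?thesis using s Max_in[OF assms] Max_Sup[OF assms] by simp
  qed
  then show "(s = -\<infinity> \<or> (\<exists>v\<in>S. s \<le> v)) \<and> (\<forall>v\<in>S. v \<le> s)" using s by (auto intro: Sup_upper)
next
  assume *: "(s = -\<infinity> \<or> (\<exists>v\<in>S. s \<le> v)) \<and> (\<forall>v\<in>S. v \<le> s)"
  then have "Sup S \<le> s" by (intro Sup_least) auto
  moreover have "s \<le> Sup S" using * by (auto intro: Sup_upper2)
  ultimately show "s = Sup S" by simp
qed

context valuation
begin

lemma beh_eq_iff:
  fixes t :: "nat list"
  assumes p: "p < length t"
  shows "beh_eq ul up n (list_encode (map enc_trans T)) (list_encode I) (list_encode F) p (list_encode t) c \<longleftrightarrow>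
    valc c = wba_beh V (WBA n T I F) (\<lambda>i. letter (lasso p t i))"
proof -
  let ?L = "length t" and ?K = "path_bound (length t) n"
  let ?good = "good_path p ?L n (list_encode I) (list_encode F)"
  let ?val = "\<lambda>y. path_code ul up (list_encode (map enc_trans T)) (list_encode t) (pfst y) (psnd y)"
  let ?B = "Suc (pr ?K (list_bound (pr ?L n) ?K))"
  let ?S = "(\<lambda>y. valc (?val y)) ` {y. y < ?B \<and> ?good y}"
  \<comment> \<open>The search range loses no path: loop start and list code are both bounded
    explicitly.\<close>
  have bound: "y < ?B" if "?good y" for y
  proof -
    have "list_encode (list_decode (psnd y)) \<le> list_bound (pr ?L n) ?K"
    proof (rule list_encode_le_bound)
      show "length (list_decode (psnd y)) \<le> ?K" using that by (simp add: good_path_def flip: llen_eq)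
      show "\<forall>x\<in>set (list_decode (psnd y)). x \<le> pr ?L n"
      proof
        fix x assume "x \<in> set (list_decode (psnd y))"
        then obtain j where j: "j < llen (psnd y)" "x = lnth (psnd y) j"
          by (auto simp: in_set_conv_nth llen_eq lnth_eq)
        then have "pfst x < ?L" "psnd x < n" using that by (auto simp: good_path_def)
        then have "pr (pfst x) (psnd x) \<le> pr ?L n" by (intro prod_encode_mono) simp_all
        then show "x \<le> pr ?L n" by simp
      qed
    qed
    moreover have "pfst y \<le> ?K" using that by (simp add: good_path_def)
    ultimately have "pr (pfst y) (psnd y) \<le> pr ?K (list_bound (pr ?L n) ?K)"
      by (intro prod_encode_mono) simp_all
    then show ?thesis by simp
  qed
  have "{v. \<exists>q u. set u \<subseteq> {..<?L} \<times> {..<n} \<and> q < length u \<and> length u \<le> 2 * tower (?L * n + 2) 4 \<and>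
      product_value T I F p t (lasso q u) = Some v} = ?S" (is "?S' = _")
  proof (intro subset_antisym subsetI)
    fix v assume "v \<in> ?S'"
    then obtain q us where *: "set us \<subseteq> {..<?L} \<times> {..<n}" "q < length us" "length us \<le> ?K"
      "product_value T I F p t (lasso q us) = Some v" by (auto simp: path_bound_def)
    define u where "u = list_encode (map prod_encode us)"
    have u: "us = decode_pairs u" by (simp add: u_def surj_decode_pairs)
    have dom: "\<forall>j<llen u. pfst (lnth u j) < ?L \<and> psnd (lnth u j) < n" using *(1) unfolding u set_decode_pairs .
    have q: "q < llen u" "llen u \<le> ?K" using *(2,3) unfolding u by simp_all
    from product_value_code[OF q(1), of t T I F p] dom *(4)
    have "path_cond p ?L (list_encode I) (list_encode F) q u" "v = valc (?val (pr q u))"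
      unfolding u by (auto split: if_splits)
    then have "?good (pr q u)" using q dom by (simp add: good_path_def)
    then show "v \<in> ?S" using \<open>v = _\<close> bound by blast
  next
    fix v assume "v \<in> ?S"
    then obtain y where y: "?good y" "v = valc (?val y)" by auto
    then have dom: "\<forall>j<llen (psnd y). pfst (lnth (psnd y) j) < ?L \<and> psnd (lnth (psnd y) j) < n"
      and q: "pfst y < llen (psnd y)" "llen (psnd y) \<le> ?K"
      and pc: "path_cond p ?L (list_encode I) (list_encode F) (pfst y) (psnd y)"
      by (simp_all add: good_path_def)
    have "product_value T I F p t (lasso (pfst y) (decode_pairs (psnd y))) = Some v"
      using product_value_code[OF q(1), of t T I F p] dom pc y(2) by simp
    then show "v \<in> ?S'"
      using q dom by (intro CollectI exI[of _ "pfst y"] exI[of _ "decode_pairs (psnd y)"])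
        (simp add: set_decode_pairs path_bound_def)
  qed
  then have beh: "wba_beh V (WBA n T I F) (\<lambda>i. letter (lasso p t i)) = Sup ?S"
    using wba_beh_lasso[OF p order_refl, of n T I F] by (simp only:)
  have fin: "finite ?S" by simp
  have quant: "(\<exists>v\<in>?S. s \<le> v) \<longleftrightarrow> (\<exists>y<?B. ?good y \<and> s \<le> valc (?val y))"
    "(\<forall>v\<in>?S. v \<le> s) \<longleftrightarrow> (\<forall>y<?B. ?good y \<longrightarrow> valc (?val y) \<le> s)" for s by blast+
  show ?thesis
    unfolding beh Sup_eq_iff_finite[OF fin] quant beh_eq_def llen_list_encode cle_iff valc_eq_MInf by (rule refl)
qed

text \<open>\<open>z\<close> codes a lasso over \<open>A\<close>. In the base, \<open>x\<close>
  stands in for the number of states, which it dominates as the code of the input; the height is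
  that of \<open>equiv_iff_lassos\<close>.\<close>

definition decide :: "nat set \<Rightarrow> nat \<Rightarrow> bool" where
  "decide A x \<longleftrightarrow>
    (\<forall>z<Suc (pr (2 * tower (card A * Suc x + 2) (pfst x + 6))
        (list_bound (Max A) (2 * tower (card A * Suc x + 2) (pfst x + 6)))).
      llen (psnd z) \<le> 2 * tower (card A * Suc x + 2) (pfst x + 6) \<and> pfst z < llen (psnd z) \<and>
      (\<forall>i<llen (psnd z). lnth (psnd z) i \<in> A) \<longrightarrow>
      beh_eq ul up (lnth (psnd x) 0) (lnth (psnd x) 1) (lnth (psnd x) 2) (lnth (psnd x) 3)
        (pfst z) (psnd z) (ev ul up (pfst z) (psnd z) (pfst x) 0))"

lemma cmpP_decide: "finite A \<Longrightarrow> cmpP (decide A)"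
  unfolding decide_def by (intro cmp_intros)

lemma decide_iff:
  assumes A: "finite A" "letter ` A = Pow AP"
  shows "decide A (enc_input \<phi> M) \<longleftrightarrow> (\<forall>w. (\<forall>i. w i \<subseteq> AP) \<longrightarrow> sem V \<phi> w = wba_beh V M w)"
proof -
  obtain n T I F where M: "M = WBA n T I F" by (cases M)
  define x where "x = enc_input \<phi> M"
  have x: "pfst x = enc_form \<phi>" "psnd x = list_encode [n, list_encode (map enc_trans T), list_encode I, list_encode F]"
    by (simp_all add: x_def enc_input_def M del: list_encode.simps)
  have nth: "lnth (psnd x) 0 = n" "lnth (psnd x) 1 = list_encode (map enc_trans T)"
    "lnth (psnd x) 2 = list_encode I" "lnth (psnd x) 3 = list_encode F"
    unfolding x by (simp_all del: list_encode.simps)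
  have "n \<le> psnd x" unfolding x using le_prod_encode_1[of n] by (simp add: le_SucI)
  also have "psnd x \<le> x" using le_prod_encode_2[of "psnd x" "pfst x"] by simp
  finally have "n \<le> x" .
  let ?b = "card A * Suc x + 2"
  let ?K = "2 * tower ?b (pfst x + 6)"
  have b: "card A + 2 \<le> ?b" "card A * n + 2 \<le> ?b" using \<open>n \<le> x\<close> by (simp_all add: trans_le_add2)
  have "decide A x \<longleftrightarrow> (\<forall>p t. set t \<subseteq> A \<and> p < length t \<and> length t \<le> ?K \<longrightarrow>
      sem V \<phi> (\<lambda>i. letter (lasso p t i)) = wba_beh V (WBA n T I F) (\<lambda>i. letter (lasso p t i)))"
    (is "_ \<longleftrightarrow> ?R")
  proof
    assume D: "decide A x"
    show ?R
    proof (intro allI impI, elim conjE)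
      fix p and t :: "nat list" assume t: "set t \<subseteq> A" "p < length t" "length t \<le> ?K"
      have "list_encode t \<le> list_bound (Max A) ?K" using t A(1) by (intro list_encode_le_bound) auto
      then have "pr p (list_encode t) \<le> pr ?K (list_bound (Max A) ?K)" using t by (intro prod_encode_mono) simp_all
      then have "beh_eq ul up (lnth (psnd x) 0) (lnth (psnd x) 1) (lnth (psnd x) 2) (lnth (psnd x) 3)
          p (list_encode t) (ev ul up p (list_encode t) (pfst x) 0)"
        using D[unfolded decide_def, rule_format, of "pr p (list_encode t)"] t subsetD[OF t(1) nth_mem]
        by (auto simp: less_Suc_eq_le)
      then have "valc (ev ul up p (list_encode t) (enc_form \<phi>) 0) = wba_beh V (WBA n T I F) (\<lambda>i. letter (lasso p t i))"
        unfolding nth beh_eq_iff[OF t(2)] x(1) .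
      moreover have "0 < length t" using t(2) by linarith
      ultimately show "sem V \<phi> (\<lambda>i. letter (lasso p t i)) = wba_beh V (WBA n T I F) (\<lambda>i. letter (lasso p t i))"
        using valc_ev[OF t(2), of 0 \<phi>] by simp
    qed
  next
    assume R: ?R
    show "decide A x"
      unfolding decide_def
    proof (intro allI impI, elim conjE)
      fix z assume z: "llen (psnd z) \<le> ?K" "pfst z < llen (psnd z)" "\<forall>i<llen (psnd z). lnth (psnd z) i \<in> A"
      define t where "t = list_decode (psnd z)"
      have zt: "psnd z = list_encode t" by (simp add: t_def)
      have t: "set t \<subseteq> A" "pfst z < length t" "length t \<le> ?K"
        using z unfolding zt by (auto simp: set_conv_nth)
      have "0 < length t" using t(2) by linarith
      then have "valc (ev ul up (pfst z) (list_encode t) (enc_form \<phi>) 0) = wba_beh V (WBA n T I F) (\<lambda>i. letter (lasso (pfst z) t i))"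
        using valc_ev[OF t(2), of 0 \<phi>] R t by simp
      then show "beh_eq ul up (lnth (psnd x) 0) (lnth (psnd x) 1) (lnth (psnd x) 2) (lnth (psnd x) 3)
          (pfst z) (psnd z) (ev ul up (pfst z) (psnd z) (pfst x) 0)"
        unfolding nth zt beh_eq_iff[OF t(2)] x(1) .
    qed
  qed
  also have "\<dots> \<longleftrightarrow> (\<forall>w. (\<forall>i. w i \<subseteq> AP) \<longrightarrow> sem V \<phi> w = wba_beh V M w)"
    unfolding x(1) M by (rule equiv_iff_lassos[OF A b, symmetric])
  finally show ?thesis unfolding x_def .
qed

lemma equiv_decidable:
  assumes "finite AP" shows "equiv_decidable AP V Frag"
proof -
  \<comment> \<open>One code for each subset of \<open>AP\<close>. Being finite, \<open>A\<close> is
    decided by cases inside the program.\<close>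
  define A where "A = (\<lambda>S. list_encode (sorted_list_of_set S)) ` Pow AP"
  have fin: "finite A" using assms by (simp add: A_def)
  have "letter (list_encode (sorted_list_of_set S)) = S" if "S \<in> Pow AP" for S
    using that finite_subset[OF _ assms] by (simp add: letter_def)
  then have A: "letter ` A = Pow AP" unfolding A_def image_image by simp
  obtain f where "\<And>x. reval f [x] (if decide A x then 1 else 0)"
    using cmpP_decide[OF fin] unfolding cmpP_def cmp_def by blast
  then show ?thesis
    unfolding equiv_decidable_def decide_iff[OF fin A, symmetric] by blast
qed

end

theorem theorem9:
  fixes AP :: "nat set"
  assumes "finite AP"
  shows "(\<forall>q::rat. equiv_decidable AP val_liminf (tRULTL (QFin q)))
       \<and> (\<forall>q::rat. equiv_decidable AP val_limsup (vtRULTL (QFin q)))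
       \<and> (\<forall>q::rat. equiv_decidable AP val_supm (vtRULTL (QFin q)))"
proof -
  interpret liminf: valuation val_liminf True False by unfold_locales (rule val_liminf_eq)
  interpret limsup: valuation val_limsup True True by unfold_locales (rule val_limsup_eq)
  interpret supm: valuation val_supm False True by unfold_locales (rule val_supm_eq)
  show ?thesis
    using liminf.equiv_decidable limsup.equiv_decidable supm.equiv_decidable assms by blast
qed

end
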